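(* Let $f:B_1\times\mathbb{R}\to\mathbb{R}$ be bounded and satisfy assumption A. Then any (weak) solution $u$ of $\Delta u=f(x,u)$ in $B_1$ is $C^{1,1}$ in $B_{1/2}$.
   Context: $B_r(y)\subset\mathbb{R}^n$ ($n\ge 2$) is the open ball of radius $r$ centered at $y$, $B_r=B_r(0)$. A solution of $\Delta u=f(x,u)$ in $B_1$ is a bounded weak solution, where the function $f$ is measurable; such $u$ belongs to $W^{2,p}_{\mathrm{loc}}(B_1)$ for all $p<\infty$ and hence to $C^1(B_1)$. $C^{1,1}(B_{1/2})$ means $W^{2,\infty}(B_{1/2})$, i.e. second derivatives are bounded. Assumption A for a function $f=f(x,t)$ on $B_1\times\mathbb{R}$ consists of: (i) $|f(x,t_2)-f(x,t_1)|\le h(x)\,\omega(|t_2-t_1|)$ for all $x\in B_1$ and $t_1,t_2\in\mathbb{R}$, where $h\in L^\infty(B_1)$ and $\omega$ is a modulus of continuity (nonnegative, nondecreasing) with $\int_0^{\epsilon}\frac{\omega(t)}{t}\,dt<\infty$ for some $\epsilon>0$; (ii) with $N$ the Newtonian potential (fundamental solution of the Laplacian in $\mathbb{R}^n$) and $v_t:=f(\cdot,t)*N$ (with $f(\cdot,t)$ extended by $0$ outside $B_1$), one has $\sup_{a\le t\le b}\|D^2v_t\|_{L^\infty(B_1)}<\infty$ for all $a,b\in\mathbb{R}$. *)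

theory Defs
  imports "HOL-Analysis.Analysis"
begin

text \<open>
  Functions on an open set \<open>U\<close> are total functions of which only the values on \<open>U\<close> matter;
  all measure-theoretic notions refer to Lebesgue measure.
\<close>

definition partial_deriv :: "'a::euclidean_space \<Rightarrow> ('a \<Rightarrow> real) \<Rightarrow> 'a \<Rightarrow> real" where
  "partial_deriv i \<phi> x = frechet_derivative \<phi> (at x) i"

text \<open>A list \<open>ds\<close> of coordinate directions (elements of \<^term>\<open>Basis\<close>) plays the role of a
  multi-index of order \<open>length ds\<close>.\<close>

definition iter_partial :: "'a::euclidean_space list \<Rightarrow> ('a \<Rightarrow> real) \<Rightarrow> 'a \<Rightarrow> real" where
  "iter_partial ds \<phi> = foldr partial_deriv ds \<phi>"

definition laplacian :: "('a::euclidean_space \<Rightarrow> real) \<Rightarrow> 'a \<Rightarrow> real" where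
  "laplacian \<phi> x = (\<Sum>i\<in>Basis. iter_partial [i, i] \<phi> x)"

text \<open>\<open>C\<^sup>\<infinity>\<close>: all iterated partial derivatives exist and are (Frechet) differentiable, hence
  continuous.\<close>

definition smooth :: "('a::euclidean_space \<Rightarrow> real) \<Rightarrow> bool" where
  "smooth \<phi> \<longleftrightarrow> (\<forall>ds\<in>lists Basis. \<forall>x. iter_partial ds \<phi> differentiable (at x))"

definition test_functions :: "'a::euclidean_space set \<Rightarrow> ('a \<Rightarrow> real) set" where
  "test_functions U =
     {\<phi>. smooth \<phi> \<and> compact (closure {x. \<phi> x \<noteq> 0}) \<and> closure {x. \<phi> x \<noteq> 0} \<subseteq> U}"

definition locally_integrable :: "'a::euclidean_space set \<Rightarrow> ('a \<Rightarrow> real) \<Rightarrow> bool" where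
  "locally_integrable U g \<longleftrightarrow> (\<forall>K. compact K \<and> K \<subseteq> U \<longrightarrow> g absolutely_integrable_on K)"

definition L_infty :: "'a::euclidean_space set \<Rightarrow> ('a \<Rightarrow> real) \<Rightarrow> bool" where
  "L_infty U g \<longleftrightarrow>
     g \<in> borel_measurable (lebesgue_on U) \<and> (\<exists>C. AE x in lebesgue_on U. \<bar>g x\<bar> \<le> C)"

text \<open>\<open>g\<close> is the weak derivative of \<open>v\<close> on \<open>U\<close> for the multi-index \<open>ds\<close>.\<close>

definition weak_deriv ::
  "'a::euclidean_space set \<Rightarrow> 'a list \<Rightarrow> ('a \<Rightarrow> real) \<Rightarrow> ('a \<Rightarrow> real) \<Rightarrow> bool" where
  "weak_deriv U ds v g \<longleftrightarrow>
     locally_integrable U v \<and> locally_integrable U g \<and>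
     (\<forall>\<phi>\<in>test_functions U.
        (LINT x:U|lebesgue. v x * iter_partial ds \<phi> x)
          = (- 1) ^ length ds * (LINT x:U|lebesgue. g x * \<phi> x))"

text \<open>The Sobolev space \<open>W\<^bsup>k,\<infinity>\<^esup>(U)\<close>; the empty list \<open>ds\<close> gives that \<open>v\<close> itself is
  essentially bounded.\<close>

definition W_infty :: "nat \<Rightarrow> 'a::euclidean_space set \<Rightarrow> ('a \<Rightarrow> real) \<Rightarrow> bool" where
  "W_infty k U v \<longleftrightarrow>
     (\<forall>ds\<in>lists Basis. length ds \<le> k \<longrightarrow> (\<exists>g. L_infty U g \<and> weak_deriv U ds v g))"

definition C11_on :: "'a::euclidean_space set \<Rightarrow> ('a \<Rightarrow> real) \<Rightarrow> bool" where
  "C11_on U v \<longleftrightarrow> W_infty 2 U v"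

text \<open>\<open>\<parallel>D\<^sup>2v\<parallel> \<le> C\<close> in \<open>L\<^sup>\<infinity>(U)\<close>: the weak Hessian exists and its Euclidean (Frobenius) norm is
  essentially bounded by \<open>C\<close>.\<close>

definition weak_hessian_bound :: "'a::euclidean_space set \<Rightarrow> ('a \<Rightarrow> real) \<Rightarrow> real \<Rightarrow> bool" where
  "weak_hessian_bound U v C \<longleftrightarrow>
     (\<exists>H :: 'a \<Rightarrow> 'a \<Rightarrow> 'a \<Rightarrow> real.
        (\<forall>i\<in>Basis. \<forall>j\<in>Basis. weak_deriv U [i, j] v (H i j)) \<and>
        (AE x in lebesgue_on U. sqrt (\<Sum>i\<in>Basis. \<Sum>j\<in>Basis. (H i j x)\<^sup>2) \<le> C))"

text \<open>Fundamental solution of the Laplacian in dimension at least 2, normalised so that its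
  distributional Laplacian is the Dirac measure at 0. Its value at the origin is irrelevant.\<close>

definition newtonian_kernel :: "'a::euclidean_space \<Rightarrow> real" where
  "newtonian_kernel x =
     (if DIM('a) = 2 then ln (norm x) / (2 * pi)
      else - 1 / (real DIM('a) * (real DIM('a) - 2) * unit_ball_vol (real DIM('a))
                    * norm x ^ (DIM('a) - 2)))"

definition convolution ::
  "('a::euclidean_space \<Rightarrow> real) \<Rightarrow> ('a \<Rightarrow> real) \<Rightarrow> 'a \<Rightarrow> real" where
  "convolution g k x = (LINT y|lebesgue. g y * k (x - y))"

definition newtonian_potential :: "('a::euclidean_space \<Rightarrow> real \<Rightarrow> real) \<Rightarrow> real \<Rightarrow> 'a \<Rightarrow> real" where
  "newtonian_potential f t =
     convolution (\<lambda>y. if y \<in> ball 0 1 then f y t else 0) newtonian_kernel"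

definition modulus_of_continuity :: "(real \<Rightarrow> real) \<Rightarrow> bool" where
  "modulus_of_continuity \<omega> \<longleftrightarrow>
     (\<forall>s\<ge>0. 0 \<le> \<omega> s) \<and> mono_on {0..} \<omega> \<and> (\<omega> \<longlongrightarrow> 0) (at_right 0)"

definition dini :: "(real \<Rightarrow> real) \<Rightarrow> bool" where
  "dini \<omega> \<longleftrightarrow> (\<exists>\<epsilon>>0. set_integrable lborel {0<..<\<epsilon>} (\<lambda>s. \<omega> s / s))"

definition assumption_A :: "('a::euclidean_space \<Rightarrow> real \<Rightarrow> real) \<Rightarrow> bool" where
  "assumption_A f \<longleftrightarrow>
     (\<exists>h \<omega>. L_infty (ball 0 1) h \<and> modulus_of_continuity \<omega> \<and> dini \<omega> \<and>
        (\<forall>x\<in>ball 0 1. \<forall>t\<^sub>1 t\<^sub>2. \<bar>f x t\<^sub>2 - f x t\<^sub>1\<bar> \<le> h x * \<omega> \<bar>t\<^sub>2 - t\<^sub>1\<bar>)) \<and>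
     (\<forall>a b. \<exists>C. \<forall>t\<in>{a..b}. weak_hessian_bound (ball 0 1) (newtonian_potential f t) C)"

text \<open>Bounded weak solutions of \<open>\<Delta>u = f(x,u)\<close> on \<open>U\<close>, in the sense of distributions. No weak
  gradient is required of \<open>u\<close>, so solutions in the \<open>W\<^bsup>1,2\<^esup>\<close> sense are included.\<close>

definition weak_solution ::
  "'a::euclidean_space set \<Rightarrow> ('a \<Rightarrow> real \<Rightarrow> real) \<Rightarrow> ('a \<Rightarrow> real) \<Rightarrow> bool" where
  "weak_solution U f u \<longleftrightarrow>
     L_infty U u \<and> locally_integrable U (\<lambda>x. f x (u x)) \<and>
     (\<forall>\<phi>\<in>test_functions U.
        (LINT x:U|lebesgue. u x * laplacian \<phi> x) = (LINT x:U|lebesgue. f x (u x) * \<phi> x))"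

end

theory Submission
  imports Defs "HOL-Computational_Algebra.Polynomial"
begin

text \<open>
  The fundamental solution \<open>N\<close> of the Laplacian is, up to a constant factor, the sum of a smooth
  function and of layers \<open>\<beta>\<^sub>j\<close>, where \<open>\<beta>\<^sub>j\<close> is a rescaled copy of one smooth function \<open>\<beta>\<close> and is
  supported in the ball of radius \<open>2\<^sup>-\<^sup>j\<close>. Moreover \<open>\<Delta>\<beta>\<^sub>j = \<rho>\<^sub>j\<^sub>+\<^sub>1 - \<rho>\<^sub>j\<close> for an approximate identity
  \<open>\<rho>\<^sub>j\<close> of mass \<open>c > 0\<close>. Testing \<open>\<Delta>u = g\<close>, where \<open>g x = f x (u x)\<close>, with derivatives of the layers
  centred at \<open>x\<close> gives
  \<open>(u * D\<^sup>2\<rho>\<^sub>k) x = (u * D\<^sup>2\<rho>\<^sub>3) x + (\<Sum>j=3..<k. (g * D\<^sup>2\<beta>\<^sub>j) x)\<close>.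
  The same identity without derivatives shows that \<open>u\<close> is Lipschitz. For \<open>t\<close> close to \<open>u x\<close> split
  \<open>g = (g - f(\<cdot>, t)) + f(\<cdot>, t)\<close>. On the support of \<open>\<beta>\<^sub>j\<close> the first part is \<open>O(\<omega>(C 2\<^sup>-\<^sup>j))\<close> while
  \<open>D\<^sup>2\<beta>\<^sub>j\<close> has constant \<open>L\<^sup>1\<close> norm, so that its sum is bounded by the Dini condition. The sum of the
  second part is \<open>(H * (\<rho>\<^sub>k - \<rho>\<^sub>3)) x\<close> up to a constant, where \<open>H\<close> is the bounded Hessian of the potential
  of \<open>f(\<cdot>, t)\<close>. Hence \<open>u * D\<^sup>2\<rho>\<^sub>k\<close> is bounded uniformly in \<open>k\<close>, and a weak limit of it is \<open>c D\<^sup>2u\<close>.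
\<close>

section \<open>Smooth functions\<close>

text \<open>The difficulty is borderline scaling. Two derivatives of a layer cost exactly what its
  weight gains, so boundedness of \<open>g\<close> alone would give a bound growing linearly in
  \<open>k\<close>. Condition (i) of assumption A gives smallness only in t, and (ii) controls one
  frozen level t at a time. The Lipschitz bound for \<open>u\<close> links the two: distance 2^-j in
  x becomes distance O(2^-j) in t. This leaves room to pick it in a dense set: joint Lebesgue
  measurability of f directly yields Borel versions of f(., t) for almost every t. Scales start at 3
  because of the nested balls: 1/2 + 1/8 is below 3/4, where the Lipschitz bound is proved, and 3/4
  + 1/8 = 7/8 keeps the test functions inside the unit ball.\<close>

definition flat :: "real poly \<Rightarrow> real \<Rightarrow> real" where
  "flat p x = (if 0 < x then poly p (inverse x) * exp (- inverse x) else 0)"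

lemma poly_times_exp_tendsto_0: "((\<lambda>t::real. poly p t * exp (- t)) \<longlongrightarrow> 0) at_top"
proof -
  have "((\<lambda>t. \<Sum>i\<le>degree p. coeff p i * (t ^ i / exp t)) \<longlongrightarrow> (\<Sum>i\<le>degree p. coeff p i * 0)) at_top"
    by (intro tendsto_intros tendsto_power_div_exp_0)
  moreover have "(\<Sum>i\<le>degree p. coeff p i * (t ^ i / exp t)) = poly p t * exp (- t)" for t
    by (simp add: poly_altdef exp_minus divide_inverse sum_distrib_right mult.assoc)
  ultimately show ?thesis by simp
qed

text \<open>In the variable t = 1/x the derivative is - t^2 times d/dt, and d/dt (p e^-t) = (p' - p)
  e^-t; this is where the factor \<open>[:0, 0, 1:]\<close> comes from. The polynomial parameter of
  \<open>flat\<close> thus closes the family under differentiation.\<close>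

lemma DERIV_flat:
  "(flat p has_real_derivative flat ([:0, 0, 1:] * (p - pderiv p)) x) (at x)"
proof -
  consider "x > 0" | "x < 0" | "x = 0" by linarith
  then show ?thesis
  proof cases
    case 1
    have "((\<lambda>x. poly p (inverse x) * exp (- inverse x)) has_real_derivative
        flat ([:0, 0, 1:] * (p - pderiv p)) x) (at x)"
      using 1 by (auto intro!: derivative_eq_intros poly_DERIV[THEN DERIV_chain2]
          simp: flat_def field_simps power2_eq_square)
    then show ?thesis
      by (rule has_field_derivative_transform_within_open[where S = "{0<..}"]) (use 1 in \<open>auto simp: flat_def\<close>)
  next
    case 2
    have "((\<lambda>x. 0) has_real_derivative flat ([:0, 0, 1:] * (p - pderiv p)) x) (at x)"
      using 2 by (simp add: flat_def)
    then show ?thesis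
      by (rule has_field_derivative_transform_within_open[where S = "{..<0}"]) (use 2 in \<open>auto simp: flat_def\<close>)
  next
    case 3
    \<comment> \<open>At 0 the difference quotient \<open>flat p h / h\<close> equals t p(t) e^-t
      with t = 1/h, hence the extra factor \<open>[:0, 1:]\<close>.\<close>
    have "((\<lambda>t. poly ([:0, 1:] * p) t * exp (- t)) \<longlongrightarrow> 0) at_top"
      by (rule poly_times_exp_tendsto_0)
    then have "((\<lambda>h. poly ([:0, 1:] * p) (inverse h) * exp (- inverse h)) \<longlongrightarrow> 0) (at_right (0::real))"
      by (rule filterlim_compose[OF _ filterlim_inverse_at_top_right])
    then have r: "((\<lambda>h. flat p h / h) \<longlongrightarrow> 0) (at_right 0)"
      by (rule Lim_transform_eventually)
        (auto simp: flat_def field_simps eventually_at_right_less intro!: eventually_mono[OF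
            eventually_at_right_less])
    have l: "((\<lambda>h. flat p h / h) \<longlongrightarrow> 0) (at_left 0)"
      by (rule Lim_transform_eventually[OF tendsto_const])
        (auto simp: flat_def eventually_at_filter)
    have "((\<lambda>h. flat p h / h) \<longlongrightarrow> 0) (at 0)"
      using l r by (simp add: filterlim_split_at)
    then show ?thesis
      unfolding has_field_derivative_iff using 3 by (simp add: flat_def)
  qed
qed

text \<open>Every explicit test function used below is built by these rules; smoothness follows since the
  class is closed under partial derivatives.\<close>

inductive smooth_expr :: "('a::euclidean_space \<Rightarrow> real) \<Rightarrow> bool" where
  const: "smooth_expr (\<lambda>x. c)"
| inner: "smooth_expr (\<lambda>x. x \<bullet> b)"
| add: "smooth_expr \<phi> \<Longrightarrow> smooth_expr \<psi> \<Longrightarrow> smooth_expr (\<lambda>x. \<phi> x + \<psi> x)"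
| mult: "smooth_expr \<phi> \<Longrightarrow> smooth_expr \<psi> \<Longrightarrow> smooth_expr (\<lambda>x. \<phi> x * \<psi> x)"
| flat: "smooth_expr \<phi> \<Longrightarrow> smooth_expr (\<lambda>x. flat p (\<phi> x))"
| powr: "smooth_expr \<phi> \<Longrightarrow> (\<And>x. 0 < \<phi> x) \<Longrightarrow> smooth_expr (\<lambda>x. \<phi> x powr a)"
| chain: "smooth_expr \<phi> \<Longrightarrow> (\<And>x. (h has_real_derivative h' (\<phi> x)) (at (\<phi> x))) \<Longrightarrow>
    smooth_expr (\<lambda>x. h' (\<phi> x)) \<Longrightarrow> smooth_expr (\<lambda>x. h (\<phi> x))"

text \<open>The derivative is taken in a fixed direction \<open>b\<close>, so it is again a scalar
  function of the class and the statement can be iterated. The rule \<open>chain\<close> asks for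
  the outer derivative only on the range of the inner function; this admits the logarithm, whose
  derivative is covered by \<open>powr\<close>.\<close>

lemma smooth_expr_has_derivative:
  assumes "smooth_expr \<phi>"
  shows "\<exists>D. (\<forall>x. (\<phi> has_derivative D x) (at x)) \<and> (\<forall>b. smooth_expr (\<lambda>x. D x b))"
  using assms
proof induction
  case (const c)
  show ?case by (rule exI[of _ "\<lambda>x h. 0"]) (simp add: smooth_expr.const)
next
  case (inner b)
  show ?case by (rule exI[of _ "\<lambda>x h. h \<bullet> b"]) (auto intro!: smooth_expr.const derivative_eq_intros)
next
  case (add \<phi> \<psi>)
  then obtain D E where "\<And>x. (\<phi> has_derivative D x) (at x)" "\<And>b. smooth_expr (\<lambda>x. D x b)"
    "\<And>x. (\<psi> has_derivative E x) (at x)" "\<And>b. smooth_expr (\<lambda>x. E x b)" by blast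
  then show ?case
    by (intro exI[of _ "\<lambda>x h. D x h + E x h"]) (auto intro!: smooth_expr.add derivative_intros)
next
  case (mult \<phi> \<psi>)
  then obtain D E where "\<And>x. (\<phi> has_derivative D x) (at x)" "\<And>b. smooth_expr (\<lambda>x. D x b)"
    "\<And>x. (\<psi> has_derivative E x) (at x)" "\<And>b. smooth_expr (\<lambda>x. E x b)" by blast
  then show ?case using mult.hyps
    by (intro exI[of _ "\<lambda>x h. \<phi> x * E x h + D x h * \<psi> x"])
        (auto intro!: smooth_expr.add smooth_expr.mult derivative_intros)
next
  case (flat \<phi> p)
  then obtain D where D: "\<And>x. (\<phi> has_derivative D x) (at x)" "\<And>b. smooth_expr (\<lambda>x. D x b)" by blast
  show ?case
  proof (intro exI[of _ "\<lambda>x h. flat ([:0, 0, 1:] * (p - pderiv p)) (\<phi> x) * D x h"] conjI allI)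
    fix x
    show "((\<lambda>x. flat p (\<phi> x)) has_derivative (\<lambda>h. flat ([:0, 0, 1:] * (p - pderiv p)) (\<phi> x) * D x h)) (at x)"
      using has_derivative_compose[OF D(1) DERIV_flat[unfolded has_field_derivative_def], of p x] by simp
  qed (intro smooth_expr.mult smooth_expr.flat flat.hyps D)
next
  case (powr \<phi> a)
  then obtain D where D: "\<And>x. (\<phi> has_derivative D x) (at x)" "\<And>b. smooth_expr (\<lambda>x. D x b)" by blast
  show ?case
  proof (intro exI[of _ "\<lambda>x h. (a * \<phi> x powr (a - 1)) * D x h"] conjI allI)
    fix x
    have "((\<lambda>s. s powr a) has_real_derivative a * \<phi> x powr (a - 1)) (at (\<phi> x))"
      using powr.hyps(2) by (rule has_real_derivative_powr)
    from has_derivative_compose[OF D(1) this[unfolded has_field_derivative_def]]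
    show "((\<lambda>x. \<phi> x powr a) has_derivative (\<lambda>h. a * \<phi> x powr (a - 1) * D x h)) (at x)" by simp
  qed (intro smooth_expr.mult smooth_expr.const smooth_expr.powr powr.hyps D)
next
  case (chain \<phi> h h')
  then obtain D where D: "\<And>x. (\<phi> has_derivative D x) (at x)" "\<And>b. smooth_expr (\<lambda>x. D x b)" by blast
  show ?case
  proof (intro exI[of _ "\<lambda>x k. h' (\<phi> x) * D x k"] conjI allI)
    fix x
    from has_derivative_compose[OF D(1) chain.hyps(2)[unfolded has_field_derivative_def]]
    show "((\<lambda>x. h (\<phi> x)) has_derivative (\<lambda>k. h' (\<phi> x) * D x k)) (at x)" by simp
  qed (intro smooth_expr.mult chain.hyps D)
qed

lemma partial_deriv_eq: "(\<phi> has_derivative D) (at x) \<Longrightarrow> partial_deriv b \<phi> x = D b"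
  unfolding partial_deriv_def using frechet_derivative_at by fastforce

lemma smooth_expr_partial_deriv: "smooth_expr \<phi> \<Longrightarrow> smooth_expr (partial_deriv b \<phi>)"
proof -
  assume "smooth_expr \<phi>"
  then obtain D where D: "\<And>x. (\<phi> has_derivative D x) (at x)" "smooth_expr (\<lambda>x. D x b)"
    using smooth_expr_has_derivative by blast
  have "partial_deriv b \<phi> = (\<lambda>x. D x b)" using partial_deriv_eq[OF D(1)] by auto
  with D show ?thesis by simp
qed

section \<open>Iterated partial derivatives: affine substitution, sums, supports, symmetry\<close>

lemma iter_partial_simps [simp]:
  "iter_partial [] \<phi> = \<phi>" "iter_partial (d # ds) \<phi> = partial_deriv d (iter_partial ds \<phi>)"
  by (simp_all add: iter_partial_def)

lemma iter_partial_append: "iter_partial (ds @ es) \<phi> = iter_partial ds (iter_partial es \<phi>)"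
  by (simp add: iter_partial_def)

lemma smooth_expr_iter_partial: "smooth_expr \<phi> \<Longrightarrow> smooth_expr (iter_partial ds \<phi>)"
  by (induction ds) (auto intro: smooth_expr_partial_deriv)

lemma smooth_expr_imp_smooth: "smooth_expr \<phi> \<Longrightarrow> smooth \<phi>"
  unfolding smooth_def
  by (meson differentiable_def smooth_expr_has_derivative smooth_expr_iter_partial)

lemma smooth_iter_partial: "smooth \<phi> \<Longrightarrow> ds \<in> lists Basis \<Longrightarrow> smooth (iter_partial ds \<phi>)"
  unfolding smooth_def by (metis append_in_lists_conv iter_partial_append)

lemma smooth_partial_deriv: "smooth \<phi> \<Longrightarrow> b \<in> Basis \<Longrightarrow> smooth (partial_deriv b \<phi>)"
  using smooth_iter_partial[of \<phi> "[b]"] by simp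

lemma smooth_imp_differentiable: "smooth \<phi> \<Longrightarrow> \<phi> differentiable (at x)"
  unfolding smooth_def by (metis iter_partial_simps(1) lists.Nil)

lemma smooth_has_derivative: "smooth \<phi> \<Longrightarrow> (\<phi> has_derivative (\<lambda>h. partial_deriv h \<phi> x)) (at x)"
  using smooth_imp_differentiable[of \<phi> x] unfolding partial_deriv_def
  by (simp add: frechet_derivative_works)

lemma smooth_imp_continuous_on: "smooth \<phi> \<Longrightarrow> continuous_on S \<phi>"
  by (meson continuous_at_imp_continuous_on differentiable_imp_continuous_within smooth_imp_differentiable)

lemma smooth_borel_measurable: "smooth \<phi> \<Longrightarrow> \<phi> \<in> borel_measurable borel"
  by (rule borel_measurable_continuous_onI) (rule smooth_imp_continuous_on)

lemma iter_partial_affine: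
  assumes "smooth \<phi>" "ds \<in> lists Basis"
  shows "iter_partial ds (\<lambda>y. c * \<phi> (a *\<^sub>R y + b)) = (\<lambda>y. c * a ^ length ds * iter_partial ds \<phi> (a *\<^sub>R y + b))"
  using assms(2)
proof (induction ds)
  case Nil
  then show ?case by simp
next
  case (Cons d ds)
  have s: "smooth (iter_partial ds \<phi>)" using Cons assms(1) smooth_iter_partial by auto
  have "((\<lambda>y. c * a ^ length ds * iter_partial ds \<phi> (a *\<^sub>R y + b)) has_derivative
     (\<lambda>h. c * a ^ length ds * partial_deriv (a *\<^sub>R h) (iter_partial ds \<phi>) (a *\<^sub>R y + b))) (at y)" for y
    by (rule derivative_eq_intros has_derivative_compose[OF _ smooth_has_derivative[OF s]] refl | simp)+
  moreover have "partial_deriv (a *\<^sub>R d) (iter_partial ds \<phi>) y = a * partial_deriv d (iter_partial ds \<phi>) y" for y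
    using linear_cmul[OF has_derivative_linear[OF smooth_has_derivative[OF s]]] by simp
  ultimately have "partial_deriv d (\<lambda>y. c * a ^ length ds * iter_partial ds \<phi> (a *\<^sub>R y + b)) y =
    c * a ^ length ds * (a * partial_deriv d (iter_partial ds \<phi>) (a *\<^sub>R y + b))" for y
    using partial_deriv_eq by metis
  moreover have "iter_partial ds (\<lambda>y. c * \<phi> (a *\<^sub>R y + b))
      = (\<lambda>y. c * a ^ length ds * iter_partial ds \<phi> (a *\<^sub>R y + b))"
    using Cons by blast
  ultimately show ?case by (intro ext) (simp add: mult_ac)
qed

lemma smooth_affine:
  fixes \<phi> :: "'a::euclidean_space \<Rightarrow> real"
  assumes "smooth \<phi>" shows "smooth (\<lambda>y. c * \<phi> (a *\<^sub>R y + b))"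
  unfolding smooth_def
proof (intro ballI allI)
  fix ds :: "'a list" and x assume ds: "ds \<in> lists Basis"
  have s: "smooth (iter_partial ds \<phi>)" using ds assms smooth_iter_partial by auto
  have "((\<lambda>y. c * a ^ length ds * iter_partial ds \<phi> (a *\<^sub>R y + b)) has_derivative
     (\<lambda>h. c * a ^ length ds * partial_deriv (a *\<^sub>R h) (iter_partial ds \<phi>) (a *\<^sub>R x + b))) (at x)"
    by (rule derivative_eq_intros has_derivative_compose[OF _ smooth_has_derivative[OF s]] refl | simp)+
  then show "iter_partial ds (\<lambda>y. c * \<phi> (a *\<^sub>R y + b)) differentiable (at x)"
    unfolding iter_partial_affine[OF assms ds] differentiable_def by blast
qed

lemma iter_partial_add:
  assumes "smooth \<phi>" "smooth \<psi>" "ds \<in> lists Basis"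
  shows "iter_partial ds (\<lambda>y. \<phi> y + \<psi> y) = (\<lambda>y. iter_partial ds \<phi> y + iter_partial ds \<psi> y)"
  using assms(3)
proof (induction ds)
  case Nil
  then show ?case by simp
next
  case (Cons d ds)
  have s: "smooth (iter_partial ds \<phi>)" "smooth (iter_partial ds \<psi>)"
    using Cons assms smooth_iter_partial by auto
  have "partial_deriv d (\<lambda>y. iter_partial ds \<phi> y + iter_partial ds \<psi> y) y =
    partial_deriv d (iter_partial ds \<phi>) y + partial_deriv d (iter_partial ds \<psi>) y" for y
    by (rule partial_deriv_eq[OF has_derivative_add[OF s[THEN smooth_has_derivative]]])
  moreover have "iter_partial ds (\<lambda>y. \<phi> y + \<psi> y) = (\<lambda>y. iter_partial ds \<phi> y + iter_partial ds \<psi> y)"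
    using Cons by blast
  ultimately show ?case by (intro ext) simp
qed

lemma smooth_add:
  assumes "smooth \<phi>" "smooth \<psi>" shows "smooth (\<lambda>y. \<phi> y + \<psi> y)"
  unfolding smooth_def
  using assms by (auto simp: iter_partial_add intro!: differentiable_add) (auto simp: smooth_def)

lemma iter_partial_zero_outside:
  assumes "closed S" "\<And>z. z \<notin> S \<Longrightarrow> \<phi> z = 0" "z \<notin> S"
  shows "iter_partial ds \<phi> z = 0"
  using assms(3)
proof (induction ds arbitrary: z)
  case Nil
  then show ?case using assms by simp
next
  case (Cons d ds)
  have "((\<lambda>x. 0::real) has_derivative (\<lambda>h. 0)) (at z)" by simp
  then have "(iter_partial ds \<phi> has_derivative (\<lambda>h. 0)) (at z)"
    by (rule has_derivative_transform_within_open[of _ _ _ UNIV "- S", simplified])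
      (use assms Cons in auto)
  then show ?case by (simp add: partial_deriv_eq)
qed

lemma mvt_partial_deriv:
  assumes "smooth \<phi>" "0 < h"
  shows "\<exists>\<xi>. 0 < \<xi> \<and> \<xi> < h \<and> \<phi> (x + h *\<^sub>R b) - \<phi> x = h * partial_deriv b \<phi> (x + \<xi> *\<^sub>R b)"
proof -
  have d: "((\<lambda>s. \<phi> (x + s *\<^sub>R b)) has_real_derivative partial_deriv b \<phi> (x + s *\<^sub>R b)) (at s)" for s
  proof -
    have "((\<lambda>s. \<phi> (x + s *\<^sub>R b)) has_derivative (\<lambda>h. partial_deriv (h *\<^sub>R b) \<phi> (x + s *\<^sub>R b))) (at s)"
      by (rule has_derivative_compose[OF _ smooth_has_derivative[OF assms(1)]])
        (auto intro!: derivative_eq_intros)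
    then show ?thesis
      using linear_cmul[OF has_derivative_linear[OF smooth_has_derivative[OF assms(1), of "x + s *\<^sub>R b"]], of _ b]
      by (simp add: has_field_derivative_def mult_commute_abs)
  qed
  from MVT2[OF assms(2), of "\<lambda>s. \<phi> (x + s *\<^sub>R b)", OF d] show ?thesis by auto
qed

lemma partial_deriv_diff_translate:
  assumes "smooth \<phi>" "d \<in> Basis"
  shows "smooth (\<lambda>y. \<phi> (y + v) - \<phi> y)"
    and "partial_deriv d (\<lambda>y. \<phi> (y + v) - \<phi> y) y = partial_deriv d \<phi> (y + v) - partial_deriv d \<phi> y"
proof -
  have s: "smooth (\<lambda>y. \<phi> (y + v))" "smooth (\<lambda>y. - \<phi> y)"
    using smooth_affine[OF assms(1), of 1 1 v] smooth_affine[OF assms(1), of "-1" 1 0] by simp_all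
  from smooth_add[OF this] show "smooth (\<lambda>y. \<phi> (y + v) - \<phi> y)" by simp
  show "partial_deriv d (\<lambda>y. \<phi> (y + v) - \<phi> y) y = partial_deriv d \<phi> (y + v) - partial_deriv d \<phi> y"
    using iter_partial_add[OF s, of "[d]"] iter_partial_affine[OF assms(1), of "[d]" 1 1 v]
      iter_partial_affine[OF assms(1), of "[d]" "-1" 1 0] assms(2) by (simp add: fun_eq_iff)
qed

text \<open>Both mixed derivatives are approximated by the same second difference quotient.\<close>

lemma partial_deriv_commute:
  assumes s: "smooth \<phi>" and b: "i \<in> Basis" "j \<in> Basis"
  shows "partial_deriv i (partial_deriv j \<phi>) x = partial_deriv j (partial_deriv i \<phi>) x"
proof -
  have mean: "\<exists>p. norm (p - x) \<le> 2 * h \<and>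
      \<phi> (x + h *\<^sub>R i + h *\<^sub>R j) - \<phi> (x + h *\<^sub>R i) - \<phi> (x + h *\<^sub>R j) + \<phi> x
          = h * h * partial_deriv j (partial_deriv i \<phi>) p"
    if b: "i \<in> Basis" "j \<in> Basis" and h: "0 < h" for h i j
  proof -
    \<comment> \<open>The mean value theorem is applied in direction \<open>i\<close> to the
      increment of \<phi> over \<open>h *\<^sub>R j\<close>, then in direction \<open>j\<close> to
      the \<open>i\<close>-derivative. The second difference is symmetric in \<open>i\<close> and
      \<open>j\<close>, so exchanging them reaches the other mixed derivative.\<close>
    obtain \<xi> where \<xi>: "0 < \<xi>" "\<xi> < h"
      "(\<phi> (x + h *\<^sub>R i + h *\<^sub>R j) - \<phi> (x + h *\<^sub>R i)) - (\<phi> (x + h *\<^sub>R j) - \<phi> x) =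
        h * (partial_deriv i \<phi> (x + \<xi> *\<^sub>R i + h *\<^sub>R j) - partial_deriv i \<phi> (x + \<xi> *\<^sub>R i))"
      using mvt_partial_deriv[OF partial_deriv_diff_translate(1)[OF s b(1), of "h *\<^sub>R j"] h, of x i]
      by (auto simp: partial_deriv_diff_translate(2)[OF s b(1)])
    obtain \<eta> where \<eta>: "0 < \<eta>" "\<eta> < h"
      "partial_deriv i \<phi> (x + \<xi> *\<^sub>R i + h *\<^sub>R j) - partial_deriv i \<phi> (x + \<xi> *\<^sub>R i)
        = h * partial_deriv j (partial_deriv i \<phi>) (x + \<xi> *\<^sub>R i + \<eta> *\<^sub>R j)"
      using mvt_partial_deriv[OF smooth_partial_deriv[OF s b(1)] h] by blast
    have "norm (\<xi> *\<^sub>R i + \<eta> *\<^sub>R j) \<le> norm (\<xi> *\<^sub>R i) + norm (\<eta> *\<^sub>R j)" by (rule norm_triangle_ineq)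
    also have "\<dots> \<le> 2 * h" using \<xi> \<eta> b by simp
    finally show ?thesis using \<xi> \<eta> by (intro exI[of _ "x + \<xi> *\<^sub>R i + \<eta> *\<^sub>R j"]) (auto simp: algebra_simps)
  qed
  have "\<exists>p q. norm (p - x) \<le> 2 / Suc n \<and> norm (q - x) \<le> 2 / Suc n \<and>
      partial_deriv i (partial_deriv j \<phi>) p = partial_deriv j (partial_deriv i \<phi>) q" for n
  proof -
    define h where "h = 1 / real (Suc n)"
    have h: "0 < h" by (simp add: h_def)
    obtain q where q: "norm (q - x) \<le> 2 * h"
      "\<phi> (x + h *\<^sub>R i + h *\<^sub>R j) - \<phi> (x + h *\<^sub>R i) - \<phi> (x + h *\<^sub>R j) + \<phi> x
        = h * h * partial_deriv j (partial_deriv i \<phi>) q"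
      using mean[OF b h] by blast
    obtain p where p: "norm (p - x) \<le> 2 * h"
      "\<phi> (x + h *\<^sub>R j + h *\<^sub>R i) - \<phi> (x + h *\<^sub>R j) - \<phi> (x + h *\<^sub>R i) + \<phi> x
        = h * h * partial_deriv i (partial_deriv j \<phi>) p"
      using mean[OF b(2,1) h] by blast
    have e: "x + h *\<^sub>R j + h *\<^sub>R i = x + h *\<^sub>R i + h *\<^sub>R j" by (simp add: add_ac)
    have "h * h * partial_deriv i (partial_deriv j \<phi>) p = h * h * partial_deriv j (partial_deriv i \<phi>) q"
      using p(2)[unfolded e] q(2) by linarith
    then have "partial_deriv i (partial_deriv j \<phi>) p = partial_deriv j (partial_deriv i \<phi>) q"
      using h by simp
    then show ?thesis using p(1) q(1) by (auto simp: h_def)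
  qed
  then obtain p q where pq: "\<And>n. norm (p n - x) \<le> 2 / Suc n" "\<And>n. norm (q n - x) \<le> 2 / Suc n"
      "\<And>n. partial_deriv i (partial_deriv j \<phi>) (p n) = partial_deriv j (partial_deriv i \<phi>) (q n)"
    by metis
  have z: "(\<lambda>n. 2 / real (Suc n)) \<longlonglongrightarrow> 0"
    by (intro real_tendsto_divide_at_top[OF tendsto_const] filterlim_compose[OF filterlim_real_sequentially
        filterlim_Suc])
  have p: "p \<longlonglongrightarrow> x" and q: "q \<longlonglongrightarrow> x"
    by (rule LIM_zero_cancel, rule Lim_null_comparison[OF _ z], use pq in auto)+
  have c: "isCont (partial_deriv i (partial_deriv j \<phi>)) x" "isCont (partial_deriv j (partial_deriv i \<phi>)) x"
    using smooth_imp_continuous_on[of _ UNIV] smooth_partial_deriv[OF smooth_partial_deriv[OF s]] b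
    by (metis UNIV_I continuous_on_eq_continuous_at open_UNIV)+
  have "(\<lambda>n. partial_deriv i (partial_deriv j \<phi>) (p n)) \<longlonglongrightarrow> partial_deriv i (partial_deriv j \<phi>) x"
     "(\<lambda>n. partial_deriv j (partial_deriv i \<phi>) (q n)) \<longlonglongrightarrow> partial_deriv j (partial_deriv i \<phi>) x"
    using isCont_tendsto_compose[OF c(1) p] isCont_tendsto_compose[OF c(2) q] by auto
  then show ?thesis unfolding pq(3) by (rule LIMSEQ_unique)
qed

lemma iter_partial_partial_deriv:
  assumes "smooth \<phi>" "ds \<in> lists Basis" "i \<in> Basis"
  shows "iter_partial ds (partial_deriv i \<phi>) = partial_deriv i (iter_partial ds \<phi>)"
  using assms(2)
proof (induction ds)
  case (Cons d ds)
  then have "iter_partial ds (partial_deriv i \<phi>) = partial_deriv i (iter_partial ds \<phi>)" by blast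
  then show ?case
    using partial_deriv_commute[OF smooth_iter_partial[OF assms(1), of ds], of d i] assms Cons.hyps
    by (intro ext) simp
qed simp

lemma smooth_sum_apply:
  fixes \<phi> :: "'i \<Rightarrow> 'a::euclidean_space \<Rightarrow> real"
  assumes "finite I" "\<And>i. i \<in> I \<Longrightarrow> smooth (\<phi> i)"
  shows "smooth (\<lambda>x. \<Sum>i\<in>I. \<phi> i x)"
    and "ds \<in> lists Basis \<Longrightarrow> iter_partial ds (\<lambda>x. \<Sum>i\<in>I. \<phi> i x) = (\<lambda>x. \<Sum>i\<in>I. iter_partial ds (\<phi> i) x)"
proof -
  have "smooth (\<lambda>x. \<Sum>i\<in>I. \<phi> i x) \<and> (ds \<in> lists Basis \<longrightarrow> iter_partial ds (\<lambda>x. \<Sum>i\<in>I. \<phi> i x)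
      = (\<lambda>x. \<Sum>i\<in>I. iter_partial ds (\<phi> i) x))" for ds
    using assms
  proof (induction I)
    case empty
    have "iter_partial ds (\<lambda>x::'a. 0) = (\<lambda>x. 0)"
      using iter_partial_zero_outside[of "{}" "\<lambda>x::'a. 0"] by auto
    then show ?case by (simp add: smooth_expr_imp_smooth smooth_expr.const)
  next
    case (insert i I)
    then show ?case by (auto simp: smooth_add iter_partial_add)
  qed
  then show "smooth (\<lambda>x. \<Sum>i\<in>I. \<phi> i x)"
    and "ds \<in> lists Basis \<Longrightarrow> iter_partial ds (\<lambda>x. \<Sum>i\<in>I. \<phi> i x) = (\<lambda>x. \<Sum>i\<in>I. iter_partial ds (\<phi> i) x)" by blast+
qed

section \<open>The Laplacian: sums, affine substitution, commutation with derivatives\<close>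

lemma laplacian_eq: "laplacian \<phi> = (\<lambda>x. \<Sum>i\<in>Basis. iter_partial [i, i] \<phi> x)"
  by (simp add: laplacian_def fun_eq_iff)

lemma smooth_laplacian: "smooth \<phi> \<Longrightarrow> smooth (laplacian \<phi>)"
  unfolding laplacian_eq by (intro smooth_sum_apply smooth_iter_partial) auto

lemma laplacian_iter_partial:
  assumes "smooth \<phi>" "ds \<in> lists Basis"
  shows "laplacian (iter_partial ds \<phi>) = iter_partial ds (laplacian \<phi>)"
proof -
  have "iter_partial [i, i] (iter_partial ds \<phi>) = iter_partial ds (iter_partial [i, i] \<phi>)" if "i \<in> Basis" for i
    unfolding iter_partial_simps
      iter_partial_partial_deriv[OF smooth_partial_deriv[OF assms(1) that] assms(2) that]
      iter_partial_partial_deriv[OF assms that] ..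
  then have 1: "laplacian (iter_partial ds \<phi>) = (\<lambda>x. \<Sum>i\<in>Basis. iter_partial ds (iter_partial [i, i] \<phi>) x)"
    unfolding laplacian_def by (intro ext sum.cong refl) (simp only:)
  have 2: "smooth (iter_partial [i, i] \<phi>)" if "i \<in> Basis" for i
    by (rule smooth_iter_partial) (use assms that in simp_all)
  have 3: "iter_partial ds (\<lambda>x. \<Sum>i\<in>Basis. iter_partial [i, i] \<phi> x)
      = (\<lambda>x. \<Sum>i\<in>Basis. iter_partial ds (iter_partial [i, i] \<phi>) x)"
    by (rule smooth_sum_apply(2)[of Basis "\<lambda>i. iter_partial [i, i] \<phi>", OF finite_Basis 2 assms(2)])
  have 4: "laplacian \<phi> = (\<lambda>x. \<Sum>i\<in>Basis. iter_partial [i, i] \<phi> x)"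
    by (rule laplacian_eq)
  show ?thesis by (simp only: 1 3 4)
qed

lemma laplacian_affine:
  assumes "smooth \<phi>"
  shows "laplacian (\<lambda>y. c * \<phi> (a *\<^sub>R y + b)) = (\<lambda>y. c * a\<^sup>2 * laplacian \<phi> (a *\<^sub>R y + b))"
proof -
  have "iter_partial [i, i] (\<lambda>y. c * \<phi> (a *\<^sub>R y + b)) = (\<lambda>y. c * a\<^sup>2 * iter_partial [i, i] \<phi> (a *\<^sub>R y + b))"
    if "i \<in> Basis" for i
    using iter_partial_affine[OF assms, of "[i, i]" c a b] that by (simp add: power2_eq_square)
  then show ?thesis
    unfolding laplacian_eq sum_distrib_left by (intro ext sum.cong refl) (simp only:)
qed

lemma laplacian_add:
  assumes "smooth \<phi>" "smooth \<psi>"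
  shows "laplacian (\<lambda>y. \<phi> y + \<psi> y) = (\<lambda>y. laplacian \<phi> y + laplacian \<psi> y)"
proof -
  have "iter_partial [i, i] (\<lambda>y. \<phi> y + \<psi> y) = (\<lambda>y. iter_partial [i, i] \<phi> y + iter_partial [i, i] \<psi> y)"
    if "i \<in> Basis" for i
    by (rule iter_partial_add[OF assms]) (use that in simp)
  then have "(\<Sum>i\<in>Basis. iter_partial [i, i] (\<lambda>y. \<phi> y + \<psi> y) x) =
    (\<Sum>i\<in>Basis. iter_partial [i, i] \<phi> x + iter_partial [i, i] \<psi> x)" for x
    by (intro sum.cong refl) (simp only:)
  then show ?thesis unfolding laplacian_eq by (simp only: sum.distrib)
qed

section \<open>Dyadic decomposition of the fundamental solution\<close>

text \<open>\<open>profile s\<close> is positive for \<open>s \<ge> 0\<close> and equal to \<open>s\<close> for \<open>s \<ge> 1\<close>, so \<open>regular_kernel\<close> is a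
  globally smooth function that coincides with the radial fundamental solution outside the unit ball.
  The factor \<open>1/2\<close> in the argument of \<open>flat\<close> keeps that argument in the range \<open>x \<le> 1/2\<close> where
  \<open>exp (- 1/x)\<close> is convex; this makes \<open>regular_kernel\<close> subharmonic.\<close>

definition profile :: "real \<Rightarrow> real" where
  "profile s = s + flat [:1:] ((1 - s) / 2)"

definition profile' :: "real \<Rightarrow> real" where
  "profile' s = 1 - flat [:0, 0, 1:] ((1 - s) / 2) / 2"

definition profile'' :: "real \<Rightarrow> real" where
  "profile'' s = flat [:0, 0, 0, -2, 1:] ((1 - s) / 2) / 4"

text \<open>The radial fundamental solution as a function of s = |z|^2, scaled so that its gradient
  in z is z/|z|^n in every dimension. Using |z|^2 keeps the norm, which is not differentiable at 0,
  out of the smooth expressions.\<close>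

definition radial_kernel :: "nat \<Rightarrow> real \<Rightarrow> real" where
  "radial_kernel n s = (if n = 2 then ln s / 2 else s powr (1 - real n / 2) / (2 - real n))"

definition regular_kernel :: "'a::euclidean_space \<Rightarrow> real" where
  "regular_kernel z = radial_kernel DIM('a) (profile (z \<bullet> z))"

text \<open>This is the density \<rho> behind the approximate identity: smooth, nonnegative and zero
  outside the unit ball. Its mass c stays an unevaluated integral, of which positivity is
  proved.\<close>

definition kernel_density :: "'a::euclidean_space \<Rightarrow> real" where
  "kernel_density = laplacian regular_kernel"

text \<open>The correction accounts for the failure of the logarithm to be homogeneous.\<close>

definition log_defect :: "nat \<Rightarrow> real" where
  "log_defect n = (if n = 2 then ln 2 else 0)"

text \<open>The basic layer \<beta>. The first term minus \<open>log_defect\<close> is the kernel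
  smoothed at radius 1/2, and the kernel smoothed at radius 1 is subtracted from it; outside the
  unit ball both are the fundamental solution and cancel. The minus signs are written as scalar
  factors and summands so that the scaling and sum rules apply literally.\<close>

definition kernel_step :: "'a::euclidean_space \<Rightarrow> real" where
  "kernel_step z = (2 ^ (DIM('a) - 2) * regular_kernel (2 *\<^sub>R z) + (- 1) * regular_kernel z) + - log_defect
      DIM('a)"

section \<open>Sign and support of the density\<close>

lemma flat_nonpos [simp]: "x \<le> 0 \<Longrightarrow> flat p x = 0"
  by (simp add: flat_def)

lemma DERIV_profile: "(profile has_real_derivative profile' s) (at s)"
proof -
  have "((\<lambda>s. flat [:1:] ((1 - s) / 2)) has_real_derivative flat [:0, 0, 1:] ((1 - s) / 2) * (- 1 / 2)) (at s)"
    by (rule DERIV_chain2[OF DERIV_flat[of "[:1:]", simplified]]) (auto intro!: derivative_eq_intros)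
  then show ?thesis
    unfolding profile_def[abs_def] profile'_def
    by (auto intro!: derivative_eq_intros)
qed

lemma DERIV_profile': "(profile' has_real_derivative profile'' s) (at s)"
proof -
  have "((\<lambda>s. flat [:0, 0, 1:] ((1 - s) / 2)) has_real_derivative flat [:0, 0, 0, -2, 1:] ((1 - s) / 2) * (-
      1 / 2)) (at s)"
    by (rule DERIV_chain2[OF DERIV_flat[of "[:0, 0, 1:]", simplified pderiv_pCons, simplified]])
        (auto intro!: derivative_eq_intros)
  then show ?thesis
    unfolding profile'_def[abs_def] profile''_def
    by (auto intro!: derivative_eq_intros)
qed

lemma flat_nonneg: "(\<And>t. t \<ge> 0 \<Longrightarrow> poly p t \<ge> 0) \<Longrightarrow> flat p x \<ge> 0"
  by (simp add: flat_def)

lemma profile_pos: "0 \<le> s \<Longrightarrow> 0 < profile s"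
  by (cases "s = 0") (auto simp: profile_def flat_def add_pos_nonneg)

lemma profile_eq: "1 \<le> s \<Longrightarrow> profile s = s"
  and profile'_eq: "1 \<le> s \<Longrightarrow> profile' s = 1"
  and profile''_eq: "1 \<le> s \<Longrightarrow> profile'' s = 0"
  by (simp_all add: profile_def profile'_def profile''_def)

text \<open>With t = 1/x this says t^2/2 < exp t. The constant 2 is what makes
  \<open>profile'\<close> positive.\<close>

lemma flat_square_less: "flat [:0, 0, 1:] x < 2"
proof (cases "x > 0")
  case True
  have "(inverse x)\<^sup>2 / 2 < exp (inverse x)"
    using exp_lower_Taylor_quadratic[of "inverse x"] positive_imp_inverse_positive[OF True] by linarith
  moreover have "flat [:0, 0, 1:] x = (inverse x)\<^sup>2 / exp (inverse x)"
    using True by (simp add: flat_def power2_eq_square exp_minus divide_inverse)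
  ultimately show ?thesis by (simp add: pos_divide_less_eq)
qed simp

lemma profile'_pos: "0 < profile' s"
  using flat_square_less[of "(1 - s) / 2"] by (simp add: profile'_def)

lemma profile''_nonneg: "0 \<le> s \<Longrightarrow> 0 \<le> profile'' s"
proof (cases "s < 1")
  case True
  assume "0 \<le> s"
  define x where "x = (1 - s) / 2"
  define t where "t = inverse x"
  have x: "0 < x" "x \<le> 1 / 2" using True \<open>0 \<le> s\<close> by (auto simp: x_def)
  \<comment> \<open>The lower bound 2 is the positive root of t^4 - 2 t^3, the polynomial in
    \<open>profile''\<close>.\<close>
  have t: "2 \<le> t" "0 < t" using x by (auto simp: t_def field_simps)
  have "profile'' s = flat [:0, 0, 0, -2, 1:] x / 4" by (simp add: profile''_def x_def)
  also have "\<dots> = t ^ 3 * (t - 2) * exp (- t) / 4"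
    unfolding flat_def t_def[symmetric] using x(1) by (simp add: algebra_simps power3_eq_cube)
  also have "\<dots> \<ge> 0" using t by simp
  finally show ?thesis .
qed (simp add: profile''_def)

lemma profile_diff_nonneg: "0 \<le> s \<Longrightarrow> 0 \<le> profile s - s * profile' s"
  using flat_nonneg[of "[:1:]" "(1 - s) / 2"] flat_nonneg[of "[:0, 0, 1:]" "(1 - s) / 2"]
  by (simp add: profile_def profile'_def algebra_simps)

lemma DERIV_radial_kernel:
  assumes "0 < s"
  shows "(radial_kernel n has_real_derivative (1 / 2) * s powr (- real n / 2)) (at s)"
proof (cases "n = 2")
  case True
  have "((\<lambda>s. ln s / 2) has_real_derivative inverse s / 2) (at s)"
    using DERIV_cdivide[OF DERIV_ln[OF assms], of 2] by simp
  moreover have "s powr (- real n / 2) = inverse s"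
    using True assms by (simp add: powr_minus)
  ultimately show ?thesis
    unfolding radial_kernel_def[abs_def] using True by simp
next
  case False
  have "((\<lambda>s. s powr (1 - real n / 2) / (2 - real n)) has_real_derivative
     ((1 - real n / 2) * s powr (1 - real n / 2 - 1)) / (2 - real n)) (at s)"
    by (rule DERIV_cdivide[OF has_real_derivative_powr[OF assms]])
  moreover have "(1 - real n / 2) / (2 - real n) = 1 / 2" using False by (simp add: field_simps)
  moreover have "((1 - real n / 2) * s powr (1 - real n / 2 - 1)) / (2 - real n) =
      (1 - real n / 2) / (2 - real n) * s powr (1 - real n / 2 - 1)"
    by (simp only: times_divide_eq_left)
  moreover have "1 - real n / 2 - 1 = - real n / 2" by simp
  ultimately have "((\<lambda>s. s powr (1 - real n / 2) / (2 - real n)) has_real_derivative (1 / 2) * s powr (-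
      real n / 2)) (at s)"
    by (simp only:)
  then show ?thesis
    unfolding radial_kernel_def[abs_def] using False by simp
qed

lemma smooth_expr_inner_self: "smooth_expr (\<lambda>z::'a::euclidean_space. z \<bullet> z)"
proof -
  have "smooth_expr (\<lambda>z::'a. \<Sum>b\<in>B. (z \<bullet> b) * (z \<bullet> b))" if "finite B" for B
    using that
  proof induction
    case (insert b B)
    then show ?case using smooth_expr.add[OF smooth_expr.mult[OF smooth_expr.inner smooth_expr.inner]] by simp
  qed (simp add: smooth_expr.const)
  then show ?thesis by (subst euclidean_inner) simp
qed

lemma smooth_expr_flat_inner: "smooth_expr (\<lambda>z::'a::euclidean_space. flat p ((1 - z \<bullet> z) / 2))"
proof -
  have "smooth_expr (\<lambda>z::'a. flat p (1/2 + (- 1/2) * (z \<bullet> z)))"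
    by (intro smooth_expr.flat smooth_expr.add smooth_expr.mult smooth_expr.const smooth_expr_inner_self)
  then show ?thesis by (simp add: field_simps)
qed

lemma smooth_expr_regular_kernel: "smooth_expr (regular_kernel :: 'a::euclidean_space \<Rightarrow> real)"
proof -
  have p: "smooth_expr (\<lambda>z::'a. profile (z \<bullet> z))"
    unfolding profile_def by (intro smooth_expr.add smooth_expr_inner_self smooth_expr_flat_inner)
  have "smooth_expr (\<lambda>z::'a. (1 / 2) * profile (z \<bullet> z) powr (- real DIM('a) / 2))"
    by (intro smooth_expr.mult smooth_expr.const smooth_expr.powr p profile_pos) simp
  from smooth_expr.chain[OF p DERIV_radial_kernel[OF profile_pos] this]
  show ?thesis unfolding regular_kernel_def[abs_def] by simp
qed

lemma smooth_regular_kernel: "smooth regular_kernel"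
  by (intro smooth_expr_imp_smooth smooth_expr_regular_kernel)

lemma smooth_kernel_density: "smooth kernel_density"
  unfolding kernel_density_def by (intro smooth_laplacian smooth_regular_kernel)

definition radial_slope :: "nat \<Rightarrow> real \<Rightarrow> real" where
  "radial_slope n s = profile s powr (- real n / 2) * profile' s"

lemma partial_regular_kernel:
  "partial_deriv b regular_kernel z = radial_slope DIM('a) (z \<bullet> z) * (z \<bullet> b)" for z :: "'a::euclidean_space"
proof -
  have 1: "((\<lambda>z. profile (z \<bullet> z)) has_derivative (\<lambda>h. profile' (z \<bullet> z) * (2 * (z \<bullet> h)))) (at z)"
    by (rule has_derivative_compose[OF _ DERIV_profile[unfolded has_field_derivative_def]])
      (auto intro!: derivative_eq_intros simp: inner_commute)
  have "(regular_kernel has_derivative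
     (\<lambda>h. (1 / 2) * profile (z \<bullet> z) powr (- real DIM('a) / 2) * (profile' (z \<bullet> z) * (2 * (z \<bullet> h))))) (at z)"
    unfolding regular_kernel_def[abs_def]
    by (rule has_derivative_compose[OF 1 DERIV_radial_kernel[unfolded has_field_derivative_def]])
      (simp add: profile_pos)
  then show ?thesis by (simp add: partial_deriv_eq radial_slope_def)
qed

lemma DERIV_radial_slope:
  assumes "0 \<le> s"
  shows "(radial_slope n has_real_derivative profile s powr (- real n / 2) * profile'' s
     - real n / 2 * profile s powr (- real n / 2 - 1) * (profile' s)\<^sup>2) (at s)"
proof -
  have "((\<lambda>s. profile s powr (- real n / 2)) has_real_derivative
      (- real n / 2 * profile s powr (- real n / 2 - 1)) * profile' s) (at s)"
    by (rule DERIV_chain2[OF _ DERIV_profile]) (rule has_real_derivative_powr[OF profile_pos[OF assms]])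
  from DERIV_mult[OF this DERIV_profile'] show ?thesis
    unfolding radial_slope_def[abs_def] by (simp add: algebra_simps power2_eq_square)
qed

text \<open>Differentiating the gradient m(s) z with s = |z|^2 once more gives 2 s m'(s) + n m(s).
  The terms are grouped so that each factor has a sign; for s at least 1 both groups vanish, because
  there \<open>profile\<close> is the identity.\<close>

lemma kernel_density_eq:
  fixes z :: "'a::euclidean_space"
  defines "n \<equiv> DIM('a)" and "s \<equiv> z \<bullet> z"
  shows "kernel_density z = profile s powr (- real n / 2 - 1) *
    (2 * s * profile s * profile'' s + n * profile' s * (profile s - s * profile' s))"
proof -
  define m' where "m' = profile s powr (- real n / 2) * profile'' s
     - real n / 2 * profile s powr (- real n / 2 - 1) * (profile' s)\<^sup>2"
  have "partial_deriv b (partial_deriv b regular_kernel) z = m' * (2 * (z \<bullet> b)\<^sup>2) + radial_slope n s"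
    if "b \<in> Basis" for b
  proof -
    have 1: "((\<lambda>z. radial_slope n (z \<bullet> z)) has_derivative (\<lambda>h. m' * (2 * (z \<bullet> h)))) (at z)"
      unfolding m'_def s_def
      by (rule has_derivative_compose[OF _ DERIV_radial_slope[unfolded has_field_derivative_def]])
        (auto intro!: derivative_eq_intros simp: inner_commute)
    have "((\<lambda>z. radial_slope n (z \<bullet> z) * (z \<bullet> b)) has_derivative
        (\<lambda>h. m' * (2 * (z \<bullet> h)) * (z \<bullet> b) + radial_slope n s * (h \<bullet> b))) (at z)"
      unfolding s_def by (auto intro!: derivative_eq_intros 1)
    moreover have "partial_deriv b regular_kernel = (\<lambda>z. radial_slope n (z \<bullet> z) * (z \<bullet> b))"
      by (auto simp: partial_regular_kernel n_def)
    ultimately show ?thesis using that by (simp add: partial_deriv_eq power2_eq_square)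
  qed
  then have "kernel_density z = (\<Sum>b\<in>Basis. m' * (2 * (z \<bullet> b)\<^sup>2) + radial_slope n s)"
    unfolding kernel_density_def laplacian_eq by simp
  also have "\<dots> = m' * (2 * s) + n * radial_slope n s"
  proof -
    have "s = (\<Sum>b\<in>Basis. (z \<bullet> b)\<^sup>2)"
      unfolding s_def by (subst euclidean_inner) (simp add: power2_eq_square)
    then show ?thesis by (simp add: sum.distrib n_def sum_distrib_left)
  qed
  also have "profile s powr (- real n / 2) = profile s powr (- real n / 2 - 1) * profile s"
  proof -
    have "profile s powr (- real n / 2 - 1 + 1) = profile s powr (- real n / 2 - 1) * profile s powr 1"
      by (rule powr_add)
    then show ?thesis using profile_pos[of s] by (simp add: s_def)
  qed
  then have "m' * (2 * s) + n * radial_slope n s = profile s powr (- real n / 2 - 1) *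
    (2 * s * profile s * profile'' s + n * profile' s * (profile s - s * profile' s))"
    unfolding m'_def radial_slope_def by (simp add: algebra_simps power2_eq_square)
  finally show ?thesis .
qed

lemma kernel_density_nonneg: "0 \<le> kernel_density z"
  unfolding kernel_density_eq
  using profile_pos[of "z \<bullet> z"] profile'_pos[of "z \<bullet> z"] profile''_nonneg[of "z \<bullet> z"] profile_diff_nonneg[of
      "z \<bullet> z"]
  by (intro mult_nonneg_nonneg add_nonneg_nonneg) auto

lemma kernel_density_zero_pos: "0 < kernel_density 0"
  unfolding kernel_density_eq using profile_pos[of 0] profile'_pos[of 0] by simp

lemma inner_self_ge_1: "1 \<le> norm z \<Longrightarrow> 1 \<le> z \<bullet> z"
  by (metis norm_eq_square one_le_power power2_norm_eq_inner)

lemma kernel_density_outside: "1 \<le> norm z \<Longrightarrow> kernel_density z = 0"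
  unfolding kernel_density_eq using inner_self_ge_1[of z] by (simp add: profile_eq profile'_eq profile''_eq)

text \<open>The argument is a squared norm, so doubling z means the factor 4. Homogeneity of degree
  2 - n in z gives the weight \<open>2 ^ (n - 2)\<close>, and for n = 2 the logarithm contributes ln
  2.\<close>

lemma radial_kernel_scale:
  assumes "2 \<le> n" "0 < s"
  shows "2 ^ (n - 2) * radial_kernel n (4 * s) = radial_kernel n s + log_defect n"
proof (cases "n = 2")
  case True
  have "ln 4 = 2 * ln (2::real)" using ln_realpow[of 2 2] by simp
  then show ?thesis using assms True by (simp add: radial_kernel_def log_defect_def ln_mult)
next
  case False
  have "(4::real) powr (1 - real n / 2) = (2 powr 2) powr (1 - real n / 2)" by simp
  also have "\<dots> = 2 powr (- real (n - 2))" unfolding powr_powr using assms by (simp add: of_nat_diff)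
  also have "\<dots> = inverse (2 ^ (n - 2))" by (simp add: powr_minus powr_realpow)
  finally show ?thesis using False assms
    by (simp add: radial_kernel_def log_defect_def powr_mult)
qed

lemma regular_kernel_outside: "1
    \<le> norm z \<Longrightarrow> regular_kernel z = radial_kernel DIM('a) (z \<bullet> z)" for z :: "'a::euclidean_space"
  by (simp add: regular_kernel_def profile_eq inner_self_ge_1)

lemma kernel_step_outside:
  fixes z :: "'a::euclidean_space"
  assumes "2 \<le> DIM('a)" "1 \<le> norm z"
  shows "kernel_step z = 0"
proof -
  have "0 < z \<bullet> z" using assms(2) by auto
  from radial_kernel_scale[OF assms(1) this] show ?thesis
    using assms by (simp add: kernel_step_def regular_kernel_outside)
qed

lemma smooth_const: "smooth (\<lambda>x. c)"
  by (intro smooth_expr_imp_smooth smooth_expr.const)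

lemma laplacian_const: "laplacian (\<lambda>x. c) = (\<lambda>x. 0)"
proof -
  have "partial_deriv b (\<lambda>x::'a. c::real) = (\<lambda>x. 0)" for b c
    by (intro ext partial_deriv_eq) simp
  then show ?thesis by (simp add: laplacian_eq)
qed

lemma smooth_scale: "smooth \<phi> \<Longrightarrow> smooth (\<lambda>y. c * \<phi> (a *\<^sub>R y))"
  using smooth_affine[of \<phi> c a 0] by simp

lemma laplacian_scale: "smooth \<phi> \<Longrightarrow> laplacian (\<lambda>y. c * \<phi> (a *\<^sub>R y)) = (\<lambda>y. c * a\<^sup>2 * laplacian \<phi> (a *\<^sub>R y))"
  using laplacian_affine[of \<phi> c a 0] by simp

lemma smooth_kernel_step: "smooth kernel_step"
  unfolding kernel_step_def[abs_def]
  using smooth_scale[OF smooth_regular_kernel, of "- 1" 1]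
  by (intro smooth_add smooth_const smooth_scale smooth_regular_kernel) simp

lemma laplacian_kernel_step:
  assumes "2 \<le> DIM('a::euclidean_space)"
  shows "laplacian (kernel_step :: 'a \<Rightarrow> real) z = 2 ^ DIM('a) * kernel_density (2 *\<^sub>R z) - kernel_density z"
proof -
  have s: "smooth (\<lambda>z::'a. 2 ^ (DIM('a) - 2) * regular_kernel (2 *\<^sub>R z))" "smooth (\<lambda>z::'a. (- 1) *
      regular_kernel z)"
    using smooth_scale[OF smooth_regular_kernel] smooth_scale[OF smooth_regular_kernel, of "- 1" 1] by auto
  have "laplacian (kernel_step :: 'a \<Rightarrow> real)
      = (\<lambda>z. (2 ^ (DIM('a) - 2) * 2\<^sup>2 * kernel_density (2 *\<^sub>R z) + (- 1) * kernel_density z) + 0)"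
    unfolding kernel_step_def[abs_def] laplacian_add[OF smooth_add[OF s] smooth_const] laplacian_add[OF s]
      laplacian_const laplacian_scale[OF smooth_regular_kernel]
      laplacian_scale[OF smooth_regular_kernel, of "- 1" 1, unfolded scaleR_one]
    by (simp add: kernel_density_def)
  moreover have "2 ^ (DIM('a) - 2) * 2\<^sup>2 = (2::real) ^ DIM('a)"
    using le_add_diff_inverse2[OF assms] by (simp only: power_add[symmetric])
  ultimately show ?thesis by simp
qed

section \<open>Dilations that preserve mass, and the dyadic layers\<close>

definition dilate :: "nat \<Rightarrow> ('a::euclidean_space \<Rightarrow> real) \<Rightarrow> 'a \<Rightarrow> real" where
  "dilate j \<kappa> z = 2 ^ (j * DIM('a)) * \<kappa> (2 ^ j *\<^sub>R z)"

lemma smooth_dilate: "smooth \<kappa> \<Longrightarrow> smooth (dilate j \<kappa>)"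
  unfolding dilate_def[abs_def] by (rule smooth_scale)

lemma iter_partial_scale: "smooth \<phi> \<Longrightarrow> ds \<in> lists Basis \<Longrightarrow>
    iter_partial ds (\<lambda>y. c * \<phi> (a *\<^sub>R y)) = (\<lambda>y. c * a ^ length ds * iter_partial ds \<phi> (a *\<^sub>R y))"
  using iter_partial_affine[of \<phi> ds c a 0] by simp

lemma iter_partial_dilate:
  "smooth \<kappa> \<Longrightarrow> ds \<in> lists Basis \<Longrightarrow>
    iter_partial ds (dilate j \<kappa>) = (\<lambda>z. (2 ^ j) ^ length ds * dilate j (iter_partial ds \<kappa>) z)"
  unfolding dilate_def[abs_def] iter_partial_scale by (simp add: mult_ac)

lemma dilate_outside:
  assumes "\<And>z. 1 \<le> norm z \<Longrightarrow> \<kappa> z = 0" "(1 / 2) ^ j \<le> norm z"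
  shows "dilate j \<kappa> z = 0"
proof -
  have "1 \<le> norm (2 ^ j *\<^sub>R z)" using assms(2) by (simp add: field_simps)
  with assms(1) show ?thesis by (simp add: dilate_def)
qed

text \<open>The weight \<open>(1 / 4) ^ j\<close> offsets the factor 4^j that the Laplacian gains
  under dilation, so the Laplacian of a layer is a plain difference of two dilated densities and
  consecutive layers telescope.\<close>

definition kernel_layer :: "nat \<Rightarrow> 'a::euclidean_space \<Rightarrow> real" where
  "kernel_layer j z = (1 / 4) ^ j * dilate j kernel_step z"

lemma smooth_kernel_layer: "smooth (kernel_layer j)"
  unfolding kernel_layer_def[abs_def]
  using smooth_scale[OF smooth_dilate[OF smooth_kernel_step], of "(1 / 4) ^ j" j 1, unfolded scaleR_one] .

lemma laplacian_kernel_layer: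
  assumes "2 \<le> DIM('a::euclidean_space)"
  shows "laplacian (kernel_layer j :: 'a \<Rightarrow> real) z = dilate (Suc j) kernel_density z - dilate j kernel_density z"
proof -
  have "laplacian (kernel_layer j :: 'a \<Rightarrow> real) z
      = ((1 / 4) ^ j * 2 ^ (j * DIM('a))) * (2 ^ j)\<^sup>2 * laplacian kernel_step (2 ^ j *\<^sub>R z)"
    unfolding kernel_layer_def[abs_def] dilate_def[abs_def] mult.assoc[symmetric]
    by (subst laplacian_scale[OF smooth_kernel_step]) simp
  also have "(1 / 4) ^ j * (2 ^ j)\<^sup>2 = (1::real)"
    by (simp add: power2_eq_square power_mult_distrib[symmetric])
  then have "((1 / 4) ^ j * 2 ^ (j * DIM('a))) * (2 ^ j)\<^sup>2 * laplacian kernel_step (2 ^ j *\<^sub>R z) =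
    2 ^ (j * DIM('a)) * laplacian kernel_step (2 ^ j *\<^sub>R z)" by (simp add: mult_ac)
  finally show ?thesis
    by (simp add: laplacian_kernel_step[OF assms] dilate_def algebra_simps power_add)
qed

lemma kernel_layer_outside:
  fixes z :: "'a::euclidean_space"
  assumes "2 \<le> DIM('a)" "(1 / 2) ^ j \<le> norm z"
  shows "kernel_layer j z = 0"
  using dilate_outside[of kernel_step j z] kernel_step_outside assms by (auto simp: kernel_layer_def)

text \<open>The kernel smoothed at radius 2^-k: adding one more layer halves the radius of
  smoothing.\<close>

definition truncated_kernel :: "nat \<Rightarrow> 'a::euclidean_space \<Rightarrow> real" where
  "truncated_kernel k z = regular_kernel z + (\<Sum>j<k. kernel_layer j z)"

lemma smooth_truncated_kernel: "smooth (truncated_kernel k)"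
  unfolding truncated_kernel_def[abs_def]
  by (intro smooth_add smooth_regular_kernel smooth_sum_apply smooth_kernel_layer) simp

lemma laplacian_sum:
  fixes \<phi> :: "'i \<Rightarrow> 'a::euclidean_space \<Rightarrow> real"
  assumes "finite I" "\<And>i. i \<in> I \<Longrightarrow> smooth (\<phi> i)"
  shows "laplacian (\<lambda>x. \<Sum>i\<in>I. \<phi> i x) = (\<lambda>x. \<Sum>i\<in>I. laplacian (\<phi> i) x)"
  using assms
proof (induction I)
  case empty
  then show ?case by (simp add: laplacian_const)
next
  case (insert i I)
  then show ?case by (simp add: laplacian_add smooth_sum_apply)
qed

lemma dilate_0 [simp]: "dilate 0 \<kappa> = \<kappa>"
  by (simp add: dilate_def fun_eq_iff)

lemma laplacian_kernel_layers:
  assumes "2 \<le> DIM('a::euclidean_space)" "m \<le> k"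
  shows "laplacian (\<lambda>z::'a. \<Sum>j=m..<k. kernel_layer j z) z = dilate k kernel_density z - dilate m kernel_density z"
  using assms(2) by (simp add: laplacian_sum smooth_kernel_layer laplacian_kernel_layer[OF assms(1)]
     sum_Suc_diff'[where f = "\<lambda>j. dilate j kernel_density z"])

lemma laplacian_truncated_kernel:
  assumes "2 \<le> DIM('a::euclidean_space)"
  shows "laplacian (truncated_kernel k :: 'a \<Rightarrow> real) = dilate k kernel_density"
proof
  fix z :: 'a
  have "smooth (\<lambda>z::'a. \<Sum>j=0..<k. kernel_layer j z)"
    by (intro smooth_sum_apply smooth_kernel_layer) simp
  then show "laplacian (truncated_kernel k) z = dilate k kernel_density z"
    unfolding truncated_kernel_def[abs_def] lessThan_atLeast0
    by (simp add: laplacian_add smooth_regular_kernel laplacian_kernel_layers[OF assms] kernel_density_def)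
qed

text \<open>The layers telescope to a single rescaled copy of \<open>regular_kernel\<close>; each of
  them contributes one \<open>log_defect\<close>.\<close>

lemma truncated_kernel_eq:
  assumes "2 \<le> DIM('a::euclidean_space)"
  shows "truncated_kernel k (z::'a)
      = (2 ^ k) ^ (DIM('a) - 2) * regular_kernel (2 ^ k *\<^sub>R z) - k * log_defect DIM('a)"
proof (induction k)
  case 0
  then show ?case by (simp add: truncated_kernel_def)
next
  case (Suc k)
  have "(1 / 4) ^ k * 2 ^ (k * DIM('a)) = (2 ^ k :: real) ^ (DIM('a) - 2)"
  proof -
    have "(2::real) ^ (k * DIM('a)) = (2 ^ k) ^ (DIM('a) - 2 + 2)"
      by (simp only: le_add_diff_inverse2[OF assms] power_mult)
    also have "\<dots> = (2 ^ k) ^ (DIM('a) - 2) * 4 ^ k"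
      unfolding power_add by (simp add: power2_eq_square power_mult_distrib[symmetric])
    finally show ?thesis by (simp add: power_divide)
  qed
  moreover have "(2 ^ k :: real) ^ (DIM('a) - 2) * log_defect DIM('a) = log_defect DIM('a)"
    by (simp add: log_defect_def)
  ultimately have "kernel_layer k z = (2 ^ Suc k) ^ (DIM('a) - 2) * regular_kernel (2 ^ Suc k *\<^sub>R z)
     - (2 ^ k) ^ (DIM('a) - 2) * regular_kernel (2 ^ k *\<^sub>R z) - log_defect DIM('a)"
    unfolding kernel_layer_def dilate_def kernel_step_def mult.assoc[symmetric]
    by (simp add: algebra_simps power_mult_distrib)
  moreover have "truncated_kernel (Suc k) z = truncated_kernel k z + kernel_layer k z"
    by (simp add: truncated_kernel_def)
  ultimately show ?case using Suc by (simp add: algebra_simps)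
qed

lemma radial_kernel_scale_power:
  assumes "2 \<le> n" "0 < s"
  shows "(2 ^ k) ^ (n - 2) * radial_kernel n (4 ^ k * s) = radial_kernel n s + k * log_defect n"
proof (induction k)
  case (Suc k)
  have "(2 ^ Suc k) ^ (n - 2) * radial_kernel n (4 ^ Suc k * s) =
    (2 ^ k) ^ (n - 2) * (2 ^ (n - 2) * radial_kernel n (4 * (4 ^ k * s)))"
    by (simp add: power_mult_distrib mult_ac)
  also have "\<dots> = (2 ^ k) ^ (n - 2) * radial_kernel n (4 ^ k * s) + (2 ^ k) ^ (n - 2) * log_defect n"
    using assms by (subst radial_kernel_scale) (auto simp: algebra_simps)
  also have "(2 ^ k) ^ (n - 2) * log_defect n = log_defect n" by (simp add: log_defect_def)
  finally show ?case using Suc by (simp add: algebra_simps)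
qed simp

lemma truncated_kernel_outside:
  fixes z :: "'a::euclidean_space"
  assumes "2 \<le> DIM('a)" "(1 / 2) ^ k \<le> norm z"
  shows "truncated_kernel k z = radial_kernel DIM('a) (z \<bullet> z)"
proof -
  have z: "z \<noteq> 0"
  proof
    assume "z = 0"
    then have "(1 / 2) ^ k \<le> (0::real)" using assms(2) by simp
    moreover have "(0::real) < (1 / 2) ^ k" by simp
    ultimately show False by linarith
  qed
  have "1 \<le> norm (2 ^ k *\<^sub>R z)" using assms(2) by (simp add: field_simps)
  then have "truncated_kernel k z
      = (2 ^ k) ^ (DIM('a) - 2) * radial_kernel DIM('a) (4 ^ k * (z \<bullet> z)) - k * log_defect DIM('a)"
    unfolding truncated_kernel_eq[OF assms(1)]
    by (simp add: regular_kernel_outside power_mult_distrib[symmetric] mult.assoc[symmetric])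
  then show ?thesis using radial_kernel_scale_power[OF assms(1), of "z \<bullet> z" k] z by simp
qed

text \<open>The factor between \<open>radial_kernel\<close> and the normalised kernel; geometrically
  the area of the unit sphere. The case split follows the definition of
  \<open>newtonian_kernel\<close>.\<close>

definition kernel_const :: "nat \<Rightarrow> real" where
  "kernel_const n = (if n = 2 then 2 * pi else real n * unit_ball_vol (real n))"

lemma kernel_const_pos: "0 < n \<Longrightarrow> 0 < kernel_const n"
  by (simp add: kernel_const_def)

lemma newtonian_kernel_eq:
  fixes z :: "'a::euclidean_space"
  assumes "2 \<le> DIM('a)" "z \<noteq> 0"
  shows "radial_kernel DIM('a) (z \<bullet> z) = kernel_const DIM('a) * newtonian_kernel z"
proof (cases "DIM('a) = 2")
  case True
  then show ?thesis using assms(2)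
    by (simp add: radial_kernel_def kernel_const_def newtonian_kernel_def dot_square_norm ln_realpow)
next
  case False
  have "(z \<bullet> z) powr (1 - real DIM('a) / 2) = (norm z powr 2) powr (1 - real DIM('a) / 2)"
    using assms(2) by (simp add: dot_square_norm)
  also have "\<dots> = norm z powr (- real (DIM('a) - 2))"
    unfolding powr_powr using assms(1) by (simp add: of_nat_diff)
  also have "\<dots> = inverse (norm z ^ (DIM('a) - 2))" using assms(2) by (simp add: powr_minus powr_realpow)
  finally have "(z \<bullet> z) powr (1 - real DIM('a) / 2) = inverse (norm z ^ (DIM('a) - 2))" .
  moreover have "unit_ball_vol (real DIM('a)) \<noteq> 0" "real DIM('a) - 2 \<noteq> 0" "2 - real DIM('a) \<noteq> 0"
    using False unit_ball_vol_pos[of "real DIM('a)"] by (auto simp del: unit_ball_vol_pos)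
  ultimately show ?thesis using False assms(2)
    by (simp add: radial_kernel_def kernel_const_def newtonian_kernel_def field_simps)
qed

section \<open>Integration by parts and approximate identities\<close>

lemma integral_affine_lborel:
  fixes f :: "'a::euclidean_space \<Rightarrow> real"
  assumes [measurable]: "f \<in> borel_measurable borel" and c: "c \<noteq> 0"
  shows "(LBINT x. f x) = \<bar>c\<bar> ^ DIM('a) * (LBINT x. f (t + c *\<^sub>R x))"
    and "integrable lborel (\<lambda>x. f (t + c *\<^sub>R x)) \<longleftrightarrow> integrable lborel f"
proof -
  have [measurable]: "(\<lambda>x. t + c *\<^sub>R x) \<in> borel_measurable borel" by measurable
  show "(LBINT x. f x) = \<bar>c\<bar> ^ DIM('a) * (LBINT x. f (t + c *\<^sub>R x))"
    by (subst lborel_affine[OF c, of t]) (simp add: integral_density integral_distr)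
  have "integrable lborel f \<longleftrightarrow> integrable lborel (\<lambda>x. \<bar>c\<bar> ^ DIM('a) * f (t + c *\<^sub>R x))"
    by (subst lborel_affine[OF c, of t]) (simp add: integrable_density integrable_distr_eq)
  then show "integrable lborel (\<lambda>x. f (t + c *\<^sub>R x)) \<longleftrightarrow> integrable lborel f"
    using c by simp
qed

lemma integral_translate:
  fixes f :: "'a::euclidean_space \<Rightarrow> real"
  assumes "f \<in> borel_measurable borel"
  shows "(LBINT y. f (y - x)) = (LBINT y. f y)"
    and "integrable lborel (\<lambda>y. f (y - x)) \<longleftrightarrow> integrable lborel f"
  using integral_affine_lborel[OF assms, of 1 "- x"] by simp_all

lemma integral_reflect:
  fixes f :: "'a::euclidean_space \<Rightarrow> real"
  assumes "f \<in> borel_measurable borel"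
  shows "(LBINT y. f (x - y)) = (LBINT y. f y)"
    and "integrable lborel (\<lambda>y. f (x - y)) \<longleftrightarrow> integrable lborel f"
  using integral_affine_lborel[OF assms, of "-1" x] by simp_all

lemma integrable_bounded_support:
  fixes f :: "'a::euclidean_space \<Rightarrow> real"
  assumes [measurable]: "f \<in> borel_measurable borel"
    and "\<And>z. z \<in> cball a r \<Longrightarrow> \<bar>f z\<bar> \<le> B" "\<And>z. z \<notin> cball a r \<Longrightarrow> f z = 0"
  shows "integrable lborel f" "(LBINT z. \<bar>f z\<bar>) \<le> B * measure lborel (cball a r)"
proof -
  have "emeasure lborel (cball a r) < \<infinity>" by (rule emeasure_lborel_cball_finite)
  then have i: "integrable lborel (\<lambda>z. B * indicator (cball a r) z)"
    by (intro integrable_mult_right integrable_real_indicator) auto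
  have le: "\<bar>f z\<bar> \<le> B * indicator (cball a r) z" for z
    using assms(2,3)[of z] by (cases "z \<in> cball a r") auto
  show f: "integrable lborel f"
    by (rule Bochner_Integration.integrable_bound[OF i]) (auto intro!: order_trans[OF le])
  have "(LBINT z. \<bar>f z\<bar>) \<le> (LBINT z. B * indicator (cball a r) z)"
    using f i le by (intro integral_mono) auto
  then show "(LBINT z. \<bar>f z\<bar>) \<le> B * measure lborel (cball a r)" by simp
qed

lemma continuous_support_bounded:
  fixes f :: "'a::euclidean_space \<Rightarrow> real"
  assumes "continuous_on UNIV f" "\<And>z. r < norm z \<Longrightarrow> f z = 0"
  obtains B where "0 \<le> B" "\<And>z. \<bar>f z\<bar> \<le> B"
proof -
  have "compact (f ` cball 0 r)"
    by (intro compact_continuous_image continuous_on_subset[OF assms(1)]) auto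
  then obtain B where B: "\<And>z. z \<in> cball 0 r \<Longrightarrow> \<bar>f z\<bar> \<le> B"
    unfolding bounded_iff[symmetric] by (metis bounded_iff compact_imp_bounded image_eqI real_norm_def)
  have "\<bar>f z\<bar> \<le> max 0 B" for z
    using B[of z] assms(2)[of z] by (cases "norm z \<le> r") auto
  then show thesis using that[of "max 0 B"] by auto
qed

lemma integrable_continuous_support:
  fixes f :: "'a::euclidean_space \<Rightarrow> real"
  assumes "continuous_on UNIV f" "\<And>z. r < norm z \<Longrightarrow> f z = 0"
  shows "integrable lborel f"
proof -
  obtain B where "\<And>z. \<bar>f z\<bar> \<le> B" using continuous_support_bounded[OF assms] by blast
  then show ?thesis
    using assms by (intro integrable_bounded_support(1)[of f 0 r B] borel_measurable_continuous_onI) auto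
qed

text \<open>Each difference quotient has integral 0 by translation invariance. The mean value
  theorem bounds the quotients by \<open>B\<close>, and their supports stay in a fixed ball, so
  dominated convergence passes to the derivative.\<close>

lemma integral_derivative_eq_0:
  fixes \<phi> :: "'a::euclidean_space \<Rightarrow> real"
  assumes D: "\<And>z. (\<phi> has_derivative D z) (at z)" and B: "\<And>z. \<bar>D z b\<bar> \<le> B"
    and supp: "\<And>z. r < norm z \<Longrightarrow> \<phi> z = 0"
  shows "(LBINT z. D z b) = 0"
proof -
  have c: "continuous_on UNIV \<phi>"
    using D by (meson continuous_at_imp_continuous_on has_derivative_continuous)
  then have [measurable]: "\<phi> \<in> borel_measurable borel" by (rule borel_measurable_continuous_onI)
  have int: "integrable lborel \<phi>" by (rule integrable_continuous_support[OF c supp])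
  define q where "q k z = (\<phi> (z + (1 / Suc k) *\<^sub>R b) - \<phi> z) / (1 / Suc k)" for k z
  have deriv: "((\<lambda>s. \<phi> (z + s *\<^sub>R b)) has_real_derivative D (z + s *\<^sub>R b) b) (at s)" for z s
  proof -
    have "((\<lambda>s. \<phi> (z + s *\<^sub>R b)) has_derivative (\<lambda>h. D (z + s *\<^sub>R b) (h *\<^sub>R b))) (at s)"
      by (rule has_derivative_compose[OF _ D]) (auto intro!: derivative_eq_intros)
    then show ?thesis
      using linear_cmul[OF has_derivative_linear[OF D], of "z + s *\<^sub>R b" _ b]
      by (simp add: has_field_derivative_def mult_commute_abs)
  qed
  have qint: "integral\<^sup>L lborel (q k) = 0" for k
  proof -
    have "integrable lborel (\<lambda>z. \<phi> (z + (1 / Suc k) *\<^sub>R b))"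
      "(LBINT z. \<phi> (z + (1 / Suc k) *\<^sub>R b)) = (LBINT z. \<phi> z)"
      using integral_translate[of \<phi> "- ((1 / Suc k) *\<^sub>R b)"] int by simp_all
    then show ?thesis unfolding q_def[abs_def] using int by simp
  qed
  have lim: "(\<lambda>k. q k z) \<longlonglongrightarrow> D z b" for z
  proof -
    have "((\<lambda>h. (\<phi> (z + h *\<^sub>R b) - \<phi> z) / h) \<longlongrightarrow> D z b) (at 0)"
      using deriv[of z 0] by (simp add: has_field_derivative_iff)
    moreover have "filterlim (\<lambda>k. 1 / real (Suc k)) (at 0) sequentially"
      unfolding filterlim_at using LIMSEQ_inverse_real_of_nat by (simp add: inverse_eq_divide)
    ultimately show ?thesis unfolding q_def by (rule filterlim_compose)
  qed
  \<comment> \<open>The radius is enlarged by \<open>norm b\<close> because the quotient also looks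
    at a point up to that far away.\<close>
  have bound: "\<bar>q k z\<bar> \<le> B * indicator (cball 0 (r + norm b)) z" for k z
  proof (cases "z \<in> cball 0 (r + norm b)")
    case True
    have "\<exists>\<xi>. 0 < \<xi> \<and> \<xi> < 1 / Suc k \<and> \<phi> (z + (1 / Suc k) *\<^sub>R b) - \<phi> (z + 0 *\<^sub>R b)
        = (1 / Suc k - 0) * D (z + \<xi> *\<^sub>R b) b"
      by (rule MVT2[of 0 "1 / Suc k" "\<lambda>s. \<phi> (z + s *\<^sub>R b)"]) (auto intro: deriv)
    then obtain \<xi> where "q k z = D (z + \<xi> *\<^sub>R b) b" unfolding q_def by auto
    then show ?thesis using B True by simp
  next
    case False
    then have z: "r + norm b < norm z" by simp
    have "norm ((1 / Suc k) *\<^sub>R b) \<le> norm b" by (simp add: field_simps mult_left_le_one_le)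
    then have "r < norm (z + (1 / Suc k) *\<^sub>R b)"
        using z norm_triangle_ineq4[of "z + (1 / Suc k) *\<^sub>R b" "(1 / Suc k) *\<^sub>R b"] by simp
    moreover have "r < norm z" using z norm_ge_zero[of b] by linarith
    ultimately show ?thesis using supp False by (simp add: q_def)
  qed
  have [measurable]: "(\<lambda>z. D z b) \<in> borel_measurable lborel"
    by (rule borel_measurable_LIMSEQ_real[OF lim]) (auto simp: q_def[abs_def])
  have "(\<lambda>k. integral\<^sup>L lborel (q k)) \<longlonglongrightarrow> (LBINT z. D z b)"
  proof (rule integral_dominated_convergence[where w = "\<lambda>z. B * indicator (cball 0 (r + norm b)) z"])
    show "integrable lborel (\<lambda>z. B * indicator (cball 0 (r + norm b)) z)"
      by (intro integrable_mult_right integrable_real_indicator emeasure_lborel_cball_finite) auto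
  qed (use lim bound in \<open>auto simp: q_def[abs_def]\<close>)
  then show ?thesis by (simp add: qint LIMSEQ_const_iff)
qed

lemma integral_by_parts:
  assumes s: "smooth \<phi>" "smooth \<psi>" and b: "b \<in> Basis" and supp: "\<And>z. r < norm z \<Longrightarrow> \<psi> z = 0"
  shows "(LBINT z. partial_deriv b \<phi> z * \<psi> z) = - (LBINT z. \<phi> z * partial_deriv b \<psi> z)"
proof -
  have supp': "r < norm z \<Longrightarrow> partial_deriv b \<psi> z = 0" for z
    using iter_partial_zero_outside[of "cball 0 r" \<psi> z "[b]"] supp by simp
  have c1: "continuous_on UNIV (\<lambda>z. partial_deriv b \<phi> z * \<psi> z)"
    and c2: "continuous_on UNIV (\<lambda>z. \<phi> z * partial_deriv b \<psi> z)"
    by (rule continuous_on_mult; rule smooth_imp_continuous_on; use s b smooth_partial_deriv in blast)+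
  have i: "integrable lborel (\<lambda>z. partial_deriv b \<phi> z * \<psi> z)" "integrable lborel (\<lambda>z. \<phi> z * partial_deriv b \<psi> z)"
    by (rule integrable_continuous_support[OF c1, of r] integrable_continuous_support[OF c2, of r], use supp
        supp' in simp)+
  have c: "continuous_on UNIV (\<lambda>z. \<phi> z * partial_deriv b \<psi> z + partial_deriv b \<phi> z * \<psi> z)"
    using c1 c2 by (intro continuous_on_add)
  have z: "\<phi> z * partial_deriv b \<psi> z + partial_deriv b \<phi> z * \<psi> z = 0" if "r < norm z" for z
    using supp supp' that by simp
  obtain B where B: "\<And>z. \<bar>\<phi> z * partial_deriv b \<psi> z + partial_deriv b \<phi> z * \<psi> z\<bar> \<le> B"
    using continuous_support_bounded[OF c z] by blast
  have "(LBINT z. \<phi> z * partial_deriv b \<psi> z + partial_deriv b \<phi> z * \<psi> z) = 0"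
    by (rule integral_derivative_eq_0[where \<phi> = "\<lambda>z. \<phi> z * \<psi> z" and b = b and
        D = "\<lambda>z h. \<phi> z * partial_deriv h \<psi> z + partial_deriv h \<phi> z * \<psi> z", OF _ B, of r])
       (use supp in \<open>auto intro!: has_derivative_mult smooth_has_derivative s\<close>)
  then show ?thesis using i by simp
qed

lemma integral_by_parts_iter:
  assumes s: "smooth \<phi>" "smooth \<psi>" and ds: "ds \<in> lists Basis" and supp: "\<And>z. r < norm z \<Longrightarrow> \<psi> z = 0"
  shows "(LBINT z. iter_partial ds \<phi> z * \<psi> z) = (- 1) ^ length ds * (LBINT z. \<phi> z * iter_partial ds \<psi> z)"
  using ds s(2) supp
proof (induction ds arbitrary: \<psi>)
  case (Cons d ds)
  have d: "d \<in> Basis" "ds \<in> lists Basis" using Cons.hyps by auto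
  have supp': "r < norm z \<Longrightarrow> partial_deriv d \<psi> z = 0" for z
    using iter_partial_zero_outside[of "cball 0 r" \<psi> z "[d]"] Cons.prems(2) by simp
  have "(LBINT z. iter_partial (d # ds) \<phi> z * \<psi> z) = - (LBINT z. iter_partial ds \<phi> z * partial_deriv d \<psi> z)"
    using integral_by_parts[OF smooth_iter_partial[OF s(1) d(2)] Cons.prems(1) d(1), of r] Cons.prems(2) by simp
  also have "\<dots> = - ((- 1) ^ length ds * (LBINT z. \<phi> z * iter_partial ds (partial_deriv d \<psi>) z))"
    using Cons.IH[OF smooth_partial_deriv[OF Cons.prems(1) d(1)] supp'] by simp
  finally show ?case using iter_partial_partial_deriv[OF Cons.prems(1) d(2,1)] by simp
qed simp

lemma integral_by_parts_laplacian:
  assumes s: "smooth \<phi>" "smooth \<psi>" and supp: "\<And>z. r < norm z \<Longrightarrow> \<psi> z = 0"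
  shows "(LBINT z. laplacian \<phi> z * \<psi> z) = (LBINT z. \<phi> z * laplacian \<psi> z)"
proof -
  have supp': "r < norm z \<Longrightarrow> iter_partial ds \<psi> z = 0" for z ds
    using iter_partial_zero_outside[of "cball 0 r" \<psi> z ds] supp by simp
  have i1: "integrable lborel (\<lambda>z. iter_partial [i, i] \<phi> z * \<psi> z)" if "i \<in> Basis" for i
  proof (rule integrable_continuous_support[of _ r])
    show "continuous_on UNIV (\<lambda>z. iter_partial [i, i] \<phi> z * \<psi> z)"
      by (rule continuous_on_mult; rule smooth_imp_continuous_on)
          (use s smooth_iter_partial[OF s(1), of "[i, i]"] that in auto)
  qed (use supp in simp)
  have i2: "integrable lborel (\<lambda>z. \<phi> z * iter_partial [i, i] \<psi> z)" if "i \<in> Basis" for i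
  proof (rule integrable_continuous_support[of _ r])
    show "continuous_on UNIV (\<lambda>z. \<phi> z * iter_partial [i, i] \<psi> z)"
      by (rule continuous_on_mult; rule smooth_imp_continuous_on)
          (use s smooth_iter_partial[OF s(2), of "[i, i]"] that in auto)
  qed (use supp'[of _ "[i, i]"] in simp)
  have "(LBINT z. laplacian \<phi> z * \<psi> z) = (\<Sum>i\<in>Basis. LBINT z. iter_partial [i, i] \<phi> z * \<psi> z)"
    unfolding laplacian_def sum_distrib_right by (rule Bochner_Integration.integral_sum[OF i1])
  also have "\<dots> = (\<Sum>i\<in>Basis. LBINT z. \<phi> z * iter_partial [i, i] \<psi> z)"
    using integral_by_parts_iter[OF s _ supp] by (intro sum.cong refl) (simp del: iter_partial_simps)
  also have "\<dots> = (LBINT z. \<phi> z * laplacian \<psi> z)"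
    unfolding laplacian_def sum_distrib_left by (rule Bochner_Integration.integral_sum[OF i2, symmetric])
  finally show ?thesis .
qed

text \<open>Since \<open>\<kappa>\<close> is reflected here, the sign \<open>(-1)\<^bsup>|ds|\<^esup>\<close> of the integration by parts cancels.\<close>

lemma convolution_by_parts:
  assumes s: "smooth \<kappa>" "smooth \<psi>" and ds: "ds \<in> lists Basis" and supp: "\<And>z. r < norm z \<Longrightarrow> \<psi> z = 0"
  shows "(LBINT x. iter_partial ds \<kappa> (y - x) * \<psi> x) = (LBINT x. \<kappa> (y - x) * iter_partial ds \<psi> x)"
proof -
  have s': "smooth (\<lambda>x. \<kappa> (y - x))" using smooth_affine[OF s(1), of 1 "-1" y] by simp
  have "iter_partial ds (\<lambda>x. \<kappa> (y - x)) = (\<lambda>x. (- 1) ^ length ds * iter_partial ds \<kappa> (y - x))"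
    using iter_partial_affine[OF s(1) ds, of 1 "-1" y] by simp
  then have "(-1) ^ length ds * (LBINT x. iter_partial ds \<kappa> (y - x) * \<psi> x) =
      (-1) ^ length ds * (LBINT x. \<kappa> (y - x) * iter_partial ds \<psi> x)"
    using integral_by_parts_iter[OF s' s(2) ds supp] by (simp add: mult.assoc)
  then show ?thesis by simp
qed

lemma convolution_by_parts_laplacian:
  assumes s: "smooth \<kappa>" "smooth \<psi>" and supp: "\<And>z. r < norm z \<Longrightarrow> \<psi> z = 0"
  shows "(LBINT x. laplacian \<kappa> (x - y) * \<psi> x) = (LBINT x. \<kappa> (x - y) * laplacian \<psi> x)"
  using integral_by_parts_laplacian[OF _ s(2) supp, of "\<lambda>x. \<kappa> (x - y)"]
    smooth_affine[OF s(1), of 1 1 "- y"] laplacian_affine[OF s(1), of 1 1 "- y"] by simp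

section \<open>Bumps, their dilates and convolutions\<close>

definition bump :: "('a::euclidean_space \<Rightarrow> real) \<Rightarrow> bool" where
  "bump \<kappa> \<longleftrightarrow> smooth \<kappa> \<and> (\<forall>z. 1 < norm z \<longrightarrow> \<kappa> z = 0)"

lemma bump_iter_partial: "bump \<kappa> \<Longrightarrow> ds \<in> lists Basis \<Longrightarrow> bump (iter_partial ds \<kappa>)"
  unfolding bump_def using smooth_iter_partial iter_partial_zero_outside[of "cball 0 1" \<kappa>] by auto

lemma bump_kernel_density: "bump kernel_density"
  by (simp add: bump_def smooth_kernel_density kernel_density_outside)

lemma bump_kernel_step: "2 \<le> DIM('a::euclidean_space) \<Longrightarrow> bump (kernel_step :: 'a \<Rightarrow> real)"
  by (simp add: bump_def smooth_kernel_step kernel_step_outside)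

lemma bump_measurable [measurable_dest]: "bump \<kappa> \<Longrightarrow> \<kappa> \<in> borel_measurable borel"
  by (simp add: bump_def smooth_borel_measurable)

lemma bump_integrable: "bump \<kappa> \<Longrightarrow> integrable lborel \<kappa>"
  unfolding bump_def by (metis integrable_continuous_support smooth_imp_continuous_on)

lemma bump_bounded:
  assumes "bump \<kappa>" obtains B where "0 \<le> B" "\<And>z. \<bar>\<kappa> z\<bar> \<le> B"
  using assms continuous_support_bounded[OF smooth_imp_continuous_on[of \<kappa>], of 1] unfolding bump_def by metis

lemma dilate_measurable [measurable]:
  assumes "\<kappa> \<in> borel_measurable borel"
  shows "dilate j \<kappa> \<in> borel_measurable borel"
proof -
  have "(\<lambda>z. 2 ^ j *\<^sub>R z) \<in> borel \<rightarrow>\<^sub>M (borel :: 'a measure)" by simp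
  from measurable_compose[OF this assms] show ?thesis
    unfolding dilate_def[abs_def] by (rule borel_measurable_times[OF borel_measurable_const])
qed

lemma integral_dilate:
  fixes \<kappa> :: "'a::euclidean_space \<Rightarrow> real"
  assumes "\<kappa> \<in> borel_measurable borel"
  shows "(LBINT z. dilate j \<kappa> z) = (LBINT z. \<kappa> z)"
    and "integrable lborel \<kappa> \<Longrightarrow> integrable lborel (dilate j \<kappa>)"
proof -
  note a = integral_affine_lborel[OF assms, of "2 ^ j" 0]
  show "(LBINT z. dilate j \<kappa> z) = (LBINT z. \<kappa> z)"
    using a(1) by (simp add: dilate_def power_mult power_abs)
  show "integrable lborel \<kappa> \<Longrightarrow> integrable lborel (dilate j \<kappa>)"
    using a(2) by (simp add: dilate_def[abs_def])
qed

lemma abs_dilate: "\<bar>dilate j \<kappa> z\<bar> = dilate j (\<lambda>z. \<bar>\<kappa> z\<bar>) z"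
  by (simp add: dilate_def abs_mult)

lemma integral_abs_dilate:
  assumes "\<kappa> \<in> borel_measurable borel"
  shows "(LBINT z. \<bar>dilate j \<kappa> z\<bar>) = (LBINT z. \<bar>\<kappa> z\<bar>)"
  unfolding abs_dilate by (rule integral_dilate) (use assms in measurable)

text \<open>Substituting z = 2^j (y - x) moves all dependence on j into the argument of \<psi>,
  which tends to y; the integrand is dominated by \<open>B * \<bar>\<kappa> z\<bar>\<close>.\<close>

lemma dilate_approximate_identity:
  fixes \<kappa> \<psi> :: "'a::euclidean_space \<Rightarrow> real"
  assumes \<kappa>: "bump \<kappa>" and \<psi>: "continuous_on UNIV \<psi>" and B: "\<And>x. \<bar>\<psi> x\<bar> \<le> B"
  shows "(\<lambda>j. LBINT x. dilate j \<kappa> (y - x) * \<psi> x) \<longlonglongrightarrow> (LBINT z. \<kappa> z) * \<psi> y"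
    and "\<bar>LBINT x. dilate j \<kappa> (y - x) * \<psi> x\<bar> \<le> B * (LBINT z. \<bar>\<kappa> z\<bar>)"
proof -
  have [measurable]: "\<psi> \<in> borel_measurable borel" using \<psi> by (rule borel_measurable_continuous_onI)
  have [measurable]: "\<kappa> \<in> borel_measurable borel" using \<kappa> by measurable
  have eq: "(LBINT x. dilate j \<kappa> (y - x) * \<psi> x) = (LBINT z. \<kappa> z * \<psi> (y - (1 / 2 ^ j) *\<^sub>R z))" for j
  proof -
    have "(LBINT z. \<kappa> z * \<psi> (y - (1 / 2 ^ j) *\<^sub>R z)) =
       (2 ^ j) ^ DIM('a) * (LBINT z. \<kappa> (2 ^ j *\<^sub>R z) * \<psi> (y - z))"
      by (subst integral_affine_lborel(1)[of _ "2 ^ j" 0]) (simp_all add: power_abs)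
    also have "\<dots> = (LBINT z. dilate j \<kappa> z * \<psi> (y - z))"
      by (simp add: dilate_def power_mult mult.assoc)
    also have "\<dots> = (LBINT x. dilate j \<kappa> (y - x) * \<psi> x)"
      using integral_reflect(1)[of "\<lambda>z. dilate j \<kappa> z * \<psi> (y - z)" y] by simp
    finally show ?thesis by simp
  qed
  have i: "integrable lborel (\<lambda>z. B * \<bar>\<kappa> z\<bar>)" using bump_integrable[OF \<kappa>] by simp
  have bound: "\<bar>\<kappa> z * \<psi> w\<bar> \<le> B * \<bar>\<kappa> z\<bar>" for z w
    using mult_right_mono[OF B[of w], of "\<bar>\<kappa> z\<bar>"] by (simp add: abs_mult mult.commute)
  have "(\<lambda>j. LBINT z. \<kappa> z * \<psi> (y - (1 / 2 ^ j) *\<^sub>R z)) \<longlonglongrightarrow> (LBINT z. \<kappa> z * \<psi> y)"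
  proof (rule integral_dominated_convergence[OF _ _ i])
    have "(\<lambda>j. \<psi> (y - (1 / 2 ^ j) *\<^sub>R z)) \<longlonglongrightarrow> \<psi> y" for z
    proof -
      have "(\<lambda>j. (1 / 2 ^ j :: real)) \<longlonglongrightarrow> 0"
        using LIMSEQ_realpow_zero[of "1 / 2 :: real"] by (simp add: power_one_over)
      then have "(\<lambda>j. y - (1 / 2 ^ j) *\<^sub>R z) \<longlonglongrightarrow> y - 0 *\<^sub>R z" by (intro tendsto_intros)
      then show ?thesis
        using \<psi> by (intro isCont_tendsto_compose[of y \<psi>]) (auto simp: continuous_on_eq_continuous_at)
    qed
    then show "AE z in lborel. (\<lambda>j. \<kappa> z * \<psi> (y - (1 / 2 ^ j) *\<^sub>R z)) \<longlonglongrightarrow> \<kappa> z * \<psi> y"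
      by (intro AE_I2 tendsto_intros)
  qed (use bound in auto)
  then show "(\<lambda>j. LBINT x. dilate j \<kappa> (y - x) * \<psi> x) \<longlonglongrightarrow> (LBINT z. \<kappa> z) * \<psi> y"
    unfolding eq by simp
  have "\<bar>LBINT z. \<kappa> z * \<psi> (y - (1 / 2 ^ j) *\<^sub>R z)\<bar> \<le> (LBINT z. B * \<bar>\<kappa> z\<bar>)"
  proof -
    have "integrable lborel (\<lambda>z. \<kappa> z * \<psi> (y - (1 / 2 ^ j) *\<^sub>R z))"
      by (rule Bochner_Integration.integrable_bound[OF i]) (auto intro!: order_trans[OF bound])
    from Bochner_Integration.integral_norm_bound_integral[OF this i] bound show ?thesis by simp
  qed
  then show "\<bar>LBINT x. dilate j \<kappa> (y - x) * \<psi> x\<bar> \<le> B * (LBINT z. \<bar>\<kappa> z\<bar>)"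
    unfolding eq by simp
qed

lemma convolution_fubini:
  fixes u \<psi> \<kappa> :: "'a::euclidean_space \<Rightarrow> real"
  assumes u: "integrable lborel u" and \<psi>: "integrable lborel \<psi>"
    and \<kappa>[measurable]: "\<kappa> \<in> borel_measurable borel" and B: "\<And>z. \<bar>\<kappa> z\<bar> \<le> B"
  shows "(LBINT x. (LBINT y. u y * \<kappa> (y - x)) * \<psi> x) = (LBINT y. u y * (LBINT x. \<kappa> (y - x) * \<psi> x))"
proof -
  have [measurable]: "u \<in> borel_measurable borel" "\<psi> \<in> borel_measurable borel" using u \<psi> by auto
  have i: "integrable (lborel \<Otimes>\<^sub>M lborel) (\<lambda>(x, y). B * (\<bar>\<psi> x\<bar> * \<bar>u y\<bar>))"
    by (rule lborel_pair.Fubini_integrable) (use u \<psi> in \<open>simp_all add: abs_mult\<close>)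
  have "integrable (lborel \<Otimes>\<^sub>M lborel) (\<lambda>(x, y). u y * \<kappa> (y - x) * \<psi> x)"
  proof (rule Bochner_Integration.integrable_bound[OF i])
    show "AE p in lborel \<Otimes>\<^sub>M lborel. norm (case p of (x, y) \<Rightarrow> u y * \<kappa> (y - x) * \<psi> x)
        \<le> norm (case p of (x, y) \<Rightarrow> B * (\<bar>\<psi> x\<bar> * \<bar>u y\<bar>))"
    proof (intro AE_I2, clarify)
      fix x y
      have "0 \<le> B" using B[of 0] by linarith
      then show "norm (u y * \<kappa> (y - x) * \<psi> x) \<le> norm (B * (\<bar>\<psi> x\<bar> * \<bar>u y\<bar>))"
        using mult_right_mono[OF B[of "y - x"], of "\<bar>\<psi> x\<bar> * \<bar>u y\<bar>"] by (simp add: abs_mult mult_ac)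
    qed
  qed measurable
  from lborel_pair.Fubini_integral[OF this]
  have "(LBINT x. (LBINT y. u y * \<kappa> (y - x) * \<psi> x)) = (LBINT y. (LBINT x. u y * \<kappa> (y - x) * \<psi> x))" by simp
  moreover have "(LBINT x. u y * \<kappa> (y - x) * \<psi> x) = u y * (LBINT x. \<kappa> (y - x) * \<psi> x)" for y
    by (simp add: mult.assoc)
  ultimately show ?thesis by (simp only: integral_mult_left_zero)
qed

lemma bump_lipschitz:
  fixes \<kappa> :: "'a::euclidean_space \<Rightarrow> real"
  assumes \<kappa>: "bump \<kappa>"
  obtains L where "0 \<le> L" "\<And>x y. \<bar>\<kappa> x - \<kappa> y\<bar> \<le> L * norm (x - y)"
proof -
  have "\<exists>B. \<forall>b\<in>Basis. \<forall>z. \<bar>partial_deriv b \<kappa> z\<bar> \<le> B b" for b :: 'a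
  proof -
    have "\<exists>B. b \<in> Basis \<longrightarrow> (\<forall>z. \<bar>partial_deriv b \<kappa> z\<bar> \<le> B)" for b
      using bump_bounded[OF bump_iter_partial[OF \<kappa>, of "[b]"]]
          by (metis Cons_in_lists_iff iter_partial_simps lists.Nil)
    then show ?thesis by metis
  qed
  then obtain B where B: "\<And>b z. b \<in> Basis \<Longrightarrow> \<bar>partial_deriv b \<kappa> z\<bar> \<le> B b" by metis
  have nn: "0 \<le> B b" if "b \<in> Basis" for b using B[OF that, of 0] by linarith
  define L where "L = (\<Sum>b\<in>Basis. B b)"
  have on: "onorm (\<lambda>h. partial_deriv h \<kappa> z) \<le> L" for z
  proof (rule onorm_le)
    fix h :: 'a
    have lin: "linear (\<lambda>h. partial_deriv h \<kappa> z)"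
      using \<kappa> smooth_has_derivative has_derivative_linear unfolding bump_def by blast
    have "partial_deriv h \<kappa> z = partial_deriv (\<Sum>b\<in>Basis. (h \<bullet> b) *\<^sub>R b) \<kappa> z"
      by (simp add: euclidean_representation)
    also have "\<dots> = (\<Sum>b\<in>Basis. (h \<bullet> b) * partial_deriv b \<kappa> z)"
      by (simp only: linear_sum[OF lin] linear_cmul[OF lin] real_scaleR_def)
    also have "\<bar>\<dots>\<bar> \<le> (\<Sum>b\<in>Basis. norm h * B b)"
      by (rule order_trans[OF sum_abs]) (auto intro!: sum_mono mult_mono simp: abs_mult B Basis_le_norm)
    finally show "norm (partial_deriv h \<kappa> z) \<le> L * norm h" by (simp add: L_def sum_distrib_left mult.commute)
  qed
  have "norm (\<kappa> x - \<kappa> y) \<le> L * norm (x - y)" for x y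
    by (rule differentiable_bound[of UNIV \<kappa> "\<lambda>z h. partial_deriv h \<kappa> z"])
      (use \<kappa> on in \<open>auto simp: bump_def smooth_has_derivative\<close>)
  moreover have "0 \<le> L" unfolding L_def using nn by (rule sum_nonneg)
  ultimately show thesis using that by simp
qed

text \<open>At unit scale the integrand is at most \<open>L * norm (x - x')\<close> and lives on two
  unit balls; a dilation keeps the integral and multiplies the distance by 2^j. The estimate yields
  Lipschitz bounds for convolutions with merely bounded functions.\<close>

lemma bump_translation_L1:
  fixes \<kappa> :: "'a::euclidean_space \<Rightarrow> real"
  assumes \<kappa>: "bump \<kappa>"
  obtains C where "0 \<le> C"
    "\<And>j x x'. (LBINT y. \<bar>dilate j \<kappa> (y - x) - dilate j \<kappa> (y - x')\<bar>) \<le> C * 2 ^ j * norm (x - x')"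
proof -
  obtain L where L: "0 \<le> L" "\<And>x y. \<bar>\<kappa> x - \<kappa> y\<bar> \<le> L * norm (x - y)" using bump_lipschitz[OF \<kappa>] by blast
  have [measurable]: "\<kappa> \<in> borel_measurable borel" using \<kappa> by measurable
  define V where "V = measure lborel (cball (0::'a) 1)"
  have meas: "measure lborel (cball a (1::real)) = V" for a :: 'a
    by (simp add: V_def content_cball)
  have fin: "integrable lborel (\<lambda>y::'a. indicator (cball a 1) y :: real)" for a :: 'a
    using emeasure_lborel_cball_finite by (intro integrable_real_indicator) auto
  have base: "(LBINT y. \<bar>\<kappa> (y - x) - \<kappa> (y - x')\<bar>) \<le> 2 * L * V * norm (x - x')" for x x'
  proof -
    let ?g = "\<lambda>y. L * norm (x - x') * (indicator (cball x 1) y + indicator (cball x' 1) y)"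
    have i: "integrable lborel ?g" using fin by simp
    have le: "\<bar>\<kappa> (y - x) - \<kappa> (y - x')\<bar> \<le> ?g y" for y
    proof (cases "y \<in> cball x 1 \<or> y \<in> cball x' 1")
      case True
      have "\<bar>\<kappa> (y - x) - \<kappa> (y - x')\<bar> \<le> L * norm (x - x')"
        using L(2)[of "y - x" "y - x'"] by (simp add: norm_minus_commute)
      also have "\<dots> \<le> ?g y" using True L(1) by (auto simp: indicator_def)
      finally show ?thesis .
    next
      case False
      then show ?thesis using \<kappa> by (auto simp: bump_def dist_norm norm_minus_commute)
    qed
    have "(LBINT y. \<bar>\<kappa> (y - x) - \<kappa> (y - x')\<bar>) \<le> (LBINT y. ?g y)"
      by (rule integral_mono[OF Bochner_Integration.integrable_bound[OF i] i])
          (use le in \<open>auto intro!: order_trans[OF le]\<close>)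
    also have "\<dots> = 2 * L * V * norm (x - x')" using fin by (simp add: meas)
    finally show ?thesis .
  qed
  have "(LBINT y. \<bar>dilate j \<kappa> (y - x) - dilate j \<kappa> (y - x')\<bar>) \<le> 2 * L * V * 2 ^ j * norm (x - x')" for j x x'
  proof -
    let ?x = "2 ^ j *\<^sub>R x" and ?x' = "2 ^ j *\<^sub>R x'"
    have "(LBINT y. \<bar>dilate j \<kappa> (y - x) - dilate j \<kappa> (y - x')\<bar>) =
       (LBINT y. dilate j (\<lambda>y. \<bar>\<kappa> (y - ?x) - \<kappa> (y - ?x')\<bar>) y)"
      by (simp add: dilate_def abs_mult scaleR_diff_right flip: right_diff_distrib)
    also have "\<dots> = (LBINT y. \<bar>\<kappa> (y - ?x) - \<kappa> (y - ?x')\<bar>)"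
      by (rule integral_dilate) simp
    also have "\<dots> \<le> 2 * L * V * norm (?x - ?x')" by (rule base)
    also have "norm (?x - ?x') = 2 ^ j * norm (x - x')" by (simp flip: scaleR_diff_right)
    finally show ?thesis by (simp add: mult_ac)
  qed
  moreover have "0 \<le> 2 * L * V" using L by (simp add: V_def)
  ultimately show thesis using that by blast
qed

text \<open>A nonnegative function with zero integral vanishes almost everywhere, and by continuity
  everywhere; but \<open>kernel_density\<close> is positive at 0.\<close>

lemma kernel_density_integral_pos: "0 < (LBINT z. kernel_density z)"
proof -
  have i: "integrable lborel (kernel_density :: 'a \<Rightarrow> real)" by (intro bump_integrable bump_kernel_density)
  have "(LBINT z. kernel_density (z::'a)) \<noteq> 0"
  proof
    assume "(LBINT z. kernel_density (z::'a)) = 0"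
    then have "AE z::'a in lborel. kernel_density z = 0"
      using integral_nonneg_eq_0_iff_AE[OF i] by (simp add: kernel_density_nonneg)
    moreover have "closed {z::'a. kernel_density z = 0}"
      by (intro closed_Collect_eq smooth_imp_continuous_on smooth_kernel_density continuous_on_const)
    ultimately have "(0::'a) \<in> {z. kernel_density z = 0}"
      using mem_closed_if_AE_lebesgue[of "{z::'a. kernel_density z = 0}" 0] by (simp add: AE_completion)
    then show False using kernel_density_zero_pos[where 'a = 'a] by simp
  qed
  moreover have "0 \<le> (LBINT z. kernel_density (z::'a))" by (simp add: kernel_density_nonneg)
  ultimately show ?thesis by simp
qed

section \<open>Weak limits and the Dini condition\<close>

text \<open>A substitute for the Banach--Alaoglu theorem: functions of almost minimal \<open>L\<^sup>2\<close> norm in the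
  (closed, convex) tail hulls of the sequence are \<open>L\<^sup>2\<close>-Cauchy by the parallelogram law.\<close>

lemma bounded_weak_limit:
  fixes g :: "nat \<Rightarrow> 'a \<Rightarrow> real" and \<Phi> :: "('a \<Rightarrow> real) set"
  assumes "finite_measure M"
    and gm: "\<And>k. g k \<in> borel_measurable M" and gC: "\<And>k x. x \<in> space M \<Longrightarrow> \<bar>g k x\<bar> \<le> C"
    and \<Phi>: "\<And>\<phi>. \<phi> \<in> \<Phi> \<Longrightarrow> integrable M \<phi>"
    and lim: "\<And>\<phi>. \<phi> \<in> \<Phi> \<Longrightarrow> (\<lambda>k. \<integral>x. g k x * \<phi> x \<partial>M) \<longlonglongrightarrow> \<Lambda> \<phi>"
  shows "\<exists>h. h \<in> borel_measurable M \<and> (\<forall>x\<in>space M. \<bar>h x\<bar> \<le> C) \<and> (\<forall>\<phi>\<in>\<Phi>. (\<integral>x. h x * \<phi> x \<partial>M) = \<Lambda> \<phi>)"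
proof -
  interpret finite_measure M by fact
  define \<mu> where "\<mu> = measure M (space M)"
  \<comment> \<open>The hull of the tail from index \<open>m\<close>, described from outside: every
    upper or lower bound shared by all pairings of the tail with a given \<phi> is inherited by the
    pairing of \<open>h\<close>. Convexity is then immediate, and a limit of elements from later and
    later hulls has the right pairings.\<close>
  define K where "K m = {h. h \<in> borel_measurable M \<and> (\<forall>x\<in>space M. \<bar>h x\<bar> \<le> C) \<and> (\<forall>\<phi>\<in>\<Phi>. \<forall>c.
     ((\<forall>k\<ge>m. (\<integral>x. g k x * \<phi> x \<partial>M) \<le> c) \<longrightarrow> (\<integral>x. h x * \<phi> x \<partial>M) \<le> c) \<and>
     ((\<forall>k\<ge>m. c \<le> (\<integral>x. g k x * \<phi> x \<partial>M)) \<longrightarrow> c \<le> (\<integral>x. h x * \<phi> x \<partial>M)))}" for m :: nat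
  define q where "q h = (\<integral>x. (h x)\<^sup>2 \<partial>M)" for h :: "'a \<Rightarrow> real"
  define d where "d m = Inf (q ` K m)" for m
  have gK: "g m \<in> K m" for m using gm gC by (auto simp: K_def)
  have Kmono: "K l \<subseteq> K m" if "m \<le> l" for l m
    using that order_trans[OF that] unfolding K_def by blast
  have Km[measurable_dest]: "h \<in> K m \<Longrightarrow> h \<in> borel_measurable M" for h m by (simp add: K_def)
  have KC: "h \<in> K m \<Longrightarrow> x \<in> space M \<Longrightarrow> \<bar>h x\<bar> \<le> C" for h m x by (simp add: K_def)
  have Kint: "integrable M (\<lambda>x. h x * \<phi> x)" if "h \<in> K m" "\<phi> \<in> \<Phi>" for h \<phi> m
  proof (rule Bochner_Integration.integrable_bound)
    show "integrable M (\<lambda>x. C * \<phi> x)" using \<Phi>[OF that(2)] by simp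
    show "(\<lambda>x. h x * \<phi> x) \<in> borel_measurable M"
      by (rule borel_measurable_times[OF Km[OF that(1)] borel_measurable_integrable[OF \<Phi>[OF that(2)]]])
    show "AE x in M. norm (h x * \<phi> x) \<le> norm (C * \<phi> x)"
    proof (rule AE_I2)
      fix x assume "x \<in> space M"
      then have "\<bar>h x\<bar> \<le> \<bar>C\<bar>" using KC[OF that(1)] by fastforce
      then show "norm (h x * \<phi> x) \<le> norm (C * \<phi> x)" by (simp add: abs_mult mult_right_mono)
    qed
  qed
  have Ksq: "integrable M (\<lambda>x. h x * h' x)" if "h \<in> K m" "h' \<in> K m'" for h h' m m'
  proof (rule integrable_const_bound[where B = "C * C"])
    show "AE x in M. norm (h x * h' x) \<le> C * C"
      using KC[OF that(1)] KC[OF that(2)] by (intro AE_I2) (simp add: abs_mult mult_mono')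
  qed (rule borel_measurable_times[OF Km[OF that(1)] Km[OF that(2)]])
  have mid: "(\<lambda>x. (h x + h' x) / 2) \<in> K m" if h: "h \<in> K m" "h' \<in> K m" for h h' m
  proof -
    have e: "(\<integral>x. (h x + h' x) / 2 * \<phi> x \<partial>M) = ((\<integral>x. h x * \<phi> x \<partial>M) + (\<integral>x. h' x * \<phi> x \<partial>M)) / 2" if "\<phi> \<in> \<Phi>" for \<phi>
      using Kint[OF h(1) that] Kint[OF h(2) that] by (simp add: distrib_right)
    show ?thesis unfolding K_def mem_Collect_eq
    proof (intro conjI ballI allI impI)
      show "(\<lambda>x. (h x + h' x) / 2) \<in> borel_measurable M"
        using Km[OF h(1)] Km[OF h(2)] by simp
      show "\<bar>(h x + h' x) / 2\<bar> \<le> C" if "x \<in> space M" for x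
      proof -
        have "\<bar>h x + h' x\<bar> \<le> 2 * C" using KC[OF h(1) that] KC[OF h(2) that] by linarith
        then show ?thesis by simp
      qed
    next
      fix \<phi> c assume \<phi>: "\<phi> \<in> \<Phi>" and b: "\<forall>k\<ge>m. (\<integral>x. g k x * \<phi> x \<partial>M) \<le> c"
      have "(\<integral>x. h x * \<phi> x \<partial>M) \<le> c" "(\<integral>x. h' x * \<phi> x \<partial>M) \<le> c"
        using h \<phi> b unfolding K_def by blast+
      then show "(\<integral>x. (h x + h' x) / 2 * \<phi> x \<partial>M) \<le> c" unfolding e[OF \<phi>] by simp
    next
      fix \<phi> c assume \<phi>: "\<phi> \<in> \<Phi>" and b: "\<forall>k\<ge>m. c \<le> (\<integral>x. g k x * \<phi> x \<partial>M)"
      have "c \<le> (\<integral>x. h x * \<phi> x \<partial>M)" "c \<le> (\<integral>x. h' x * \<phi> x \<partial>M)"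
        using h \<phi> b unfolding K_def by blast+
      then show "c \<le> (\<integral>x. (h x + h' x) / 2 * \<phi> x \<partial>M)" unfolding e[OF \<phi>] by simp
    qed
  qed
  have q0: "0 \<le> q h" for h by (simp add: q_def)
  have dle: "d m \<le> q h" if "h \<in> K m" for h m
    unfolding d_def using that q0 by (intro cInf_lower bdd_belowI2[of _ 0]) auto
  have dmono: "incseq d"
    unfolding d_def by (intro monoI cInf_superset_mono image_mono Kmono bdd_belowI2[of _ 0] q0) (use gK in auto)
  have "d m \<le> C\<^sup>2 * \<mu>" for m
  proof -
    have "q (g m) \<le> (\<integral>x. C\<^sup>2 \<partial>M)" unfolding q_def
    proof (rule integral_mono)
      show "integrable M (\<lambda>x. (g m x)\<^sup>2)" using Ksq[OF gK gK, of m m] by (simp add: power2_eq_square)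
      show "(g m x)\<^sup>2 \<le> C\<^sup>2" if "x \<in> space M" for x
        using order_trans[OF gC[OF that] abs_ge_self] by (simp add: abs_le_square_iff[symmetric])
    qed simp
    then show ?thesis using dle[OF gK, of m] by (simp add: \<mu>_def mult.commute)
  qed
  then obtain L where L: "d \<longlonglongrightarrow> L" "\<And>m. d m \<le> L"
    using incseq_convergent[OF dmono] by metis
  \<comment> \<open>The infima \<open>d m\<close> of the squared L^2 norm increase to
    \<open>L\<close>. Beyond a late index they exceed L - 4^-i, while some element of the hull stays
    below L + 4^-i.\<close>
  have "\<exists>m h. i \<le> m \<and> h \<in> K m \<and> L - (1 / 4) ^ i < d m \<and> q h < L + (1 / 4) ^ i" for i
  proof -
    have "eventually (\<lambda>m. L - (1 / 4) ^ i < d m) sequentially"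
      by (rule order_tendstoD(1)[OF L(1)]) simp
    then obtain m where m: "i \<le> m" "L - (1 / 4) ^ i < d m"
      using eventually_happens'[OF sequentially_bot eventually_conj[OF _ eventually_ge_at_top[of i]]] by blast
    have "Inf (q ` K m) < L + (1 / 4) ^ i" using L(2)[of m] unfolding d_def by (rule le_less_trans) simp
    then obtain h where "h \<in> K m" "q h < L + (1 / 4) ^ i"
      using cInf_lessD[of "q ` K m"] gK by blast
    then show ?thesis using m by blast
  qed
  then obtain m h where mh: "\<And>i. i
      \<le> m i" "\<And>i. h i \<in> K (m i)" "\<And>i. L - (1 / 4) ^ i < d (m i)" "\<And>i. q (h i) < L + (1 / 4) ^ i"
    by metis
  have [measurable]: "h i \<in> borel_measurable M" for i using mh(2) by measurable
  have hC: "x \<in> space M \<Longrightarrow> \<bar>h i x\<bar> \<le> C" for i x using KC[OF mh(2)] .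
  have L2: "(\<integral>x. (h (Suc i) x - h i x)\<^sup>2 \<partial>M) \<le> 8 * (1 / 4) ^ i" for i
  proof -
    \<comment> \<open>The chosen indices need not increase, so both functions are placed in the
      larger hull, that of the smaller index. Their midpoint lies there too and has energy at least
      \<open>d l\<close>, which is what the parallelogram law uses.\<close>
    define l where "l = min (m i) (m (Suc i))"
    have p: "0 < (1 / 4 :: real) ^ i" by simp
    have "L - (1 / 4) ^ i < d (m (Suc i))" using mh(3)[of "Suc i"] p power_Suc[of "1 / 4 :: real" i] by linarith
    then have dl: "L - (1 / 4) ^ i < d l"
      using mh(3)[of i] by (simp add: l_def min_def)
    have "l \<le> m i" "l \<le> m (Suc i)" by (simp_all add: l_def)
    then have K: "h i \<in> K l" "h (Suc i) \<in> K l" using Kmono mh(2) by blast+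
    have "d l \<le> q (\<lambda>x. (h i x + h (Suc i) x) / 2)" by (rule dle[OF mid[OF K]])
    moreover have "(\<integral>x. (h (Suc i) x - h i x)\<^sup>2 \<partial>M)
        = 2 * q (h (Suc i)) + 2 * q (h i) - 4 * q (\<lambda>x. (h i x + h (Suc i) x) / 2)"
    proof -
      have "(h (Suc i) x - h i x)\<^sup>2 = 2 * (h (Suc i) x)\<^sup>2 + 2 * (h i x)\<^sup>2 - 4 * ((h i x + h (Suc i) x) /
          2)\<^sup>2" for x
        by (simp add: power2_eq_square field_simps)
      moreover have "integrable M (\<lambda>x. (h i x)\<^sup>2)" "integrable M (\<lambda>x. (h (Suc i) x)\<^sup>2)" "integrable M (\<lambda>x.
          ((h i x + h (Suc i) x) / 2)\<^sup>2)"
        using Ksq[OF K(1,1)] Ksq[OF K(2,2)] Ksq[OF mid[OF K] mid[OF K]] by (simp_all add: power2_eq_square)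
      ultimately show ?thesis unfolding q_def by simp
    qed
    ultimately show ?thesis using mh(4)[of i] mh(4)[of "Suc i"] dl p power_Suc[of "1 / 4 :: real" i] by linarith
  qed
  have int: "integrable M (\<lambda>x. \<bar>h (Suc i) x - h i x\<bar>)" for i
  proof (rule integrable_const_bound[where B = "2 * C"])
    show "AE x in M. norm \<bar>h (Suc i) x - h i x\<bar> \<le> 2 * C"
    proof (rule AE_I2)
      fix x assume "x \<in> space M"
      then show "norm \<bar>h (Suc i) x - h i x\<bar> \<le> 2 * C" using hC[of x i] hC[of x "Suc i"] by simp
    qed
  qed measurable
  have L1: "(\<integral>x. \<bar>h (Suc i) x - h i x\<bar> \<partial>M) \<le> (4 + \<mu>) * (1 / 2) ^ i" for i
  proof -
    have i2: "integrable M (\<lambda>x. (h (Suc i) x - h i x)\<^sup>2)"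
    proof (rule integrable_const_bound[where B = "(2 * C)\<^sup>2"])
      show "AE x in M. norm ((h (Suc i) x - h i x)\<^sup>2) \<le> (2 * C)\<^sup>2"
      proof (rule AE_I2)
        fix x assume "x \<in> space M"
        then have "\<bar>h (Suc i) x - h i x\<bar> \<le> 2 * C" using hC[of x i] hC[of x "Suc i"] by linarith
        from power_mono[OF this abs_ge_zero, of 2]
        show "norm ((h (Suc i) x - h i x)\<^sup>2) \<le> (2 * C)\<^sup>2" by simp
      qed
    qed measurable
    \<comment> \<open>Young's inequality 2 a <= 2^i a^2 + 2^-i trades the decay 4^-i of the squared
      L^2 norm for a decay 2^-i of the L^1 norm, which is summable.\<close>
    have "(\<integral>x. \<bar>h (Suc i) x - h i x\<bar> \<partial>M) \<le> (\<integral>x. (2 ^ i * (h (Suc i) x - h i x)\<^sup>2 + (1 / 2) ^ i) / 2 \<partial>M)"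
    proof (rule integral_mono[OF int])
      fix x
      define a where "a = \<bar>h (Suc i) x - h i x\<bar>"
      have "0 \<le> (2 ^ i * a - 1)\<^sup>2" by simp
      then have "2 ^ i * (2 * a) \<le> 2 ^ i * (2 ^ i * a\<^sup>2 + (1 / 2) ^ i)"
        by (simp add: power2_eq_square algebra_simps power_one_over)
      then have "2 * a \<le> 2 ^ i * a\<^sup>2 + (1 / 2) ^ i" by (rule mult_left_le_imp_le) simp
      then show "\<bar>h (Suc i) x - h i x\<bar> \<le> (2 ^ i * (h (Suc i) x - h i x)\<^sup>2 + (1 / 2) ^ i) / 2"
        by (simp add: a_def)
    qed (use i2 in simp)
    also have "\<dots> = (2 ^ i * (\<integral>x. (h (Suc i) x - h i x)\<^sup>2 \<partial>M) + \<mu> * (1 / 2) ^ i) / 2"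
      using i2 by (simp add: \<mu>_def)
    also have "\<dots> \<le> (2 ^ i * (8 * (1 / 4) ^ i) + \<mu> * (1 / 2) ^ i) / 2"
      using L2[of i] by simp
    also have "\<dots> = (4 + \<mu> / 2) * (1 / 2) ^ i"
    proof -
      have "(2::real) ^ i * (1 / 4) ^ i = (1 / 2) ^ i" by (simp add: power_mult_distrib[symmetric])
      then show ?thesis by (simp add: algebra_simps)
    qed
    also have "\<dots> \<le> (4 + \<mu>) * (1 / 2) ^ i" by (intro mult_right_mono) (auto simp: \<mu>_def)
    finally show ?thesis .
  qed
  have conv: "AE x in M. convergent (\<lambda>i. h i x)"
  proof -
    have "(\<integral>\<^sup>+x. (\<Sum>i. ennreal \<bar>h (Suc i) x - h i x\<bar>) \<partial>M) = (\<Sum>i. \<integral>\<^sup>+x. ennreal \<bar>h (Suc i) x - h i x\<bar> \<partial>M)"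
      by (rule nn_integral_suminf) measurable
    also have "\<dots> = (\<Sum>i. ennreal (\<integral>x. \<bar>h (Suc i) x - h i x\<bar> \<partial>M))"
      using int by (intro suminf_cong nn_integral_eq_integral) auto
    also have "\<dots> \<le> (\<Sum>i. ennreal ((4 + \<mu>) * (1 / 2) ^ i))"
      by (intro suminf_le ennreal_leI L1 summableI)
    also have "\<dots> < \<infinity>"
    proof -
      have "summable (\<lambda>i. (4 + \<mu>) * (1 / 2 :: real) ^ i)" by (intro summable_mult summable_geometric) simp
      then show ?thesis by (subst suminf_ennreal2) (auto simp: \<mu>_def)
    qed
    finally have "AE x in M. (\<Sum>i. ennreal \<bar>h (Suc i) x - h i x\<bar>) \<noteq> \<infinity>"
      by (intro nn_integral_PInf_AE) auto
    then show ?thesis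
    proof eventually_elim
      case (elim x)
      then have "summable (\<lambda>i. \<bar>h (Suc i) x - h i x\<bar>)" by (intro summable_suminf_not_top) auto
      then have "summable (\<lambda>i. h (Suc i) x - h i x)" by (rule summable_rabs_cancel)
      then have "convergent (\<lambda>n. h n x - h 0 x)"
        unfolding summable_iff_convergent sum_lessThan_telescope[of "\<lambda>n. h n x"] .
      then have "convergent (\<lambda>n. (h n x - h 0 x) + h 0 x)" by (rule convergent_add[OF _ convergent_const])
      then show ?case by simp
    qed
  qed
  \<comment> \<open>The limit is clamped so that the bound \<open>C\<close> also holds on the null
    set where the sequence diverges.\<close>
  define h' where "h' x = max (- C) (min C (lim (\<lambda>i. h i x)))" for x
  have [measurable]: "h' \<in> borel_measurable M" unfolding h'_def[abs_def] by measurable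
  have h'lim: "AE x in M. (\<lambda>i. h i x) \<longlonglongrightarrow> h' x"
    using conv AE_space
  proof eventually_elim
    case (elim x)
    then have l: "(\<lambda>i. h i x) \<longlonglongrightarrow> lim (\<lambda>i. h i x)" by (simp add: convergent_LIMSEQ_iff)
    have b: "h i x \<le> C" "- C \<le> h i x" for i using hC[OF elim(2), of i] by linarith+
    have "lim (\<lambda>i. h i x) \<le> C" "- C \<le> lim (\<lambda>i. h i x)"
      using LIMSEQ_le_const2[OF l] LIMSEQ_le_const[OF l] b by blast+
    then show ?case using l by (simp add: h'_def)
  qed
  have "(\<integral>x. h' x * \<phi> x \<partial>M) = \<Lambda> \<phi>" if \<phi>: "\<phi> \<in> \<Phi>" for \<phi>
  proof -
    have [measurable]: "\<phi> \<in> borel_measurable M" using \<Phi>[OF \<phi>] by auto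
    have "(\<lambda>i. \<integral>x. h i x * \<phi> x \<partial>M) \<longlonglongrightarrow> (\<integral>x. h' x * \<phi> x \<partial>M)"
    proof (rule integral_dominated_convergence[where w = "\<lambda>x. C * \<bar>\<phi> x\<bar>"])
      show "AE x in M. (\<lambda>i. h i x * \<phi> x) \<longlonglongrightarrow> h' x * \<phi> x"
        using h'lim by eventually_elim (intro tendsto_intros)
      show "AE x in M. norm (h i x * \<phi> x) \<le> C * \<bar>\<phi> x\<bar>" for i
        using hC by (auto simp: abs_mult intro!: mult_right_mono)
    qed (use \<Phi>[OF \<phi>] in auto)
    moreover have "(\<lambda>i. \<integral>x. h i x * \<phi> x \<partial>M) \<longlonglongrightarrow> \<Lambda> \<phi>"
    proof (rule LIMSEQ_I)
      fix e :: real assume "0 < e"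
      then obtain N where N: "\<And>k. N \<le> k \<Longrightarrow> norm ((\<integral>x. g k x * \<phi> x \<partial>M) - \<Lambda> \<phi>) < e / 2"
        using LIMSEQ_D[OF lim[OF \<phi>], of "e / 2"] by auto
      have b: "(\<integral>x. g k x * \<phi> x \<partial>M) \<le> \<Lambda> \<phi> + e / 2" "\<Lambda> \<phi> - e / 2 \<le> (\<integral>x. g k x * \<phi> x \<partial>M)" if "N \<le> k" for k
        using N[OF that, unfolded real_norm_def] by linarith+
      have "norm ((\<integral>x. h i x * \<phi> x \<partial>M) - \<Lambda> \<phi>) < e" if "N \<le> i" for i
      proof -
        have "h i \<in> K N" using mh(2)[of i] Kmono[of N "m i"] mh(1)[of i] that by auto
        then have "(\<integral>x. h i x * \<phi> x \<partial>M) \<le> \<Lambda> \<phi> + e / 2" "\<Lambda> \<phi> - e / 2 \<le> (\<integral>x. h i x * \<phi> x \<partial>M)"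
          using \<phi> b unfolding K_def by blast+
        then show ?thesis unfolding real_norm_def using \<open>0 < e\<close> by linarith
      qed
      then show "\<exists>N. \<forall>i\<ge>N. norm ((\<integral>x. h i x * \<phi> x \<partial>M) - \<Lambda> \<phi>) < e" by blast
    qed
    ultimately show ?thesis by (rule LIMSEQ_unique)
  qed
  moreover have "\<bar>h' x\<bar> \<le> C" if "x \<in> space M" for x
  proof -
    have "0 \<le> C" using hC[OF that, of 0] by linarith
    then show ?thesis by (simp add: h'_def abs_le_iff)
  qed
  ultimately show ?thesis by (intro exI[of _ h']) auto
qed

text \<open>The function is tested against approximations of itself: a measurable \<open>w\<close>
  is an almost everywhere limit of continuous functions, which are clamped to [-B, B] and multiplied
  by a cutoff \<open>\<eta>\<close> positive exactly on the open ball. In the limit the integral of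
  \<open>\<eta>\<close> w^2 vanishes.\<close>

lemma AE_zero_if_orthogonal_continuous:
  fixes w :: "'a::euclidean_space \<Rightarrow> real"
  assumes [measurable]: "w \<in> borel_measurable borel" and B: "\<And>x. \<bar>w x\<bar> \<le> B"
    and orth: "\<And>\<psi>. continuous_on UNIV \<psi> \<Longrightarrow> (\<And>z. r < norm z \<Longrightarrow> \<psi> z = 0) \<Longrightarrow> (LBINT x. w x * \<psi> x) = 0"
  shows "AE x in lborel. norm x < r \<longrightarrow> w x = 0"
proof -
  have "w measurable_on UNIV"
    by (intro lebesgue_measurable_imp_measurable_on) (auto intro: measurable_completion)
  then obtain N g where N: "negligible N" and g: "\<And>n. continuous_on UNIV (g n)"
    and gw: "\<And>x. x \<notin> N \<Longrightarrow> (\<lambda>n. g n x) \<longlonglongrightarrow> w x"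
    unfolding measurable_on_def by auto
  define \<eta> where "\<eta> x = max 0 (r - norm x)" for x :: 'a
  define \<psi> where "\<psi> n x = \<eta> x * max (- B) (min B (g n x))" for n x
  have \<eta>c: "continuous_on UNIV \<eta>" unfolding \<eta>_def by (intro continuous_intros)
  have \<psi>c: "continuous_on UNIV (\<psi> n)" for n
    unfolding \<psi>_def by (intro continuous_intros \<eta>c g)
  have [measurable]: "\<eta> \<in> borel_measurable borel" "\<psi> n \<in> borel_measurable borel" for n
    using \<eta>c \<psi>c by (auto intro: borel_measurable_continuous_onI)
  have \<eta>0: "\<eta> x = 0" if "r < norm x" for x using that by (simp add: \<eta>_def)
  have i\<eta>: "integrable lborel \<eta>" by (rule integrable_continuous_support[OF \<eta>c \<eta>0])
  have nB: "0 \<le> B" using B[of 0] by linarith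
  have \<eta>nn: "0 \<le> \<eta> x" for x by (simp add: \<eta>_def)
  have zero: "(LBINT x. w x * \<psi> n x) = 0" for n
    by (rule orth[OF \<psi>c]) (simp add: \<psi>_def \<eta>0)
  have "AE x in lebesgue. x \<notin> N"
    using N by (intro AE_not_in) (simp add: negligible_iff_null_sets)
  then have "AE x in lborel. x \<notin> N" by (simp add: AE_completion_iff)
  then have "AE x in lborel. (\<lambda>n. w x * \<psi> n x) \<longlonglongrightarrow> w x * (\<eta> x * w x)"
  proof eventually_elim
    case (elim x)
    have "(\<lambda>n. g n x) \<longlonglongrightarrow> w x" using gw elim by blast
    then have "(\<lambda>n. w x * \<psi> n x) \<longlonglongrightarrow> w x * (\<eta> x * max (- B) (min B (w x)))"
      unfolding \<psi>_def by (intro tendsto_mult tendsto_const tendsto_max tendsto_min)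
    moreover have "max (- B) (min B (w x)) = w x" using B[of x] by (auto simp: abs_le_iff max_def min_def)
    ultimately show ?case by simp
  qed
  moreover have "norm (w x * \<psi> n x) \<le> B * B * \<eta> x" for n x
  proof -
    have "\<bar>max (- B) (min B (g n x))\<bar> \<le> B" using nB by (simp add: abs_le_iff)
    then have "\<bar>w x\<bar> * (\<eta> x * \<bar>max (- B) (min B (g n x))\<bar>) \<le> B * (\<eta> x * B)"
      using B[of x] nB \<eta>nn[of x] by (intro mult_mono) auto
    then show ?thesis using \<eta>nn[of x] by (simp add: \<psi>_def abs_mult mult_ac)
  qed
  ultimately have "(\<lambda>n. LBINT x. w x * \<psi> n x) \<longlonglongrightarrow> (LBINT x. w x * (\<eta> x * w x))"
    using i\<eta> by (intro integral_dominated_convergence[where w = "\<lambda>x. B * B * \<eta> x"]) auto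
  then have 0: "(LBINT x. \<eta> x * (w x)\<^sup>2) = 0"
    by (simp add: zero LIMSEQ_const_iff power2_eq_square mult_ac)
  have "integrable lborel (\<lambda>x. \<eta> x * (w x)\<^sup>2)"
  proof (rule Bochner_Integration.integrable_bound[of _ "\<lambda>x. B\<^sup>2 * \<eta> x"])
    show "AE x in lborel. norm (\<eta> x * (w x)\<^sup>2) \<le> norm (B\<^sup>2 * \<eta> x)"
      using B nB \<eta>nn by (intro AE_I2)
          (auto simp: abs_mult mult.commute abs_le_square_iff[symmetric] intro!: mult_left_mono)
  qed (use i\<eta> in auto)
  then have "AE x in lborel. \<eta> x * (w x)\<^sup>2 = 0"
    using integral_nonneg_eq_0_iff_AE[of lborel "\<lambda>x. \<eta> x * (w x)\<^sup>2"] 0 \<eta>nn by simp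
  then show ?thesis by eventually_elim (auto simp: \<eta>_def)
qed

text \<open>By monotonicity \<omega>(s)/s is at least \<omega>(t_j)/(2 t_j) on (t_j, 2 t_j), an
  interval of length t_j, so its integral there is at least \<omega>(t_j)/2. For t_j = a 2^-j these
  intervals are disjoint.\<close>

lemma dini_summable:
  assumes \<omega>: "modulus_of_continuity \<omega>" "dini \<omega>" and a: "0 < a"
  shows "summable (\<lambda>j. \<omega> (a * (1 / 2) ^ j))"
proof -
  obtain \<epsilon> where \<epsilon>: "0 < \<epsilon>" and int: "set_integrable lborel {0<..<\<epsilon>} (\<lambda>s. \<omega> s / s)"
    using \<omega>(2) unfolding dini_def by blast
  define t where "t j = a * (1 / 2) ^ j" for j :: nat
  have t0: "0 < t j" for j using a by (simp add: t_def)
  have nn: "0 \<le> \<omega> s" if "0 \<le> s" for s using \<omega>(1) that by (simp add: modulus_of_continuity_def)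
  have mono: "\<omega> s \<le> \<omega> s'" if "0 \<le> s" "s \<le> s'" for s s'
  proof -
    have "mono_on {0..} \<omega>" using \<omega>(1) by (simp add: modulus_of_continuity_def)
    from mono_onD[OF this _ _ that(2)] show ?thesis using that by simp
  qed
  have "t \<longlonglongrightarrow> a * 0" unfolding t_def by (intro tendsto_intros LIMSEQ_realpow_zero) auto
  then have "eventually (\<lambda>j. t j < \<epsilon> / 2) sequentially" using \<epsilon> by (intro order_tendstoD) auto
  \<comment> \<open>With t_j < \<epsilon>/2 the whole interval (t_j, 2 t_j) lies in the range where
    the Dini integral is finite.\<close>
  then obtain N where N: "\<And>j. N \<le> j \<Longrightarrow> t j < \<epsilon> / 2" unfolding eventually_sequentially by blast
  have tmono: "2 * t j \<le> t i" if "i < j" for i j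
  proof -
    have "(1 / 2 :: real) ^ j \<le> (1 / 2) ^ Suc i" using that by (intro power_decreasing) auto
    then show ?thesis using a by (simp add: t_def)
  qed
  define F where "F = (\<lambda>s. indicator {0<..<\<epsilon>} s * (\<omega> s / s))"
  have F: "integrable lborel F" using int unfolding set_integrable_def F_def by simp
  have le: "(\<Sum>j=N..<n. \<omega> (t j) / (2 * t j) * indicator {t j<..<2 * t j} s) \<le> F s" for n s
  proof (cases "\<exists>i\<in>{N..<n}. s \<in> {t i<..<2 * t i}")
    case False
    then have "(\<Sum>j=N..<n. \<omega> (t j) / (2 * t j) * indicator {t j<..<2 * t j} s) = 0" by (intro sum.neutral) auto
    moreover have "0 \<le> F s" using nn[of s] by (auto simp: F_def indicator_def)
    ultimately show ?thesis by simp
  next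
    case True
    then obtain i where i: "i \<in> {N..<n}" "s \<in> {t i<..<2 * t i}" by blast
    have "s \<notin> {t j<..<2 * t j}" if "j \<noteq> i" for j
      using tmono[of i j] tmono[of j i] i(2) that by (cases "i < j") auto
    then have "(\<Sum>j=N..<n. \<omega> (t j) / (2 * t j) * indicator {t j<..<2 * t j} s)
        = (\<Sum>j\<in>{i}. \<omega> (t j) / (2 * t j) * indicator {t j<..<2 * t j} s)"
      using i by (intro sum.mono_neutral_right) (auto simp: indicator_def)
    also have "\<dots> = \<omega> (t i) / (2 * t i)" using i by simp
    also have "\<dots> \<le> \<omega> s / s"
      using i(2) t0[of i] nn[of "t i"] mono[of "t i" s] by (intro frac_le) (auto simp: less_imp_le)
    also have "\<dots> = F s" using N[of i] i t0[of i] by (simp add: F_def indicator_def)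
    finally show ?thesis .
  qed
  have ii: "integrable lborel (\<lambda>s. \<omega> (t j) / (2 * t j) * indicator {t j<..<2 * t j} s)" for j
    using t0[of j] by (intro integrable_mult_right integrable_real_indicator) auto
  have "(\<Sum>j=N..<n. \<omega> (t j) / 2) \<le> integral\<^sup>L lborel F" for n
  proof -
    have "\<omega> (t j) / 2 = (LBINT s. \<omega> (t j) / (2 * t j) * indicator {t j<..<2 * t j} s)" for j
      using t0[of j] by simp
    then have "(\<Sum>j=N..<n. \<omega> (t j) / 2) = (\<Sum>j=N..<n. LBINT s. \<omega> (t j) / (2 * t j) * indicator {t j<..<2 * t j} s)"
      by (intro sum.cong refl)
    also have "\<dots> = (LBINT s. (\<Sum>j=N..<n. \<omega> (t j) / (2 * t j) * indicator {t j<..<2 * t j} s))"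
      by (rule Bochner_Integration.integral_sum[OF ii, symmetric])
    also have "\<dots> \<le> integral\<^sup>L lborel F"
      by (rule integral_mono[OF Bochner_Integration.integrable_sum[OF ii] F le])
    finally show ?thesis .
  qed
  then have "(\<Sum>j=N..<n. \<omega> (t j)) / 2 \<le> integral\<^sup>L lborel F" for n
    by (simp only: sum_divide_distrib)
  then have bound: "(\<Sum>j=N..<n. \<omega> (t j)) \<le> 2 * integral\<^sup>L lborel F" for n
    by (simp add: mult.commute)
  have "summable (\<lambda>j. \<omega> (t (j + N)))"
  proof (rule summableI_nonneg_bounded)
    show "(\<Sum>j<n. \<omega> (t (j + N))) \<le> 2 * integral\<^sup>L lborel F" for n
      using bound[of "n + N"] sum.shift_bounds_nat_ivl[of "\<lambda>j. \<omega> (t j)" 0 N n] by (simp add: lessThan_atLeast0)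
  qed (use nn t0 less_imp_le in blast)
  then show ?thesis unfolding t_def by (simp add: summable_iff_shift[of "\<lambda>j. \<omega> (a * (1 / 2) ^ j)"])
qed

section \<open>The Newtonian potential\<close>

lemma bounded_times_integrable:
  fixes u \<kappa> :: "'a::euclidean_space \<Rightarrow> real"
  assumes [measurable]: "u \<in> borel_measurable borel" and M: "\<And>x. \<bar>u x\<bar> \<le> M" and \<kappa>: "integrable lborel \<kappa>"
  shows "integrable lborel (\<lambda>y. u y * \<kappa> y)" and "\<bar>LBINT y. u y * \<kappa> y\<bar> \<le> M * (LBINT y. \<bar>\<kappa> y\<bar>)"
proof -
  have [measurable]: "\<kappa> \<in> borel_measurable borel" using \<kappa> by auto
  have i: "integrable lborel (\<lambda>y. M * \<bar>\<kappa> y\<bar>)" using \<kappa> by simp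
  have le: "norm (u y * \<kappa> y) \<le> M * \<bar>\<kappa> y\<bar>" for y
    using mult_right_mono[OF M[of y], of "\<bar>\<kappa> y\<bar>"] by (simp add: abs_mult)
  show int: "integrable lborel (\<lambda>y. u y * \<kappa> y)"
  proof (rule Bochner_Integration.integrable_bound[OF i])
    show "AE y in lborel. norm (u y * \<kappa> y) \<le> norm (M * \<bar>\<kappa> y\<bar>)"
      using order_trans[OF le] by (intro AE_I2) (simp only: real_norm_def abs_ge_self)
  qed simp
  show "\<bar>LBINT y. u y * \<kappa> y\<bar> \<le> M * (LBINT y. \<bar>\<kappa> y\<bar>)"
    using Bochner_Integration.integral_norm_bound_integral[OF int i le] by simp
qed

lemma bounded_times_translate:
  fixes u \<kappa> :: "'a::euclidean_space \<Rightarrow> real"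
  assumes "u \<in> borel_measurable borel" "\<And>x. \<bar>u x\<bar> \<le> M" and \<kappa>: "integrable lborel \<kappa>"
  shows "integrable lborel (\<lambda>y. u y * \<kappa> (y - x))" and "\<bar>LBINT y. u y * \<kappa> (y - x)\<bar> \<le> M * (LBINT y. \<bar>\<kappa> y\<bar>)"
proof -
  have [measurable]: "\<kappa> \<in> borel_measurable borel" using \<kappa> by auto
  have "integrable lborel (\<lambda>y. \<kappa> (y - x))" using \<kappa> integral_translate(2)[of \<kappa> x] by simp
  from bounded_times_integrable[OF assms(1,2) this] integral_translate(1)[of "\<lambda>y. \<bar>\<kappa> y\<bar>" x]
  show "integrable lborel (\<lambda>y. u y * \<kappa> (y - x))" and "\<bar>LBINT y. u y * \<kappa> (y - x)\<bar> \<le> M * (LBINT y. \<bar>\<kappa> y\<bar>)"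
    by simp_all
qed

lemma kernel_density_minus: "kernel_density (- z) = kernel_density z"
  by (simp add: kernel_density_eq)

lemma truncated_kernel_minus:
  "2 \<le> DIM('a::euclidean_space) \<Longrightarrow> truncated_kernel k (- z) = truncated_kernel k (z::'a)"
  by (simp add: truncated_kernel_eq regular_kernel_def)

lemma kernel_layer_integral:
  assumes "2 \<le> DIM('a::euclidean_space)"
  shows "integrable lborel (kernel_layer j :: 'a \<Rightarrow> real)"
    and "(LBINT z. \<bar>kernel_layer j (z::'a)\<bar>) = (1 / 4) ^ j * (LBINT z. \<bar>kernel_step (z::'a)\<bar>)"
proof -
  have b: "bump (kernel_step :: 'a \<Rightarrow> real)" by (rule bump_kernel_step[OF assms])
  have "integrable lborel (dilate j (kernel_step :: 'a \<Rightarrow> real))"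
    by (rule integral_dilate(2)[OF bump_measurable[OF b] bump_integrable[OF b]])
  then show "integrable lborel (kernel_layer j :: 'a \<Rightarrow> real)" unfolding kernel_layer_def[abs_def] by simp
  show "(LBINT z. \<bar>kernel_layer j (z::'a)\<bar>) = (1 / 4) ^ j * (LBINT z. \<bar>kernel_step (z::'a)\<bar>)"
    using integral_abs_dilate[OF bump_measurable[OF b], of j] by (simp add: kernel_layer_def abs_mult)
qed

lemma newtonian_kernel_measurable [measurable]:
  "(newtonian_kernel :: 'a::euclidean_space \<Rightarrow> real) \<in> borel_measurable borel"
  unfolding newtonian_kernel_def[abs_def] by measurable

text \<open>The error is the sum of the layers from \<open>k\<close> on, whose L^1 norms are a
  multiple of 4^-j; the geometric sum has the factor 4/3, rounded up to 2. At each z other than 0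
  this sum is finite, since sufficiently fine layers vanish there.\<close>

lemma newtonian_kernel_approx:
  fixes k :: nat
  assumes n: "2 \<le> DIM('a::euclidean_space)"
  defines "E \<equiv> \<lambda>z::'a. kernel_const DIM('a) * newtonian_kernel z - truncated_kernel k z"
  shows "integrable lborel E"
    and "(LBINT z. \<bar>E z\<bar>) \<le> 2 * (1 / 4) ^ k * (LBINT z. \<bar>kernel_step (z::'a)\<bar>)"
proof -
  define I where "I = (LBINT z. \<bar>kernel_step (z::'a)\<bar>)"
  have I0: "0 \<le> I" by (simp add: I_def)
  have [measurable]: "truncated_kernel k \<in> borel_measurable (borel :: 'a measure)"
     "kernel_layer j \<in> borel_measurable (borel :: 'a measure)" for j
    by (intro smooth_borel_measurable smooth_truncated_kernel smooth_kernel_layer)+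
  have [measurable]: "E \<in> borel_measurable borel" unfolding E_def by measurable
  have pw: "ennreal \<bar>E z\<bar> \<le> (\<Sum>j. ennreal \<bar>kernel_layer (j + k) z\<bar>)" if z: "z \<noteq> 0" for z
  proof -
    \<comment> \<open>From the scale \<open>m0 + k\<close> on the truncated kernel at z is already
      exact, so finitely many layers separate it from \<open>truncated_kernel k\<close>; adding
      \<open>k\<close> keeps the index at least \<open>k\<close>.\<close>
    obtain m0 where "(1 / 2) ^ m0 < norm z" using real_arch_pow_inv[of "norm z" "1 / 2"] z by auto
    moreover have "(1 / 2 :: real) ^ (m0 + k) \<le> (1 / 2) ^ m0" by (intro power_decreasing) auto
    ultimately have m: "(1 / 2) ^ (m0 + k) \<le> norm z" by linarith
    have "kernel_const DIM('a) * newtonian_kernel z = truncated_kernel (m0 + k) z"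
      using truncated_kernel_outside[OF n m] newtonian_kernel_eq[OF n z] by simp
    then have "E z = (\<Sum>j<m0 + k. kernel_layer j z) - (\<Sum>j<k. kernel_layer j z)"
      by (simp add: E_def truncated_kernel_def)
    also have "\<dots> = (\<Sum>j<m0. kernel_layer (j + k) z)"
    proof -
      have "(\<Sum>j<m0 + k. kernel_layer j z) = (\<Sum>j<k. kernel_layer j z) + (\<Sum>j=k..<m0 + k. kernel_layer j z)"
        unfolding lessThan_atLeast0 by (rule sum.atLeastLessThan_concat[symmetric]) auto
      also have "(\<Sum>j=k..<m0 + k. kernel_layer j z) = (\<Sum>j<m0. kernel_layer (j + k) z)"
        using sum.shift_bounds_nat_ivl[of "\<lambda>j. kernel_layer j z" 0 k m0] by (simp add: lessThan_atLeast0)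
      finally show ?thesis by simp
    qed
    finally have "\<bar>E z\<bar> \<le> (\<Sum>j<m0. \<bar>kernel_layer (j + k) z\<bar>)" by (simp add: sum_abs)
    then have "ennreal \<bar>E z\<bar> \<le> (\<Sum>j<m0. ennreal \<bar>kernel_layer (j + k) z\<bar>)"
      by (simp add: sum_ennreal ennreal_leI)
    also have "\<dots> \<le> (\<Sum>j. ennreal \<bar>kernel_layer (j + k) z\<bar>)" by (rule sum_le_suminf) (auto intro: summableI)
    finally show ?thesis .
  qed
  have sm: "(\<lambda>j. (1 / 4 :: real) ^ (j + k) * I) sums (4 / 3 * (1 / 4) ^ k * I)"
    using sums_mult2[OF geometric_sums[of "1 / 4 :: real"], of "(1 / 4) ^ k * I"] by (simp add: power_add mult_ac)
  have "(\<integral>\<^sup>+z. ennreal \<bar>E z\<bar> \<partial>lborel) \<le> (\<integral>\<^sup>+z. (\<Sum>j. ennreal \<bar>kernel_layer (j + k) (z::'a)\<bar>) \<partial>lborel)"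
    by (rule nn_integral_mono_AE) (use AE_lborel_singleton[of "0::'a"] pw in \<open>auto elim!: eventually_mono\<close>)
  also have "\<dots> = (\<Sum>j. \<integral>\<^sup>+z. ennreal \<bar>kernel_layer (j + k) (z::'a)\<bar> \<partial>lborel)"
    by (rule nn_integral_suminf) measurable
  also have "\<dots> = (\<Sum>j. ennreal ((1 / 4) ^ (j + k) * I))"
  proof (rule suminf_cong)
    fix j
    have "integrable lborel (\<lambda>z::'a. \<bar>kernel_layer (j + k) z\<bar>)" using kernel_layer_integral(1)[OF n] by simp
    then show "(\<integral>\<^sup>+z. ennreal \<bar>kernel_layer (j + k) (z::'a)\<bar> \<partial>lborel) = ennreal ((1 / 4) ^ (j + k) * I)"
      by (subst nn_integral_eq_integral) (simp_all add: kernel_layer_integral(2)[OF n] I_def)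
  qed
  also have "\<dots> = ennreal (4 / 3 * (1 / 4) ^ k * I)"
    by (rule suminf_ennreal_eq[OF _ sm]) (simp add: I0)
  also have "\<dots> \<le> ennreal (2 * (1 / 4) ^ k * I)"
    using I0 by (intro ennreal_leI mult_right_mono) auto
  finally have nn: "(\<integral>\<^sup>+z. ennreal \<bar>E z\<bar> \<partial>lborel) \<le> ennreal (2 * (1 / 4) ^ k * I)" .
  show int: "integrable lborel E"
    by (rule integrableI_bounded) (use nn in \<open>auto intro: le_less_trans\<close>)
  show "(LBINT z. \<bar>E z\<bar>) \<le> 2 * (1 / 4) ^ k * (LBINT z. \<bar>kernel_step (z::'a)\<bar>)"
    using nn int I0 unfolding I_def[symmetric] by (subst (asm) nn_integral_eq_integral) (auto simp: ennreal_le_iff)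
qed

text \<open>The kernel is replaced by \<open>truncated_kernel k\<close>, whose Laplacian is an
  approximate identity of mass c; on the unit ball the replacement changes
  \<open>kernel_const\<close> times the potential by O(4^-k). The factor on the left is there
  because the truncated kernels approximate \<open>kernel_const\<close> times the Newtonian
  kernel.\<close>

lemma newtonian_potential_weak_laplacian:
  fixes F \<phi> :: "'a::euclidean_space \<Rightarrow> real"
  assumes n: "2 \<le> DIM('a)" and F[measurable]: "F \<in> borel_measurable borel" and M: "\<And>x. \<bar>F x\<bar> \<le> M"
    and F0: "\<And>x. 1 < norm x \<Longrightarrow> F x = 0"
    and \<phi>: "smooth \<phi>" "\<And>x. 1 < norm x \<Longrightarrow> \<phi> x = 0"
  defines "v \<equiv> \<lambda>x. LBINT y. F y * newtonian_kernel (x - y)"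
  shows "v \<in> borel_measurable borel" and "integrable lborel (\<lambda>x. v x * laplacian \<phi> x)"
    and "kernel_const DIM('a) * (LBINT x. v x * laplacian \<phi> x) =
      (LBINT z. kernel_density (z::'a)) * (LBINT x. F x * \<phi> x)"
proof -
  define \<kappa> where "\<kappa> = kernel_const DIM('a)"
  have \<kappa>: "0 < \<kappa>" unfolding \<kappa>_def by (rule kernel_const_pos) simp
  define c where "c = (LBINT z. kernel_density (z::'a))"
  define I where "I = (LBINT z. \<bar>kernel_step (z::'a)\<bar>)"
  have M0: "0 \<le> M" using M[of 0] by linarith
  show vm[measurable]: "v \<in> borel_measurable borel" unfolding v_def by measurable
  have \<phi>c: "continuous_on UNIV \<phi>" "continuous_on UNIV (laplacian \<phi>)"
    using \<phi>(1) by (auto intro: smooth_imp_continuous_on smooth_laplacian)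
  have [measurable]: "\<phi> \<in> borel_measurable borel" "laplacian \<phi> \<in> borel_measurable borel"
    using \<phi>c by (auto intro: borel_measurable_continuous_onI)
  have \<Delta>0: "laplacian \<phi> x = 0" if "1 < norm x" for x
    using iter_partial_zero_outside[of "cball 0 1" \<phi> x] \<phi>(2) that
        by (simp add: laplacian_eq del: iter_partial_simps)
  have i\<phi>: "integrable lborel \<phi>" and i\<Delta>: "integrable lborel (laplacian \<phi>)"
    using integrable_continuous_support[OF \<phi>c(1) \<phi>(2)] integrable_continuous_support[OF \<phi>c(2) \<Delta>0] by auto
  have iF: "integrable lborel F"
    by (rule integrable_bounded_support(1)[of F 0 1 M]) (use M F0 in auto)
  \<comment> \<open>The truncated kernel is cut off at radius 2. This changes nothing for the
    difference of two points of the unit ball, but makes the kernel bounded and integrable, as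
    Fubini and the pairing bounds require.\<close>
  define A where "A k z = indicator (cball 0 2) z * truncated_kernel k z" for k and z :: 'a
  have tm[measurable]: "truncated_kernel k \<in> borel_measurable (borel :: 'a measure)" for k
    by (intro smooth_borel_measurable smooth_truncated_kernel)
  have Am[measurable]: "A k \<in> borel_measurable borel" for k
    unfolding A_def[abs_def] by (intro borel_measurable_times borel_measurable_indicator tm) simp
  have "\<exists>B. \<forall>z. \<bar>A k z\<bar> \<le> B" for k
  proof -
    have "compact (truncated_kernel k ` cball (0::'a) 2)"
      by (intro compact_continuous_image smooth_imp_continuous_on smooth_truncated_kernel) auto
    then obtain B where B: "\<And>z::'a. z \<in> cball 0 2 \<Longrightarrow> \<bar>truncated_kernel k z\<bar> \<le> B"
      by (metis bounded_iff compact_imp_bounded image_eqI real_norm_def)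
    have "\<bar>A k z\<bar> \<le> \<bar>B\<bar>" for z
      using B[of z] by (cases "z \<in> cball 0 2") (auto simp: A_def simp del: mem_cball)
    then show ?thesis by blast
  qed
  then obtain B where B: "\<And>k z. \<bar>A k z\<bar> \<le> B k" by metis
  define w where "w k x = (LBINT y. F y * A k (y - x))" for k x
  have iA: "integrable lborel (A k)" for k
  proof (rule integrable_bounded_support(1)[of _ 0 2 "B k"])
    show "A k z = 0" if "z \<notin> cball 0 2" for z using that by (simp add: A_def)
  qed (use B Am in blast)+
  have wB: "\<bar>w k x\<bar> \<le> M * (LBINT z. \<bar>A k z\<bar>)" for k x
    unfolding w_def by (rule bounded_times_translate(2)[OF F M iA])
  have [measurable]: "w k \<in> borel_measurable borel" for k unfolding w_def[abs_def] by measurable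
  have close: "\<bar>\<kappa> * v x - w k x\<bar> \<le> M * (2 * (1 / 4) ^ k * I)" if x: "norm x \<le> 1" for k x
  proof -
    define E where "E z = \<kappa> * newtonian_kernel z - truncated_kernel k z" for z :: 'a
    have iE: "integrable lborel E" and EI: "(LBINT z. \<bar>E z\<bar>) \<le> 2 * (1 / 4) ^ k * I"
      using newtonian_kernel_approx[OF n, of k] unfolding E_def \<kappa>_def I_def by blast+
    have [measurable]: "E \<in> borel_measurable borel" using iE by auto
    have iE': "integrable lborel (\<lambda>y. E (x - y))" and EI': "(LBINT y. \<bar>E (x - y)\<bar>) = (LBINT z. \<bar>E z\<bar>)"
      using integral_reflect(2)[of E x] iE integral_reflect(1)[of "\<lambda>z. \<bar>E z\<bar>" x] by simp_all
    have eq: "\<kappa> * (F y * newtonian_kernel (x - y)) = F y * E (x - y) + F y * A k (y - x)" for y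
    proof (cases "norm y \<le> 1")
      case True
      then have "norm (y - x) \<le> 2" using x norm_triangle_ineq4[of y x] by linarith
      then have "A k (y - x) = truncated_kernel k (x - y)"
        using truncated_kernel_minus[OF n, of k "y - x"] by (simp add: A_def)
      then show ?thesis by (simp add: E_def algebra_simps)
    qed (simp add: F0)
    have "\<kappa> * v x = (LBINT y. \<kappa> * (F y * newtonian_kernel (x - y)))" by (simp add: v_def)
    also have "\<dots> = (LBINT y. F y * E (x - y)) + w k x"
      unfolding eq w_def using bounded_times_integrable(1)[OF F M iE'] bounded_times_translate(1)[OF F M iA]
      by (intro Bochner_Integration.integral_add) auto
    finally have "\<kappa> * v x - w k x = (LBINT y. F y * E (x - y))" by simp
    also have "\<bar>\<dots>\<bar> \<le> M * (LBINT y. \<bar>E (x - y)\<bar>)" by (rule bounded_times_integrable(2)[OF F M iE'])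
    also have "\<dots> \<le> M * (2 * (1 / 4) ^ k * I)" unfolding EI' using EI M0 by (intro mult_left_mono) auto
    finally show ?thesis .
  qed
  have iw: "integrable lborel (\<lambda>x. w k x * laplacian \<phi> x)" for k
    by (rule bounded_times_integrable(1)[OF _ wB i\<Delta>]) measurable
  have diff: "\<bar>\<kappa> * v x * laplacian \<phi> x - w k x * laplacian \<phi> x\<bar>
      \<le> M * (2 * (1 / 4) ^ k * I) * \<bar>laplacian \<phi> x\<bar>" for k x
  proof (cases "norm x \<le> 1")
    case True
    have "\<bar>\<kappa> * v x * laplacian \<phi> x - w k x * laplacian \<phi> x\<bar> = \<bar>\<kappa> * v x - w k x\<bar> * \<bar>laplacian \<phi> x\<bar>"
      by (simp add: abs_mult[symmetric] algebra_simps)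
    then show ?thesis using mult_right_mono[OF close[OF True]] by simp
  qed (simp add: \<Delta>0)
  have id: "integrable lborel (\<lambda>x. \<kappa> * v x * laplacian \<phi> x - w k x * laplacian \<phi> x)" for k
  proof (rule Bochner_Integration.integrable_bound)
    show "integrable lborel (\<lambda>x. M * (2 * (1 / 4) ^ k * I) * \<bar>laplacian \<phi> x\<bar>)" using i\<Delta> by simp
  qed (use diff[of _ k] in \<open>auto intro!: AE_I2 order_trans[OF diff[of _ k]]\<close>)
  have iv: "integrable lborel (\<lambda>x. \<kappa> * v x * laplacian \<phi> x)"
    using Bochner_Integration.integrable_add[OF id[of 0] iw[of 0]] by simp
  then show "integrable lborel (\<lambda>x. v x * laplacian \<phi> x)" using \<kappa> by (simp add: mult.assoc)
  have lim1: "(\<lambda>k. LBINT x. w k x * laplacian \<phi> x) \<longlonglongrightarrow> (LBINT x. \<kappa> * v x * laplacian \<phi> x)"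
  proof (rule LIM_zero_cancel, rule Lim_null_comparison)
    show "(\<lambda>k. M * (2 * (1 / 4) ^ k * I) * (LBINT x. \<bar>laplacian \<phi> x\<bar>)) \<longlonglongrightarrow> 0"
      by (auto intro!: tendsto_mult_left_zero tendsto_mult_right_zero LIMSEQ_realpow_zero)
    show "\<forall>\<^sub>F k in sequentially. norm ((LBINT x. w k x * laplacian \<phi> x) - (LBINT x. \<kappa> * v x * laplacian \<phi> x))
        \<le> M * (2 * (1 / 4) ^ k * I) * (LBINT x. \<bar>laplacian \<phi> x\<bar>)"
    proof (intro always_eventually allI)
      fix k
      have "norm (LBINT x. \<kappa> * v x * laplacian \<phi> x - w k x * laplacian \<phi> x) \<le>
         (LBINT x. M * (2 * (1 / 4) ^ k * I) * \<bar>laplacian \<phi> x\<bar>)"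
        by (rule Bochner_Integration.integral_norm_bound_integral[OF id]) (use i\<Delta> diff in auto)
      then show "norm ((LBINT x. w k x * laplacian \<phi> x) - (LBINT x. \<kappa> * v x * laplacian \<phi> x))
        \<le> M * (2 * (1 / 4) ^ k * I) * (LBINT x. \<bar>laplacian \<phi> x\<bar>)"
        using iv iw by (simp add: norm_minus_commute)
    qed
  qed
  obtain B\<phi> where B\<phi>: "\<And>x. \<bar>\<phi> x\<bar> \<le> B\<phi>" using continuous_support_bounded[OF \<phi>c(1) \<phi>(2)] by blast
  have conv: "(LBINT x. w k x * laplacian \<phi> x)
      = (LBINT y. F y * (LBINT x. dilate k kernel_density (y - x) * \<phi> x))" for k
  proof -
    have "F y * (LBINT x. A k (y - x) * laplacian \<phi> x)
        = F y * (LBINT x. dilate k kernel_density (y - x) * \<phi> x)" for y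
    proof (cases "norm y \<le> 1")
      case True
      have "(LBINT x. A k (y - x) * laplacian \<phi> x) = (LBINT x. truncated_kernel k (x - y) * laplacian \<phi> x)"
      proof (rule Bochner_Integration.integral_cong[OF refl])
        fix x
        show "A k (y - x) * laplacian \<phi> x = truncated_kernel k (x - y) * laplacian \<phi> x"
        proof (cases "norm x \<le> 1")
          case x: True
          then have "norm (y - x) \<le> 2" using True norm_triangle_ineq4[of y x] by linarith
          then show ?thesis using truncated_kernel_minus[OF n, of k "y - x"] by (simp add: A_def)
        qed (simp add: \<Delta>0)
      qed
      also have "\<dots> = (LBINT x. laplacian (truncated_kernel k) (x - y) * \<phi> x)"
        by (rule convolution_by_parts_laplacian[OF smooth_truncated_kernel \<phi>, symmetric])
      also have "\<dots> = (LBINT x. dilate k kernel_density (y - x) * \<phi> x)"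
      proof -
        have "dilate k kernel_density (x - y) = dilate k kernel_density (y - x)" for x :: 'a
          using kernel_density_minus[of "2 ^ k *\<^sub>R (y - x)"] by (simp add: dilate_def flip: scaleR_minus_right)
        then show ?thesis by (simp add: laplacian_truncated_kernel[OF n])
      qed
      finally show ?thesis by simp
    qed (simp add: F0)
    then show ?thesis
      unfolding w_def convolution_fubini[OF iF i\<Delta> Am B] by (simp only:)
  qed
  have bd: "bump (kernel_density :: 'a \<Rightarrow> real)" by (rule bump_kernel_density)
  have [measurable]: "dilate k (kernel_density :: 'a \<Rightarrow> real) \<in> borel_measurable borel" for k
    by (rule dilate_measurable[OF bump_measurable[OF bd]])
  have lim2: "(\<lambda>k. LBINT y. F y * (LBINT x. dilate k kernel_density (y - x) * \<phi> x)) \<longlonglongrightarrow> (LBINT y. F y * (c * \<phi> y))"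
  proof (rule integral_dominated_convergence[where w = "\<lambda>y. B\<phi> * (LBINT z. \<bar>kernel_density (z::'a)\<bar>) * \<bar>F y\<bar>"])
    show "AE y in lborel. (\<lambda>k. F y * (LBINT x. dilate k kernel_density (y - x) * \<phi> x)) \<longlonglongrightarrow> F y * (c * \<phi> y)"
      unfolding c_def by (intro AE_I2 tendsto_mult tendsto_const dilate_approximate_identity(1)[OF bd \<phi>c(1) B\<phi>])
    show "AE y in lborel. norm (F y * (LBINT x. dilate k kernel_density (y - x) * \<phi> x))
        \<le> B\<phi> * (LBINT z. \<bar>kernel_density (z::'a)\<bar>) * \<bar>F y\<bar>" for k
      using mult_left_mono[OF dilate_approximate_identity(2)[OF bd \<phi>c(1) B\<phi>] abs_ge_zero]
      by (intro AE_I2) (simp add: abs_mult mult.commute)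
  qed (use iF in \<open>auto intro!: integrable_mult_right\<close>)
  have "(LBINT x. \<kappa> * v x * laplacian \<phi> x) = (LBINT y. F y * (c * \<phi> y))"
    using lim1 lim2 unfolding conv by (rule LIMSEQ_unique)
  also have "(LBINT y. F y * (c * \<phi> y)) = c * (LBINT y. F y * \<phi> y)"
    by (simp add: mult.left_commute[of _ c])
  finally show "kernel_const DIM('a) * (LBINT x. v x * laplacian \<phi> x) =
      (LBINT z. kernel_density (z::'a)) * (LBINT x. F x * \<phi> x)"
    by (simp add: \<kappa>_def c_def mult.assoc)
qed

section \<open>Bounds for the mollified solution\<close>

lemma iter_partial_dilate_integrable:
  assumes \<kappa>: "bump \<kappa>" and ds: "ds \<in> lists Basis"
  shows "integrable lborel (iter_partial ds (dilate k \<kappa>))"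
    and "(LBINT z. \<bar>iter_partial ds (dilate k \<kappa>) z\<bar>) = (2 ^ k) ^ length ds * (LBINT z. \<bar>iter_partial ds \<kappa> z\<bar>)"
proof -
  have b: "bump (iter_partial ds \<kappa>)" by (rule bump_iter_partial[OF \<kappa> ds])
  have s: "smooth \<kappa>" using \<kappa> by (simp add: bump_def)
  show "integrable lborel (iter_partial ds (dilate k \<kappa>))"
    unfolding iter_partial_dilate[OF s ds]
    using integral_dilate(2)[OF bump_measurable[OF b] bump_integrable[OF b]] by simp
  show "(LBINT z. \<bar>iter_partial ds (dilate k \<kappa>) z\<bar>) = (2 ^ k) ^ length ds * (LBINT z. \<bar>iter_partial ds \<kappa> z\<bar>)"
    unfolding iter_partial_dilate[OF s ds]
    using integral_abs_dilate[OF bump_measurable[OF b], of k] by (simp add: abs_mult power_abs)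
qed

lemma iter_partial_kernel_layer:
  assumes "ds \<in> lists Basis"
  shows "iter_partial ds (kernel_layer j) = (\<lambda>z. (1 / 4) ^ j * iter_partial ds (dilate j kernel_step) z)"
  using iter_partial_scale[OF smooth_dilate[OF smooth_kernel_step] assms, of "(1 / 4) ^ j" j 1]
  by (simp add: kernel_layer_def[abs_def])

text \<open>The factor in front of the integral decides what can be summed: it is 4^-j without
  derivatives, 2^-j with one derivative and 1 with two.\<close>

lemma iter_partial_kernel_layer_integral:
  fixes ds :: "'a::euclidean_space list"
  assumes "2 \<le> DIM('a)" "ds \<in> lists Basis"
  shows "integrable lborel (iter_partial ds (kernel_layer j))"
    and "(LBINT z. \<bar>iter_partial ds (kernel_layer j) z\<bar>) =
      (1 / 4) ^ j * (2 ^ j) ^ length ds * (LBINT z. \<bar>iter_partial ds kernel_step z\<bar>)"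
  unfolding iter_partial_kernel_layer[OF assms(2)]
  using iter_partial_dilate_integrable[OF bump_kernel_step[OF assms(1)] assms(2), of j]
  by (simp_all add: abs_mult)

lemma iter_partial_kernel_layer_outside:
  fixes z :: "'a::euclidean_space"
  assumes "2 \<le> DIM('a)" "(1 / 2) ^ j < norm z"
  shows "iter_partial ds (kernel_layer j) z = 0"
  by (rule iter_partial_zero_outside[of "cball 0 ((1 / 2) ^ j)"])
    (use assms kernel_layer_outside[OF assms(1), of j] in auto)

text \<open>A linear equation: in the application \<open>g\<close> stands for f(x, u x), and the
  nonlinearity returns only in the Hessian bound. Both functions are everywhere bounded Borel
  representatives, and test functions stop at radius 7/8 because \<open>g\<close> represents the
  right-hand side only there.\<close>

locale poisson_solution =
  fixes u g :: "'a::euclidean_space \<Rightarrow> real" and M :: real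
  assumes dim: "2 \<le> DIM('a)"
    and um [measurable]: "u \<in> borel_measurable borel" and gm [measurable]: "g \<in> borel_measurable borel"
    and uM: "\<And>x. \<bar>u x\<bar> \<le> M" and gM: "\<And>x. \<bar>g x\<bar> \<le> M"
    and u0: "\<And>x. 1 < norm x \<Longrightarrow> u x = 0"
    and weak: "\<And>\<phi>. smooth \<phi> \<Longrightarrow> (\<And>z. 7 / 8 < norm z \<Longrightarrow> \<phi> z = 0) \<Longrightarrow>
      (LBINT x. u x * laplacian \<phi> x) = (LBINT x. g x * \<phi> x)"
begin

text \<open>Up to the factor \<open>(-1)\<^bsup>|ds|\<^esup> c\<close>, where \<open>c\<close> is the integral of \<open>kernel_density\<close>, this is the
  derivative \<open>ds\<close> of a mollification of \<open>u\<close> at scale \<open>2\<^sup>-\<^sup>k\<close>.\<close>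

definition mollified :: "'a list \<Rightarrow> nat \<Rightarrow> 'a \<Rightarrow> real" where
  "mollified ds k x = (LBINT y. u y * iter_partial ds (dilate k kernel_density) (y - x))"

lemma M_nonneg: "0 \<le> M"
  using uM[of 0] by linarith

lemma integrable_u: "integrable lborel u"
  by (rule integrable_bounded_support(1)[of u 0 1 M]) (use uM u0 in auto)

lemma mollified_bound:
  assumes "ds \<in> lists Basis"
  shows "\<bar>mollified ds k x\<bar> \<le> M * ((2 ^ k) ^ length ds * (LBINT z. \<bar>iter_partial ds kernel_density (z::'a)\<bar>))"
  unfolding mollified_def
  using bounded_times_translate(2)[OF um uM iter_partial_dilate_integrable(1)[OF bump_kernel_density assms],
      of k x]
  by (simp only: iter_partial_dilate_integrable(2)[OF bump_kernel_density assms])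

lemma mollified_measurable [measurable]:
  assumes "ds \<in> lists Basis"
  shows "mollified ds k \<in> borel_measurable borel"
proof -
  have [measurable]: "iter_partial ds (dilate k kernel_density) \<in> borel_measurable (borel :: 'a measure)"
    using iter_partial_dilate_integrable(1)[OF bump_kernel_density assms] by auto
  show ?thesis unfolding mollified_def[abs_def] by measurable
qed

text \<open>The weak equation is tested with a derivative of the layer centred at \<open>x\<close>.
  The conditions \<open>3 \<le> j\<close> and \<open>norm x \<le> 3 / 4\<close> put its support into
  the admissible ball, as 3/4 + 1/8 = 7/8.\<close>

lemma mollified_step:
  assumes ds: "ds \<in> lists Basis" and j: "3 \<le> j" and x: "norm x \<le> 3 / 4"
  shows "mollified ds (Suc j) x - mollified ds j x = (LBINT y. g y * iter_partial ds (kernel_layer j) (y - x))"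
proof -
  let ?\<rho> = "kernel_density :: 'a \<Rightarrow> real" and ?\<beta> = "kernel_layer j :: 'a \<Rightarrow> real"
  define \<phi> where "\<phi> y = iter_partial ds ?\<beta> (y - x)" for y
  have s\<beta>: "smooth (iter_partial ds ?\<beta>)" by (rule smooth_iter_partial[OF smooth_kernel_layer ds])
  have s\<phi>: "smooth \<phi>" using smooth_affine[OF s\<beta>, of 1 1 "- x"] by (simp add: \<phi>_def[abs_def])
  have \<phi>0: "\<phi> y = 0" if "7 / 8 < norm y" for y
  proof -
    have "(1 / 2 :: real) ^ j \<le> (1 / 2) ^ 3" using j by (intro power_decreasing) auto
    then have "(1 / 2) ^ j < norm (y - x)" using norm_triangle_ineq2[of y x] x that by (simp add: power3_eq_cube)
    then show ?thesis unfolding \<phi>_def by (rule iter_partial_kernel_layer_outside[OF dim])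
  qed
  have lap: "laplacian ?\<beta> = (\<lambda>z. dilate (Suc j) ?\<rho> z + (- 1) * dilate j ?\<rho> z)"
    by (rule ext) (simp add: laplacian_kernel_layer[OF dim])
  have s\<rho>: "smooth (dilate (Suc j) ?\<rho>)" "smooth (dilate j ?\<rho>)"
    by (intro smooth_dilate smooth_kernel_density)+
  have s\<rho>': "smooth (\<lambda>z. (- 1) * dilate j ?\<rho> z)" using smooth_scale[OF s\<rho>(2), of "- 1" 1] by simp
  have "iter_partial ds (\<lambda>z. (- 1) * dilate j ?\<rho> z) = (\<lambda>z. (- 1) * iter_partial ds (dilate j ?\<rho>) z)"
    using iter_partial_scale[OF s\<rho>(2) ds, of "- 1" 1] by simp
  then have "laplacian (iter_partial ds ?\<beta>)
      = (\<lambda>z. iter_partial ds (dilate (Suc j) ?\<rho>) z + (- 1) * iter_partial ds (dilate j ?\<rho>) z)"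
    unfolding laplacian_iter_partial[OF smooth_kernel_layer ds] lap iter_partial_add[OF s\<rho>(1) s\<rho>' ds] by simp
  moreover have "laplacian \<phi> = (\<lambda>y. laplacian (iter_partial ds ?\<beta>) (y - x))"
    using laplacian_affine[OF s\<beta>, of 1 1 "- x"] by (simp add: \<phi>_def[abs_def])
  ultimately have "laplacian \<phi> = (\<lambda>y. iter_partial ds (dilate (Suc j) ?\<rho>) (y - x) - iter_partial ds (dilate
      j ?\<rho>) (y - x))"
    by simp
  moreover have "integrable lborel (\<lambda>y. u y * iter_partial ds (dilate i ?\<rho>) (y - x))" for i
    by (rule bounded_times_translate(1)[OF um uM iter_partial_dilate_integrable(1)[OF bump_kernel_density ds]])
  ultimately have "(LBINT y. u y * laplacian \<phi> y) = mollified ds (Suc j) x - mollified ds j x"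
    unfolding mollified_def by (simp add: right_diff_distrib)
  then show ?thesis using weak[OF s\<phi> \<phi>0] by (simp add: \<phi>_def)
qed

lemma mollified_telescope:
  assumes ds: "ds \<in> lists Basis" and k: "3 \<le> k" and x: "norm x \<le> 3 / 4"
  shows "mollified ds k x = mollified ds 3 x + (\<Sum>j=3..<k. LBINT y. g y * iter_partial ds (kernel_layer j) (y - x))"
proof -
  have "(\<Sum>j=3..<k. LBINT y. g y * iter_partial ds (kernel_layer j) (y - x))
      = (\<Sum>j=3..<k. mollified ds (Suc j) x - mollified ds j x)"
    using mollified_step[OF ds _ x] by (intro sum.cong) auto
  also have "\<dots> = mollified ds k x - mollified ds 3 x" by (rule sum_Suc_diff'[OF k])
  finally show ?thesis by simp
qed

lemma sum_half_power: "(\<Sum>j=m..<k. (1 / 2 :: real) ^ j) \<le> 2"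
proof -
  have "(\<Sum>j=m..<k. (1 / 2 :: real) ^ j) \<le> (\<Sum>j<k. (1 / 2) ^ j)" by (rule sum_mono2) auto
  also have "\<dots> = 2 * (1 - (1 / 2) ^ k)" by (simp add: sum_gp_strict)
  also have "\<dots> \<le> 2" by simp
  finally show ?thesis .
qed

text \<open>One derivative costs 2^j against the weight 4^-j of the layer, so the layers sum
  geometrically and the bound on \<open>g\<close> is enough.\<close>

lemma mollified_gradient_bound:
  assumes ds: "ds \<in> lists Basis" "length ds = 1"
  shows "\<exists>B. \<forall>k\<ge>3. \<forall>x. norm x \<le> 3 / 4 \<longrightarrow> \<bar>mollified ds k x\<bar> \<le> B"
proof -
  define I where "I = (LBINT z. \<bar>iter_partial ds kernel_step (z::'a)\<bar>)"
  define B0 where "B0 = M * ((2 ^ 3) ^ length ds * (LBINT z. \<bar>iter_partial ds kernel_density (z::'a)\<bar>))"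
  have I: "0 \<le> I" by (simp add: I_def)
  have "\<bar>mollified ds k x\<bar> \<le> B0 + M * I * 2" if k: "3 \<le> k" and x: "norm x \<le> 3 / 4" for k x
  proof -
    have bd: "\<bar>LBINT y. g y * iter_partial ds (kernel_layer j) (y - x)\<bar> \<le> M * I * (1 / 2) ^ j" for j
    proof -
      have "(1 / 4 :: real) ^ j * 2 ^ j = (1 / 2) ^ j" by (simp add: power_mult_distrib[symmetric])
      then show ?thesis
        using bounded_times_translate(2)[OF gm gM iter_partial_kernel_layer_integral(1)[OF dim ds(1)], of j x]
        unfolding iter_partial_kernel_layer_integral(2)[OF dim ds(1)] by (simp add: ds(2) I_def mult_ac)
    qed
    have "\<bar>\<Sum>j=3..<k. LBINT y. g y * iter_partial ds (kernel_layer j) (y - x)\<bar> \<le> (\<Sum>j=3..<k. M * I * (1 / 2) ^ j)"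
      by (rule order_trans[OF sum_abs sum_mono[OF bd]])
    also have "\<dots> = M * I * (\<Sum>j=3..<k. (1 / 2) ^ j)" by (simp add: sum_distrib_left)
    also have "\<dots> \<le> M * I * 2" using sum_half_power M_nonneg I by (intro mult_left_mono) auto
    finally show ?thesis
      using mollified_telescope[OF ds(1) k x] mollified_bound[OF ds(1), of 3 x] unfolding B0_def[symmetric]
          by linarith
  qed
  then show ?thesis by blast
qed

lemma mollified_fubini:
  assumes ds: "ds \<in> lists Basis" and \<psi>: "integrable lborel \<psi>"
  shows "(LBINT x. mollified ds k x * \<psi> x) =
    (LBINT y. u y * (LBINT x. iter_partial ds (dilate k kernel_density) (y - x) * \<psi> x))"
proof -
  let ?\<rho> = "kernel_density :: 'a \<Rightarrow> real"
  have bd: "bump (iter_partial ds ?\<rho>)" by (rule bump_iter_partial[OF bump_kernel_density ds])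
  obtain C where C: "\<And>z. \<bar>iter_partial ds ?\<rho> z\<bar> \<le> C" using bump_bounded[OF bd] by blast
  have "\<bar>iter_partial ds (dilate k ?\<rho>) z\<bar> \<le> (2 ^ k) ^ length ds * (2 ^ (k * DIM('a)) * C)" for z
    unfolding iter_partial_dilate[OF smooth_kernel_density ds] using C[of "2 ^ k *\<^sub>R z"]
    by (simp add: dilate_def abs_mult power_abs)
  moreover have "iter_partial ds (dilate k ?\<rho>) \<in> borel_measurable borel"
    by (rule smooth_borel_measurable[OF smooth_iter_partial[OF smooth_dilate[OF smooth_kernel_density] ds]])
  ultimately show ?thesis
    unfolding mollified_def by (intro convolution_fubini[OF integrable_u \<psi>])
qed

lemma mollification_limit:
  assumes c: "continuous_on UNIV \<psi>" and z: "\<And>x. r < norm x \<Longrightarrow> \<psi> x = 0"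
  shows "(\<lambda>k. LBINT y. u y * (LBINT x. dilate k kernel_density (y - x) * \<psi> x)) \<longlonglongrightarrow>
     (LBINT z. kernel_density (z::'a)) * (LBINT y. u y * \<psi> y)"
proof -
  let ?\<rho> = "kernel_density :: 'a \<Rightarrow> real"
  have b: "bump ?\<rho>" by (rule bump_kernel_density)
  obtain B where B: "\<And>x. \<bar>\<psi> x\<bar> \<le> B" using continuous_support_bounded[OF c z] by blast
  have [measurable]: "dilate k ?\<rho> \<in> borel_measurable borel" "\<psi> \<in> borel_measurable borel" for k
    using c by (auto intro: smooth_borel_measurable borel_measurable_continuous_onI smooth_dilate
        smooth_kernel_density)
  have "(\<lambda>k. LBINT y. u y * (LBINT x. dilate k ?\<rho> (y - x) * \<psi> x)) \<longlonglongrightarrow>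
      (LBINT y. u y * ((LBINT z. ?\<rho> z) * \<psi> y))"
  proof (rule integral_dominated_convergence[where w = "\<lambda>y. B * (LBINT z. \<bar>?\<rho> z\<bar>) * \<bar>u y\<bar>"])
    show "AE y in lborel. (\<lambda>k. u y * (LBINT x. dilate k ?\<rho> (y - x) * \<psi> x)) \<longlonglongrightarrow> u y * ((LBINT z. ?\<rho> z) * \<psi> y)"
      by (intro AE_I2 tendsto_mult tendsto_const dilate_approximate_identity(1)[OF b c B])
    show "AE y in lborel. norm (u y * (LBINT x. dilate k ?\<rho> (y - x) * \<psi> x)) \<le> B * (LBINT z. \<bar>?\<rho> z\<bar>) * \<bar>u y\<bar>" for k
      using mult_left_mono[OF dilate_approximate_identity(2)[OF b c B] abs_ge_zero]
      by (intro AE_I2) (simp add: abs_mult mult.commute)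
  qed (use integrable_u in auto)
  moreover have "(LBINT y. u y * (c * \<psi> y)) = c * (LBINT y. u y * \<psi> y)" for c
    by (simp add: mult.left_commute[of _ c])
  ultimately show ?thesis by simp
qed

text \<open>The derivatives move from the mollifier to \<psi>, so the limit is c times the pairing
  that defines the weak derivative of \<open>u\<close>. The sign and the division by c are supplied
  in \<open>bounded_weak_derivative\<close>.\<close>

lemma mollified_weak_limit:
  assumes ds: "ds \<in> lists Basis" and \<psi>: "smooth \<psi>" "\<And>z. r < norm z \<Longrightarrow> \<psi> z = 0"
  shows "(\<lambda>k. LBINT x. mollified ds k x * \<psi> x) \<longlonglongrightarrow>
     (LBINT z. kernel_density (z::'a)) * (LBINT y. u y * iter_partial ds \<psi> y)"
proof -
  have i\<psi>: "integrable lborel \<psi>" by (rule integrable_continuous_support[OF smooth_imp_continuous_on[OF \<psi>(1)] \<psi>(2)])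
  have z: "iter_partial ds \<psi> x = 0" if "r < norm x" for x
    by (rule iter_partial_zero_outside[of "cball 0 r"]) (use \<psi>(2) that in auto)
  have "(LBINT x. iter_partial ds (dilate k kernel_density) (y - x) * \<psi> x)
      = (LBINT x. dilate k kernel_density (y - x) * iter_partial ds \<psi> x)" for k y
    by (rule convolution_by_parts[OF smooth_dilate[OF smooth_kernel_density] \<psi>(1) ds \<psi>(2)])
  then show ?thesis
    unfolding mollified_fubini[OF ds i\<psi>]
    using mollification_limit[OF smooth_imp_continuous_on[OF smooth_iter_partial[OF \<psi>(1) ds]] z] by (simp only:)
qed

text \<open>Translating a layer by x - x' changes it in L^1 by O(4^-j 2^j |x - x'|), which sums over
  j uniformly in \<open>k\<close>. Working with differences of kernels avoids differentiating
  \<open>mollified\<close> under the integral sign.\<close>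

lemma mollified_lipschitz:
  "\<exists>L\<ge>0. \<forall>k\<ge>3. \<forall>x x'. norm x \<le> 3 / 4 \<longrightarrow> norm x' \<le> 3 / 4 \<longrightarrow> \<bar>mollified [] k x - mollified [] k x'\<bar>
      \<le> L * norm (x - x')"
proof -
  obtain C\<rho> where C\<rho>: "0 \<le> C\<rho>"
    "\<And>j x x'::'a. (LBINT y. \<bar>dilate j kernel_density (y - x) - dilate j kernel_density (y - x')\<bar>)
        \<le> C\<rho> * 2 ^ j * norm (x - x')"
    using bump_translation_L1[OF bump_kernel_density[where 'a = 'a]] by blast
  obtain C\<beta> where C\<beta>: "0 \<le> C\<beta>"
    "\<And>j x x'::'a. (LBINT y. \<bar>dilate j kernel_step (y - x) - dilate j kernel_step (y - x')\<bar>)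
        \<le> C\<beta> * 2 ^ j * norm (x - x')"
    using bump_translation_L1[OF bump_kernel_step[OF dim]] by blast
  have bound: "\<bar>(LBINT y. w y * \<kappa> (y - x)) - (LBINT y. w y * \<kappa> (y - x'))\<bar>
      \<le> M * (LBINT y. \<bar>\<kappa> (y - x) - \<kappa> (y - x')\<bar>)"
    if w: "w \<in> borel_measurable borel" "\<And>y. \<bar>w y\<bar> \<le> M" and \<kappa>: "integrable lborel \<kappa>" for w \<kappa> :: "'a \<Rightarrow> real" and x x'
  proof -
    have i: "integrable lborel (\<lambda>y. \<kappa> (y - x))" for x using \<kappa> integral_translate(2)[of \<kappa> x] by auto
    have "(LBINT y. w y * \<kappa> (y - x)) - (LBINT y. w y * \<kappa> (y - x')) = (LBINT y. w y * (\<kappa> (y - x) - \<kappa> (y - x')))"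
      using bounded_times_integrable(1)[OF w i] by (simp add: right_diff_distrib)
    then show ?thesis
      using bounded_times_integrable(2)[OF w, of "\<lambda>y. \<kappa> (y - x) - \<kappa> (y - x')"] i by simp
  qed
  \<comment> \<open>The factor 8 is the 2^3 of the coarsest mollifier, and 2 bounds the geometric
    sum of the layers.\<close>
  define L where "L = M * (C\<rho> * 8) + M * C\<beta> * 2"
  have "\<bar>mollified [] k x - mollified [] k x'\<bar> \<le> L * norm (x - x')"
    if k: "3 \<le> k" and x: "norm x \<le> 3 / 4" "norm x' \<le> 3 / 4" for k x x'
  proof -
    define G where "G j x = (LBINT y. g y * kernel_layer j (y - x))" for j x
    have "\<bar>mollified [] 3 x - mollified [] 3 x'\<bar>
        \<le> M * (LBINT y. \<bar>dilate 3 kernel_density (y - x) - dilate 3 kernel_density (y - x')\<bar>)"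
      unfolding mollified_def iter_partial_simps
      by (rule bound[OF um uM iter_partial_dilate_integrable(1)[OF bump_kernel_density, of "[]", unfolded
          iter_partial_simps]]) simp
    also have "\<dots> \<le> M * (C\<rho> * 2 ^ 3 * norm (x - x'))" by (intro mult_left_mono C\<rho> M_nonneg)
    finally have 1: "\<bar>mollified [] 3 x - mollified [] 3 x'\<bar> \<le> M * (C\<rho> * 8) * norm (x - x')" by simp
    have 2: "\<bar>G j x - G j x'\<bar> \<le> M * C\<beta> * norm (x - x') * (1 / 2) ^ j" for j
    proof -
      have "\<bar>G j x - G j x'\<bar> \<le> M * (LBINT y. \<bar>kernel_layer j (y - x) - kernel_layer j (y - x')\<bar>)"
        unfolding G_def by (rule bound[OF gm gM kernel_layer_integral(1)[OF dim]])
      also have "(LBINT y. \<bar>kernel_layer j (y - x) - kernel_layer j (y - x')\<bar>) =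
        (1 / 4) ^ j * (LBINT y. \<bar>dilate j kernel_step (y - x) - dilate j kernel_step (y - x')\<bar>)"
        by (simp add: kernel_layer_def abs_mult flip: right_diff_distrib)
      also have "M * \<dots> \<le> M * ((1 / 4) ^ j * (C\<beta> * 2 ^ j * norm (x - x')))"
        by (intro mult_left_mono C\<beta> M_nonneg) simp
      also have "\<dots> = M * C\<beta> * norm (x - x') * ((1 / 4) ^ j * 2 ^ j)" by simp
      also have "(1 / 4 :: real) ^ j * 2 ^ j = (1 / 2) ^ j" by (simp add: power_mult_distrib[symmetric])
      finally show ?thesis .
    qed
    have "\<bar>(\<Sum>j=3..<k. G j x) - (\<Sum>j=3..<k. G j x')\<bar> \<le> (\<Sum>j=3..<k. M * C\<beta> * norm (x - x') * (1 / 2) ^ j)"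
      unfolding sum_subtractf[symmetric] by (rule order_trans[OF sum_abs sum_mono[OF 2]])
    also have "\<dots> = M * C\<beta> * norm (x - x') * (\<Sum>j=3..<k. (1 / 2) ^ j)" by (simp add: sum_distrib_left)
    also have "\<dots> \<le> M * C\<beta> * norm (x - x') * 2"
      using sum_half_power M_nonneg C\<beta>(1) by (intro mult_left_mono) auto
    finally have 3: "\<bar>(\<Sum>j=3..<k. G j x) - (\<Sum>j=3..<k. G j x')\<bar> \<le> M * C\<beta> * 2 * norm (x - x')" by simp
    have "mollified [] k x = mollified [] 3 x + (\<Sum>j=3..<k. G j x)" "mollified [] k x'
        = mollified [] 3 x' + (\<Sum>j=3..<k. G j x')"
      using mollified_telescope[of "[]", OF _ k] x by (simp_all add: G_def)
    then show ?thesis using 1 3 unfolding L_def distrib_right by linarith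
  qed
  moreover have "0 \<le> L" using M_nonneg C\<rho>(1) C\<beta>(1) by (simp add: L_def)
  ultimately show ?thesis by blast
qed

text \<open>The functions \<open>mollified [] k\<close> converge pointwise, since the contributions
  of the layers are summable, and weakly to c u. Hence their limit divided by c is a version of
  \<open>u\<close>, and it inherits the Lipschitz bound that is uniform in \<open>k\<close>.\<close>

lemma lipschitz_representative:
  "\<exists>t L T. 0 \<le> L \<and> (AE x in lborel. norm x < 3 / 4 \<longrightarrow> u x = t x) \<and>
    (\<forall>x x'. norm x \<le> 3 / 4 \<longrightarrow> norm x' \<le> 3 / 4 \<longrightarrow> \<bar>t x - t x'\<bar> \<le> L * norm (x - x')) \<and>
    (\<forall>x. norm x \<le> 3 / 4 \<longrightarrow> \<bar>t x\<bar> \<le> T)"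
proof -
  define c where "c = (LBINT z. kernel_density (z::'a))"
  have c: "0 < c" unfolding c_def by (rule kernel_density_integral_pos)
  define I where "I = (LBINT z. \<bar>kernel_density (z::'a)\<bar>)"
  define V where "V = mollified []"
  have VM: "\<bar>V k x\<bar> \<le> M * I" for k x
    using mollified_bound[of "[]" k x] by (simp add: V_def I_def)
  have I0: "0 \<le> I" by (simp add: I_def)
  obtain L where L0: "0 \<le> L" and L: "\<And>k x x'. 3 \<le> k \<Longrightarrow> norm x \<le> 3 / 4 \<Longrightarrow> norm x' \<le> 3 / 4 \<Longrightarrow> \<bar>V k x - V k x'\<bar>
      \<le> L * norm (x - x')"
    using mollified_lipschitz unfolding V_def by blast
  have [measurable]: "V k \<in> borel_measurable borel" for k unfolding V_def by (rule mollified_measurable) simp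
  have conv: "convergent (\<lambda>k. V k x)" if x: "norm x \<le> 3 / 4" for x
  proof -
    define a where "a j = (LBINT y. g y * kernel_layer j (y - x))" for j
    have "summable (\<lambda>j. M * ((1 / 4) ^ j * (LBINT z. \<bar>kernel_step (z::'a)\<bar>)))"
      by (intro summable_mult summable_mult2 summable_geometric) simp
    moreover have "norm (a j) \<le> M * ((1 / 4) ^ j * (LBINT z. \<bar>kernel_step (z::'a)\<bar>))" for j
      using bounded_times_translate(2)[OF gm gM kernel_layer_integral(1)[OF dim], of j x] unfolding
          kernel_layer_integral(2)[OF dim] a_def by simp
    ultimately have "summable a" by (rule summable_comparison_test'[where N = 0])
    then have "summable (\<lambda>j. a (j + 3))" by (rule summable_ignore_initial_segment)
    then have "convergent (\<lambda>n. \<Sum>j<n. a (j + 3))" unfolding summable_iff_convergent .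
    moreover have "V (n + 3) x = V 3 x + (\<Sum>j<n. a (j + 3))" for n
      using mollified_telescope[of "[]" "n + 3" x] x sum.shift_bounds_nat_ivl[of a 0 3 n]
      by (simp add: V_def a_def lessThan_atLeast0)
    ultimately have "convergent (\<lambda>n. V (n + 3) x)"
      using convergent_add[OF convergent_const[of "V 3 x"]] by simp
    then show ?thesis using convergent_ignore_initial_segment[where f = "\<lambda>k. V k x" and m = 3] by simp
  qed
  define W where "W x = lim (\<lambda>k. V k x)" for x
  have W: "(\<lambda>k. V k x) \<longlonglongrightarrow> W x" if "norm x \<le> 3 / 4" for x
    using conv[OF that] by (simp add: W_def convergent_LIMSEQ_iff)
  have Wm[measurable]: "W \<in> borel_measurable borel" unfolding W_def[abs_def] by measurable
  have WM: "\<bar>W x\<bar> \<le> M * I" if "norm x \<le> 3 / 4" for x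
    by (rule LIMSEQ_le_const2[OF tendsto_rabs[OF W[OF that]]]) (use VM in auto)
  have WL: "\<bar>W x - W x'\<bar> \<le> L * norm (x - x')" if "norm x \<le> 3 / 4" "norm x' \<le> 3 / 4" for x x'
    by (rule LIMSEQ_le_const2[OF tendsto_rabs[OF tendsto_diff[OF W[OF that(1)] W[OF that(2)]]]])
      (use L[OF _ that] in blast)
  \<comment> \<open>\<open>W\<close> is controlled only on the ball of radius 3/4; the indicator
    makes the difference bounded everywhere.\<close>
  define w where "w x = indicator (cball 0 (3 / 4)) x * (W x - c * u x)" for x
  have "AE x in lborel. norm x < 3 / 4 \<longrightarrow> w x = 0"
  proof (rule AE_zero_if_orthogonal_continuous)
    show "w \<in> borel_measurable borel" unfolding w_def[abs_def]
      by (intro borel_measurable_times borel_measurable_indicator borel_measurable_diff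
          borel_measurable_const um Wm) simp
    show "\<bar>w x\<bar> \<le> M * I + c * M" for x
    proof (cases "norm x \<le> 3 / 4")
      case True
      have "\<bar>c * u x\<bar> \<le> c * M" using uM[of x] c by (simp add: abs_mult)
      then show ?thesis using WM[OF True] True abs_triangle_ineq4[of "W x" "c * u x"] by (simp add: w_def)
    qed (use M_nonneg I0 c in \<open>simp add: w_def\<close>)
    fix \<psi> :: "'a \<Rightarrow> real" assume \<psi>: "continuous_on UNIV \<psi>" and z: "\<And>z. 3 / 4 < norm z \<Longrightarrow> \<psi> z = 0"
    have i: "integrable lborel \<psi>" by (rule integrable_continuous_support[OF \<psi> z])
    have [measurable]: "\<psi> \<in> borel_measurable borel" using i by auto
    have "(\<lambda>k. LBINT x. V k x * \<psi> x) \<longlonglongrightarrow> (LBINT x. W x * \<psi> x)"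
    proof (rule integral_dominated_convergence[where w = "\<lambda>x. M * I * \<bar>\<psi> x\<bar>"])
      show "AE x in lborel. (\<lambda>k. V k x * \<psi> x) \<longlonglongrightarrow> W x * \<psi> x"
      proof (rule AE_I2)
        fix x show "(\<lambda>k. V k x * \<psi> x) \<longlonglongrightarrow> W x * \<psi> x"
          using W[of x] z[of x] by (cases "norm x \<le> 3 / 4") (auto intro: tendsto_mult)
      qed
      show "AE x in lborel. norm (V k x * \<psi> x) \<le> M * I * \<bar>\<psi> x\<bar>" for k
        using VM by (auto simp: abs_mult intro!: AE_I2 mult_right_mono)
    qed (use i in auto)
    moreover have "(\<lambda>k. LBINT x. V k x * \<psi> x) \<longlonglongrightarrow> c * (LBINT x. u x * \<psi> x)"
      unfolding V_def mollified_fubini[of "[]", OF lists.Nil i] iter_partial_simps c_def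
      by (rule mollification_limit[OF \<psi> z])
    ultimately have eq: "(LBINT x. W x * \<psi> x) = c * (LBINT x. u x * \<psi> x)" by (rule LIMSEQ_unique)
    have iu: "integrable lborel (\<lambda>x. u x * \<psi> x)" by (rule bounded_times_integrable(1)[OF um uM i])
    have "integrable lborel (\<lambda>x. indicator (cball 0 (3 / 4)) x * W x * \<psi> x)"
    proof (rule bounded_times_integrable(1)[OF _ _ i, of _ "M * I"])
      show "(\<lambda>x. indicator (cball 0 (3 / 4)) x * W x) \<in> borel_measurable borel"
        by (intro borel_measurable_times borel_measurable_indicator Wm) simp
      show "\<bar>indicator (cball 0 (3 / 4)) x * W x\<bar> \<le> M * I" for x
        using WM[of x] M_nonneg I0 by (cases "norm x \<le> 3 / 4") (auto simp: indicator_def)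
    qed
    moreover have "indicator (cball 0 (3 / 4)) x * W x * \<psi> x = W x * \<psi> x" for x
      using z[of x] by (cases "norm x \<le> 3 / 4") auto
    ultimately have iW: "integrable lborel (\<lambda>x. W x * \<psi> x)" by simp
    have "w x * \<psi> x = W x * \<psi> x - c * (u x * \<psi> x)" for x
      using z[of x] by (cases "norm x \<le> 3 / 4") (auto simp: w_def algebra_simps)
    then show "(LBINT x. w x * \<psi> x) = 0" using iu iW eq by simp
  qed
  then have ae: "AE x in lborel. norm x < 3 / 4 \<longrightarrow> u x = W x / c"
    by eventually_elim (use c in \<open>auto simp: w_def field_simps\<close>)
  show ?thesis
  proof (rule exI[of _ "\<lambda>x. W x / c"], rule exI[of _ "L / c"], rule exI[of _ "M * I / c"], intro conjI allI
      impI ae)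
    show "\<bar>W x / c - W x' / c\<bar> \<le> L / c * norm (x - x')" if "norm x \<le> 3 / 4" "norm x' \<le> 3 / 4" for x x'
      using divide_right_mono[OF WL[OF that], of c] c by (simp flip: diff_divide_distrib)
    show "\<bar>W x / c\<bar> \<le> M * I / c" if "norm x \<le> 3 / 4" for x
      using divide_right_mono[OF WM[OF that], of c] c by simp
  qed (use L0 c in simp)
qed

text \<open>The singular integral is split dyadically.  On the layer at scale \<open>2\<^sup>-\<^sup>j\<close> the difference
  \<open>g - F t\<close> is at most \<open>\<omega> ((L + 1) 2\<^sup>-\<^sup>j)\<close>, summable by the Dini condition; the part with \<open>F t\<close>
  is summed over all layers before it is estimated, through the Hessian of the potential of \<open>F t\<close>.\<close>

lemma mollified_hessian_bound:
  fixes F :: "real \<Rightarrow> 'a \<Rightarrow> real"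
  assumes b: "b \<in> Basis" "b' \<in> Basis"
    and \<omega>: "modulus_of_continuity \<omega>" "dini \<omega>" and C: "0 \<le> C"
    and dense: "\<And>a b::real. a < b \<Longrightarrow> \<exists>t\<in>S. a < t \<and> t < b"
    and Fm: "\<And>t. t \<in> S \<Longrightarrow> F t \<in> borel_measurable borel" and FM: "\<And>t x. t \<in> S \<Longrightarrow> \<bar>F t x\<bar> \<le> M"
    and diff: "\<And>t. t \<in> S \<Longrightarrow> AE y in lborel. norm y < 3 / 4 \<longrightarrow> \<bar>g y - F t y\<bar> \<le> C * \<omega> \<bar>u y - t\<bar>"
    and hess: "\<And>a b. \<exists>K. \<forall>t\<in>S \<inter> {a..b}. \<forall>\<phi> i j. smooth \<phi> \<longrightarrow> (\<forall>z. 7 / 8 < norm z \<longrightarrow> \<phi> z = 0) \<longrightarrow> i \<in> Basis \<longrightarrow> j \<in> Basis \<longrightarrow>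
      \<bar>LBINT x. F t x * iter_partial [i, j] \<phi> x\<bar> \<le> K * (LBINT x. \<bar>laplacian \<phi> x\<bar>)"
  shows "\<exists>B. \<forall>k\<ge>3. \<forall>x. norm x \<le> 1 / 2 \<longrightarrow> \<bar>mollified [b, b'] k x\<bar> \<le> B"
proof -
  let ?ds = "[b, b']"
  have ds: "?ds \<in> lists Basis" using b by simp
  obtain t L T where *: "0 \<le> L \<and> (AE x in lborel. norm x < 3 / 4 \<longrightarrow> u x = t x) \<and>
    (\<forall>x x'. norm x \<le> 3 / 4 \<longrightarrow> norm x' \<le> 3 / 4 \<longrightarrow> \<bar>t x - t x'\<bar> \<le> L * norm (x - x')) \<and>
    (\<forall>x. norm x \<le> 3 / 4 \<longrightarrow> \<bar>t x\<bar> \<le> T)"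
    using lipschitz_representative by (elim exE)
  note L = conjunct1[OF *] and ut = conjunct1[OF conjunct2[OF *]]
  have tL: "\<bar>t x - t x'\<bar> \<le> L * norm (x - x')" if "norm x \<le> 3 / 4" "norm x' \<le> 3 / 4" for x x'
    using * that by simp
  have tT: "\<bar>t x\<bar> \<le> T" if "norm x \<le> 3 / 4" for x using * that by simp
  \<comment> \<open>The levels chosen below lie within 1 of a value of \<open>t\<close>, hence in
    one fixed compact interval, so a single constant \<open>K\<close> serves all points and all
    scales.\<close>
  obtain K where K: "\<And>s \<phi> i j. s \<in> S \<Longrightarrow> - T - 1 \<le> s \<Longrightarrow> s \<le> T + 1 \<Longrightarrow> smooth \<phi> \<Longrightarrow> (\<And>z. 7 / 8 < norm z \<Longrightarrow> \<phi> z = 0) \<Longrightarrow>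
     i \<in> Basis \<Longrightarrow> j \<in> Basis \<Longrightarrow> \<bar>LBINT x. F s x * iter_partial [i, j] \<phi> x\<bar> \<le> K * (LBINT x. \<bar>laplacian \<phi> x\<bar>)"
  proof -
    from hess[of "- T - 1" "T + 1"] obtain K where K: "\<forall>t\<in>S \<inter> {- T - 1..T + 1}. \<forall>\<phi> i j. smooth \<phi> \<longrightarrow> (\<forall>z. 7 /
        8 < norm z \<longrightarrow> \<phi> z = 0) \<longrightarrow> i \<in> Basis \<longrightarrow> j \<in> Basis \<longrightarrow>
      \<bar>LBINT x. F t x * iter_partial [i, j] \<phi> x\<bar> \<le> K * (LBINT x. \<bar>laplacian \<phi> x\<bar>)" by (elim exE)
    show thesis
    proof (rule that)
      fix s :: real and \<phi> :: "'a \<Rightarrow> real" and i j :: 'a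
      assume "s \<in> S" "- T - 1 \<le> s" "s \<le> T + 1" "smooth \<phi>" and z: "\<And>z::'a. 7 / 8 < norm z \<Longrightarrow> \<phi> z = 0"
        and ij: "i \<in> Basis" "j \<in> Basis"
      then have "s \<in> S \<inter> {- T - 1..T + 1}" "\<forall>z. 7 / 8 < norm z \<longrightarrow> \<phi> z = 0" by auto
      with K \<open>smooth \<phi>\<close> ij show "\<bar>LBINT x. F s x * iter_partial [i, j] \<phi> x\<bar> \<le> K * (LBINT x. \<bar>laplacian \<phi> x\<bar>)"
        by (simp del: iter_partial_simps)
    qed
  qed
  define I where "I = (LBINT z. \<bar>iter_partial ?ds kernel_step (z::'a)\<bar>)"
  define R where "R = (LBINT z. \<bar>kernel_density (z::'a)\<bar>)"
  define B0 where "B0 = M * ((2 ^ 3) ^ length ?ds * (LBINT z. \<bar>iter_partial ?ds kernel_density (z::'a)\<bar>))"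
  \<comment> \<open>On the layer of radius 2^-j, \<open>L\<close> accounts for the variation of
    \<open>t\<close> and 1 for the distance from \<open>t x\<close> to the chosen level.\<close>
  define \<Omega> where "\<Omega> j = \<omega> ((L + 1) * (1 / 2) ^ j)" for j
  have \<Omega>: "summable \<Omega>" unfolding \<Omega>_def using L by (intro dini_summable[OF \<omega>]) simp
  have \<omega>0: "0 \<le> \<omega> s" if "0 \<le> s" for s using \<omega>(1) that by (simp add: modulus_of_continuity_def)
  have \<omega>mono: "\<omega> s \<le> \<omega> s'" if "0 \<le> s" "s \<le> s'" for s s'
  proof -
    have "mono_on {0..} \<omega>" using \<omega>(1) by (simp add: modulus_of_continuity_def)
    from mono_onD[OF this _ _ that(2)] show ?thesis using that by simp
  qed
  have \<Omega>0: "0 \<le> \<Omega> j" for j unfolding \<Omega>_def using L by (intro \<omega>0) simp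
  have I0: "0 \<le> I" and R0: "0 \<le> R" by (simp_all add: I_def R_def)
  have "\<bar>mollified ?ds k x\<bar> \<le> B0 + C * I * suminf \<Omega> + \<bar>K\<bar> * (2 * R)" if k: "3 \<le> k" and x: "norm x \<le> 1 / 2" for k x
  proof -
    have x': "norm x \<le> 3 / 4" using x by simp
    have p: "(0::real) < (1 / 2) ^ k" by simp
    \<comment> \<open>An error 2^-k in the level is at most 2^-j for every layer j < k, so it is
      harmless at each scale of the sum.\<close>
    obtain s where s: "s \<in> S" "\<bar>t x - s\<bar> \<le> (1 / 2) ^ k"
      using dense[of "t x - (1 / 2) ^ k" "t x + (1 / 2) ^ k"] p by (force simp: abs_le_iff)
    have "(1 / 2 :: real) ^ k \<le> 1" by (simp add: power_le_one)
    then have sT: "- T - 1 \<le> s" "s \<le> T + 1" using tT[OF x'] s(2) by linarith+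
    define \<eta> where "\<eta> j = iter_partial ?ds (kernel_layer j :: 'a \<Rightarrow> real)" for j
    have i\<eta>: "integrable lborel (\<eta> j)" and I\<eta>: "(LBINT z. \<bar>\<eta> j z\<bar>) = I" for j
    proof -
      show "integrable lborel (\<eta> j)" unfolding \<eta>_def by (rule iter_partial_kernel_layer_integral(1)[OF dim ds])
      have "(1 / 4 :: real) ^ j * (2 ^ j) ^ length ?ds = 1"
        by (simp add: power2_eq_square power_mult_distrib[symmetric])
      then show "(LBINT z. \<bar>\<eta> j z\<bar>) = I"
        unfolding \<eta>_def iter_partial_kernel_layer_integral(2)[OF dim ds] I_def by simp
    qed
    note [measurable] = Fm[OF s(1)] borel_measurable_integrable[OF i\<eta>]
    have ig: "integrable lborel (\<lambda>y. g y * \<eta> j (y - x))" and iF: "integrable lborel (\<lambda>y. F s y * \<eta> j (y -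
        x))" for j
      using bounded_times_translate(1)[OF gm gM i\<eta>] bounded_times_translate(1)[OF Fm[OF s(1)] FM[OF s(1)]
          i\<eta>] by auto
    have layer: "\<bar>LBINT y. (g y - F s y) * \<eta> j (y - x)\<bar> \<le> C * I * \<Omega> j" if j: "3 \<le> j" "j < k" for j
    proof -
      have i: "integrable lborel (\<lambda>y. (g y - F s y) * \<eta> j (y - x))"
        unfolding left_diff_distrib using ig iF by (intro Bochner_Integration.integrable_diff)
      have i2: "integrable lborel (\<lambda>y. C * \<Omega> j * \<bar>\<eta> j (y - x)\<bar>)"
        using i\<eta>[of j] integral_translate(2)[of "\<eta> j" x] by simp
      have j8: "(1 / 2 :: real) ^ j \<le> 1 / 8"
        using power_decreasing[OF j(1), of "1 / 2 :: real"] by (simp add: power3_eq_cube)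
      have jk: "(1 / 2 :: real) ^ k \<le> (1 / 2) ^ j" using j by (intro power_decreasing) auto
      have ae: "AE y in lborel. norm ((g y - F s y) * \<eta> j (y - x)) \<le> C * \<Omega> j * \<bar>\<eta> j (y - x)\<bar>"
        using ut diff[OF s(1)]
      proof eventually_elim
        case (elim y)
        show ?case
        proof (cases "(1 / 2) ^ j < norm (y - x)")
          case True
          then show ?thesis using iter_partial_kernel_layer_outside[OF dim True, of ?ds]
              by (simp add: \<eta>_def del: iter_partial_simps)
        next
          case False
          then have yx: "norm (y - x) \<le> (1 / 2) ^ j" by simp
          then have y: "norm y < 3 / 4" using norm_triangle_ineq2[of y x] x j8 by linarith
          then have uy: "u y = t y" and gF: "\<bar>g y - F s y\<bar> \<le> C * \<omega> \<bar>u y - s\<bar>" using elim by auto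
          have "\<bar>t y - t x\<bar> \<le> L * (1 / 2) ^ j"
            by (rule order_trans[OF tL mult_left_mono[OF yx L]]) (use y x' in simp_all)
          moreover have "\<bar>t x - s\<bar> \<le> (1 / 2) ^ j" using s(2) jk by linarith
          ultimately have "\<bar>u y - s\<bar> \<le> (L + 1) * (1 / 2) ^ j" unfolding uy distrib_right by linarith
          then have "\<omega> \<bar>u y - s\<bar> \<le> \<Omega> j" unfolding \<Omega>_def by (intro \<omega>mono) auto
          then have "\<bar>g y - F s y\<bar> \<le> C * \<Omega> j" using gF mult_left_mono[OF _ C] by (meson order_trans)
          from mult_right_mono[OF this abs_ge_zero[of "\<eta> j (y - x)"]] show ?thesis by (simp add: abs_mult)
        qed
      qed
      have "norm (LBINT y. (g y - F s y) * \<eta> j (y - x)) \<le> (LBINT y. norm ((g y - F s y) * \<eta> j (y - x)))"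
        by (rule integral_norm_bound)
      also have "\<dots> \<le> (LBINT y. C * \<Omega> j * \<bar>\<eta> j (y - x)\<bar>)"
        by (rule integral_mono_AE[OF integrable_norm[OF i] i2 ae])
      also have "\<dots> = C * \<Omega> j * I"
        using integral_translate(1)[of "\<lambda>z. \<bar>\<eta> j z\<bar>" x] by (simp add: I\<eta>)
      finally show ?thesis by (simp add: mult_ac)
    qed
    have "\<bar>\<Sum>j=3..<k. LBINT y. (g y - F s y) * \<eta> j (y - x)\<bar> \<le> (\<Sum>j=3..<k. C * I * \<Omega> j)"
      by (rule order_trans[OF sum_abs sum_mono]) (use layer in auto)
    also have "\<dots> = C * I * (\<Sum>j=3..<k. \<Omega> j)" by (simp add: sum_distrib_left)
    also have "\<dots> \<le> C * I * suminf \<Omega>"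
      using C I0 \<Omega> \<Omega>0 by (intro mult_left_mono sum_le_suminf) auto
    finally have part1: "\<bar>\<Sum>j=3..<k. LBINT y. (g y - F s y) * \<eta> j (y - x)\<bar> \<le> C * I * suminf \<Omega>" .
    define \<psi> where "\<psi> z = (\<Sum>j=3..<k. kernel_layer j z)" for z :: 'a
    have s\<psi>: "smooth \<psi>" unfolding \<psi>_def[abs_def] by (intro smooth_sum_apply smooth_kernel_layer) simp
    define \<phi> where "\<phi> y = \<psi> (y - x)" for y
    have s\<phi>: "smooth \<phi>" using smooth_affine[OF s\<psi>, of 1 1 "- x"] by (simp add: \<phi>_def[abs_def])
    have \<phi>0: "\<phi> y = 0" if "7 / 8 < norm y" for y
      unfolding \<phi>_def \<psi>_def
    proof (rule sum.neutral, rule ballI)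
      fix j assume "j \<in> {3..<k}"
      then have "(1 / 2 :: real) ^ j \<le> (1 / 2) ^ 3" by (intro power_decreasing) auto
      then have "(1 / 2) ^ j \<le> norm (y - x)" using norm_triangle_ineq2[of y x] x that by (simp add: power3_eq_cube)
      then show "kernel_layer j (y - x) = 0" by (rule kernel_layer_outside[OF dim])
    qed
    have "iter_partial ?ds \<phi> = (\<lambda>y. iter_partial ?ds \<psi> (y - x))"
      using iter_partial_affine[OF s\<psi> ds, of 1 1 "- x"] by (simp add: \<phi>_def[abs_def])
    also have "iter_partial ?ds \<psi> = (\<lambda>z. \<Sum>j=3..<k. \<eta> j z)"
      unfolding \<psi>_def[abs_def] \<eta>_def by (rule smooth_sum_apply(2)[OF _ smooth_kernel_layer ds]) simp
    finally have D\<phi>: "iter_partial ?ds \<phi> = (\<lambda>y. \<Sum>j=3..<k. \<eta> j (y - x))" .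
    have "laplacian \<phi> = (\<lambda>y. dilate k kernel_density (y - x) - dilate 3 kernel_density (y - x))"
      using laplacian_affine[OF s\<psi>, of 1 1 "- x"] laplacian_kernel_layers[OF dim k]
      by (simp add: \<phi>_def[abs_def] \<psi>_def[abs_def])
    moreover have "integrable lborel (\<lambda>y::'a. dilate i kernel_density (y - x))"
      "(LBINT y. \<bar>dilate i kernel_density (y - x)\<bar>) = R" for i
    proof -
      have i: "integrable lborel (dilate i kernel_density :: 'a \<Rightarrow> real)"
        and I: "(LBINT z. \<bar>dilate i kernel_density (z::'a)\<bar>) = R"
        using iter_partial_dilate_integrable[OF bump_kernel_density, of "[]" i] by (simp_all add: R_def)
      show "integrable lborel (\<lambda>y::'a. dilate i kernel_density (y - x))"
        using i integral_translate(2)[of "dilate i kernel_density" x] by auto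
      show "(LBINT y. \<bar>dilate i kernel_density (y - x)\<bar>) = R"
        using I integral_translate(1)[of "\<lambda>z. \<bar>dilate i kernel_density z\<bar>" x] borel_measurable_integrable[OF
            i] by simp
    qed
    ultimately have lap: "(LBINT y. \<bar>laplacian \<phi> y\<bar>) \<le> 2 * R"
    proof -
      assume l: "laplacian \<phi> = (\<lambda>y. dilate k kernel_density (y - x) - dilate 3 kernel_density (y - x))"
        and i: "\<And>i. integrable lborel (\<lambda>y::'a. dilate i kernel_density (y - x))"
        and I: "\<And>i. (LBINT y. \<bar>dilate i kernel_density (y - x)\<bar>) = R"
      have "(LBINT y. \<bar>laplacian \<phi> y\<bar>)
          \<le> (LBINT y. \<bar>dilate k kernel_density (y - x)\<bar> + \<bar>dilate 3 kernel_density (y - x)\<bar>)"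
        unfolding l using i by (intro integral_mono) (auto intro: abs_triangle_ineq4)
      also have "\<dots> = 2 * R" using i by (simp add: I)
      finally show ?thesis .
    qed
    have "(\<Sum>j=3..<k. LBINT y. F s y * \<eta> j (y - x)) = (LBINT y. F s y * iter_partial ?ds \<phi> y)"
      unfolding D\<phi> sum_distrib_left using iF by (intro Bochner_Integration.integral_sum[symmetric])
    also have "\<bar>\<dots>\<bar> \<le> K * (LBINT y. \<bar>laplacian \<phi> y\<bar>)"
      by (rule K[OF s(1) sT s\<phi> \<phi>0 b])
    also have "\<dots> \<le> \<bar>K\<bar> * (2 * R)"
      using lap by (intro mult_mono) auto
    finally have part2: "\<bar>\<Sum>j=3..<k. LBINT y. F s y * \<eta> j (y - x)\<bar> \<le> \<bar>K\<bar> * (2 * R)" .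
    have "(\<Sum>j=3..<k. LBINT y. g y * \<eta> j (y - x)) =
      (\<Sum>j=3..<k. LBINT y. (g y - F s y) * \<eta> j (y - x)) + (\<Sum>j=3..<k. LBINT y. F s y * \<eta> j (y - x))"
      using ig iF by (simp add: left_diff_distrib flip: sum.distrib)
    then show ?thesis
      using part1 part2 mollified_telescope[OF ds k x'] mollified_bound[OF ds, of 3 x]
      unfolding B0_def[symmetric] \<eta>_def[symmetric] by linarith
  qed
  then show ?thesis by blast
qed

end

section \<open>Regularity\<close>

lemma lebesgue_measurable_AE_eq:
  fixes f g :: "'a::euclidean_space \<Rightarrow> real"
  assumes g: "g \<in> borel_measurable borel" and ae: "AE x in lborel. f x = g x"
  shows "f \<in> borel_measurable lebesgue"
proof -
  have "{x. f x \<noteq> g x} \<in> null_sets lebesgue"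
    using AE_completion[OF ae] by (simp add: completion.AE_iff_null_sets)
  then have N: "negligible {x. f x \<noteq> g x}" by (simp add: negligible_iff_null_sets)
  have "g measurable_on UNIV"
    using g by (intro lebesgue_measurable_imp_measurable_on) (auto intro: measurable_completion)
  then have "f measurable_on UNIV" by (rule measurable_on_spike[OF _ N]) auto
  then show ?thesis by (simp add: measurable_on_iff_borel_measurable lebesgue_on_UNIV_eq)
qed

lemma integral_lebesgue_AE:
  fixes f g :: "'a::euclidean_space \<Rightarrow> real"
  assumes g: "g \<in> borel_measurable borel" and ae: "AE x in lborel. f x = g x"
  shows "integral\<^sup>L lebesgue f = integral\<^sup>L lborel g"
proof -
  have g': "g \<in> borel_measurable lebesgue" using g by (auto intro: measurable_completion)
  have "integral\<^sup>L lebesgue f = integral\<^sup>L lebesgue g"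
    by (rule integral_cong_AE[OF lebesgue_measurable_AE_eq[OF g ae] g' AE_completion[OF ae]])
  also have "\<dots> = integral\<^sup>L lborel g" using g by (intro integral_completion) simp
  finally show ?thesis .
qed

text \<open>Transfers the weak formulation, given by Lebesgue set integrals over \<open>U\<close>,
  to Borel representatives on the whole space; these have to match only on the set \<open>V\<close>
  that carries \<phi>.\<close>

lemma set_integral_lebesgue_AE:
  fixes w w' \<phi> :: "'a::euclidean_space \<Rightarrow> real"
  assumes "w' \<in> borel_measurable borel" "\<phi> \<in> borel_measurable borel"
    and ae: "AE x in lborel. x \<in> V \<longrightarrow> w x = w' x" and V: "V \<subseteq> U" and \<phi>: "\<And>x. x \<notin> V \<Longrightarrow> \<phi> x = 0"
  shows "(LINT x:U|lebesgue. w x * \<phi> x) = (LBINT x. w' x * \<phi> x)"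
  unfolding set_lebesgue_integral_def
proof (rule integral_lebesgue_AE)
  show "(\<lambda>x. w' x * \<phi> x) \<in> borel_measurable borel" using assms by simp
  show "AE x in lborel. indicat_real U x *\<^sub>R (w x * \<phi> x) = w' x * \<phi> x"
    using ae by eventually_elim (use V \<phi> in \<open>auto simp: indicator_def\<close>)
qed

lemma bounded_borel_representative:
  fixes w :: "'a::euclidean_space \<Rightarrow> real"
  assumes U: "U \<in> sets borel" and w: "w \<in> borel_measurable (lebesgue_on U)"
    and M: "AE x in lebesgue_on U. \<bar>w x\<bar> \<le> M" "0 \<le> M"
  shows "\<exists>w'. w' \<in> borel_measurable borel \<and> (\<forall>x. \<bar>w' x\<bar>
      \<le> M) \<and> (\<forall>x. x \<notin> U \<longrightarrow> w' x = 0) \<and> (AE x in lborel. x \<in> U \<longrightarrow> w x = w' x)"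
proof -
  have Ul: "U \<inter> space lebesgue \<in> sets lebesgue" using U by simp
  have "(\<lambda>x. indicator U x *\<^sub>R w x) \<in> borel_measurable lebesgue"
    using w borel_measurable_restrict_space_iff[OF Ul] by blast
  then obtain v where v: "v \<in> borel_measurable lborel" "AE x in lborel. indicator U x *\<^sub>R w x = v x"
    using completion_ex_borel_measurable_real by blast
  have ae: "AE x in lborel. x \<in> U \<longrightarrow> \<bar>w x\<bar> \<le> M"
    using M(1) unfolding AE_restrict_space_iff[OF Ul] AE_completion_iff .
  \<comment> \<open>Clamping makes the essential bound hold at every point.\<close>
  define w' where "w' x = indicator U x * max (- M) (min M (v x))" for x
  have "w' \<in> borel_measurable borel"
    unfolding w'_def[abs_def] using U v(1) by simp
  moreover have "\<bar>w' x\<bar> \<le> M" for x using M(2) by (auto simp: w'_def indicator_def abs_le_iff)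
  moreover have "x \<notin> U \<longrightarrow> w' x = 0" for x by (simp add: w'_def)
  moreover have "AE x in lborel. x \<in> U \<longrightarrow> w x = w' x"
    using v(2) ae by eventually_elim (auto simp: w'_def abs_le_iff max_def min_def)
  ultimately show ?thesis by blast
qed

lemma test_functionsD:
  assumes "\<phi> \<in> test_functions U"
  shows "smooth \<phi>" and "z \<notin> U \<Longrightarrow> iter_partial ds \<phi> z = 0"
proof -
  have c: "closure {x. \<phi> x \<noteq> 0} \<subseteq> U" and s: "smooth \<phi>" using assms by (auto simp: test_functions_def)
  show "smooth \<phi>" by (rule s)
  show "iter_partial ds \<phi> z = 0" if "z \<notin> U"
    by (rule iter_partial_zero_outside[of "closure {x. \<phi> x \<noteq> 0}"])
        (use c that closure_subset[of "{x. \<phi> x \<noteq> 0}"] in auto)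
qed

lemma test_functions_ballI:
  assumes "smooth \<phi>" "\<And>z. r < norm z \<Longrightarrow> \<phi> z = 0" "r < R"
  shows "\<phi> \<in> test_functions (ball 0 R)"
proof -
  have "{x. \<phi> x \<noteq> 0} \<subseteq> cball 0 r" using assms(2) by force
  then have c: "closure {x. \<phi> x \<noteq> 0} \<subseteq> cball 0 r" by (intro closure_minimal) auto
  then have "compact (closure {x. \<phi> x \<noteq> 0})"
    by (meson bounded_cball bounded_subset closed_closure compact_eq_bounded_closed)
  then show ?thesis using c assms(1,3) by (auto simp: test_functions_def)
qed

lemma iter_partial_measurable: "smooth \<phi> \<Longrightarrow> ds \<in> lists Basis \<Longrightarrow> iter_partial ds \<phi> \<in> borel_measurable borel"
  by (intro smooth_borel_measurable smooth_iter_partial)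

text \<open>Up to constants the potential v satisfies \<Delta>v = F, so pairing F with D_ij \<phi>
  amounts to pairing v with \<Delta>D_ij \<phi> = D_ij \<Delta>\<phi>. With \<Delta>\<phi> as the
  test function in the definition of the weak Hessian, this becomes the pairing of H_ij with
  \<Delta>\<phi>. Hence only the L^1 norm of \<Delta>\<phi> enters, which stays bounded for sums of
  layers.\<close>

lemma newtonian_potential_hessian_pairing:
  fixes F :: "'a::euclidean_space \<Rightarrow> real"
  assumes n: "2 \<le> DIM('a)" and F: "F \<in> borel_measurable borel" "\<And>x. \<bar>F x\<bar> \<le> M" "\<And>x. 1 < norm x \<Longrightarrow> F x = 0"
    and H: "weak_hessian_bound (ball 0 1) (\<lambda>x. LBINT y. F y * newtonian_kernel (x - y)) C"
    and \<phi>: "smooth \<phi>" "\<And>z. 7 / 8 < norm z \<Longrightarrow> \<phi> z = 0" and ij: "i \<in> Basis" "j \<in> Basis"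
  shows "\<bar>LBINT x. F x * iter_partial [i, j] \<phi> x\<bar> \<le>
    kernel_const DIM('a) / (LBINT z. kernel_density (z::'a)) * \<bar>C\<bar> * (LBINT x. \<bar>laplacian \<phi> x\<bar>)"
proof -
  define v where "v x = (LBINT y. F y * newtonian_kernel (x - y))" for x
  define c where "c = (LBINT z. kernel_density (z::'a))"
  have c: "0 < c" unfolding c_def by (rule kernel_density_integral_pos)
  have \<kappa>: "0 < kernel_const DIM('a)" by (rule kernel_const_pos) simp
  have ds: "[i, j] \<in> lists Basis" using ij by simp
  define \<psi> where "\<psi> = iter_partial [i, j] \<phi>"
  have s\<psi>: "smooth \<psi>" unfolding \<psi>_def by (rule smooth_iter_partial[OF \<phi>(1) ds])
  have zero: "iter_partial ds \<phi> z = 0" if "7 / 8 < norm z" for ds z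
    by (rule iter_partial_zero_outside[of "cball 0 (7 / 8)"]) (use \<phi>(2) that in auto)
  have \<psi>0: "\<psi> z = 0" if "1 < norm z" for z unfolding \<psi>_def using zero that by (simp del: iter_partial_simps)
  have \<Delta>0: "laplacian \<phi> z = 0" if "7 / 8 < norm z" for z
    using zero[OF that] by (simp add: laplacian_eq del: iter_partial_simps)
  have s\<Delta>: "smooth (laplacian \<phi>)" by (rule smooth_laplacian[OF \<phi>(1)])
  have i\<Delta>: "integrable lborel (laplacian \<phi>)"
    by (rule integrable_continuous_support[OF smooth_imp_continuous_on[OF s\<Delta>] \<Delta>0])
  obtain H where H: "\<And>i j. i \<in> Basis \<Longrightarrow> j \<in> Basis \<Longrightarrow> weak_deriv (ball 0 1) [i, j] v (H i j)"
    and HC: "AE x in lebesgue_on (ball 0 1). sqrt (\<Sum>i\<in>Basis. \<Sum>j\<in>Basis. (H i j x)\<^sup>2) \<le> C"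
    using H unfolding weak_hessian_bound_def v_def by blast
  have vm: "v \<in> borel_measurable borel" and eq: "kernel_const DIM('a) * (LBINT x. v x * laplacian \<psi> x)
      = c * (LBINT x. F x * \<psi> x)"
    using newtonian_potential_weak_laplacian(1,3)[OF n F s\<psi> \<psi>0] unfolding v_def c_def by blast+
  have test: "laplacian \<phi> \<in> test_functions (ball 0 1)"
    by (rule test_functions_ballI[where r = "7 / 8", OF s\<Delta> \<Delta>0]) simp_all
  have "(LBINT x. v x * laplacian \<psi> x) = (LBINT x. v x * iter_partial [i, j] (laplacian \<phi>) x)"
    unfolding \<psi>_def laplacian_iter_partial[OF \<phi>(1) ds] ..
  also have "\<dots> = (LINT x:ball 0 1|lebesgue. v x * iter_partial [i, j] (laplacian \<phi>) x)"
    by (rule set_integral_lebesgue_AE[OF vm iter_partial_measurable[OF s\<Delta> ds], of "ball 0 1", symmetric])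
      (auto simp: test_functionsD(2)[OF test] simp del: iter_partial_simps)
  also have "\<dots> = (LINT x:ball 0 1|lebesgue. H i j x * laplacian \<phi> x)"
    using H[OF ij] test unfolding weak_deriv_def by (simp del: iter_partial_simps)
  finally have v: "(LBINT x. v x * laplacian \<psi> x) = (LINT x:ball 0 1|lebesgue. H i j x * laplacian \<phi> x)" .
  have Ul: "ball (0::'a) 1 \<inter> space lebesgue \<in> sets lebesgue" by simp
  have ae: "AE x in lebesgue. x \<in> ball 0 1 \<longrightarrow> \<bar>H i j x\<bar> \<le> \<bar>C\<bar>"
    using HC unfolding AE_restrict_space_iff[OF Ul]
  proof (elim eventually_mono, intro impI)
    fix x :: 'a assume "x \<in> ball 0 1" and "x \<in> ball 0 1 \<longrightarrow> sqrt (\<Sum>i\<in>Basis. \<Sum>j\<in>Basis. (H i j x)\<^sup>2) \<le> C"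
    then have *: "sqrt (\<Sum>i\<in>Basis. \<Sum>j\<in>Basis. (H i j x)\<^sup>2) \<le> C" by blast
    have "(H i j x)\<^sup>2 \<le> (\<Sum>j\<in>Basis. (H i j x)\<^sup>2)" using ij(2) by (intro member_le_sum) auto
    also have "\<dots> \<le> (\<Sum>i\<in>Basis. \<Sum>j\<in>Basis. (H i j x)\<^sup>2)"
      by (rule member_le_sum[of i Basis "\<lambda>i. \<Sum>j\<in>Basis. (H i j x)\<^sup>2"]) (use ij(1) in \<open>auto intro: sum_nonneg\<close>)
    finally have "sqrt ((H i j x)\<^sup>2) \<le> sqrt (\<Sum>i\<in>Basis. \<Sum>j\<in>Basis. (H i j x)\<^sup>2)" by (rule real_sqrt_le_mono)
    then show "\<bar>H i j x\<bar> \<le> \<bar>C\<bar>" using * by simp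
  qed
  have il: "integrable lebesgue (\<lambda>x. \<bar>C\<bar> * \<bar>laplacian \<phi> x\<bar>)"
    using i\<Delta> by (auto simp: integrable_completion borel_measurable_integrable)
  have "\<bar>LINT x:ball 0 1|lebesgue. H i j x * laplacian \<phi> x\<bar> \<le> (\<integral>x. \<bar>C\<bar> * \<bar>laplacian \<phi> x\<bar> \<partial>lebesgue)"
  proof (cases "integrable lebesgue (\<lambda>x. indicator (ball 0 1) x *\<^sub>R (H i j x * laplacian \<phi> x))")
    case True
    have "norm (LINT x:ball 0 1|lebesgue. H i j x * laplacian \<phi> x)
        \<le> (\<integral>x. norm (indicator (ball 0 1) x *\<^sub>R (H i j x * laplacian \<phi> x)) \<partial>lebesgue)"
      unfolding set_lebesgue_integral_def by (rule integral_norm_bound)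
    also have "\<dots> \<le> (\<integral>x. \<bar>C\<bar> * \<bar>laplacian \<phi> x\<bar> \<partial>lebesgue)"
    proof (rule integral_mono_AE[OF integrable_norm[OF True] il])
      show "AE x in lebesgue. norm (indicator (ball 0 1) x *\<^sub>R (H i j x * laplacian \<phi> x)) \<le> \<bar>C\<bar> * \<bar>laplacian \<phi> x\<bar>"
        using ae
      proof eventually_elim
        case (elim x)
        then show ?case by (cases "x \<in> ball 0 1") (simp_all add: abs_mult mult_right_mono)
      qed
    qed
    finally show ?thesis by simp
  next
    case False
    \<comment> \<open>A non-integrable integrand has integral 0 by convention, so the bound is
      trivial in this case.\<close>
    then show ?thesis unfolding set_lebesgue_integral_def by (simp add: not_integrable_integral_eq)
  qed
  also have "(\<integral>x. \<bar>C\<bar> * \<bar>laplacian \<phi> x\<bar> \<partial>lebesgue) = \<bar>C\<bar> * (LBINT x. \<bar>laplacian \<phi> x\<bar>)"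
    using i\<Delta> by (subst integral_completion) (auto simp: borel_measurable_integrable)
  finally have "\<bar>LBINT x. v x * laplacian \<psi> x\<bar> \<le> \<bar>C\<bar> * (LBINT x. \<bar>laplacian \<phi> x\<bar>)" unfolding v .
  moreover have "(LBINT x. F x * \<psi> x) = kernel_const DIM('a) / c * (LBINT x. v x * laplacian \<psi> x)"
    using eq c by (simp add: field_simps)
  then have "\<bar>LBINT x. F x * \<psi> x\<bar> = kernel_const DIM('a) / c * \<bar>LBINT x. v x * laplacian \<psi> x\<bar>"
    using c \<kappa> by (simp add: abs_mult)
  ultimately show ?thesis
    using mult_left_mono[of "\<bar>LBINT x. v x * laplacian \<psi> x\<bar>" _ "kernel_const DIM('a) / c"] c \<kappa>
    unfolding \<psi>_def[symmetric] c_def[symmetric] by (simp add: mult.assoc)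
qed

lemma finite_measure_lebesgue_on_ball: "finite_measure (lebesgue_on (ball (a::'a::euclidean_space) r))"
  by (intro finite_measure_lebesgue_on) simp

text \<open>\<open>bounded_weak_limit\<close> is applied to the mollified derivatives, normalised by
  the sign and the mass c, on the ball of radius 1/2, where the uniform bound is available.\<close>

lemma (in poisson_solution) bounded_weak_derivative:
  assumes ds: "ds \<in> lists Basis"
    and B: "\<And>k x. 3 \<le> k \<Longrightarrow> norm x \<le> 1 / 2 \<Longrightarrow> \<bar>mollified ds k x\<bar> \<le> B"
  defines "U \<equiv> ball (0::'a) (1 / 2)"
  shows "\<exists>G. L_infty U G \<and> (\<forall>\<phi>\<in>test_functions U.
      (LBINT x. u x * iter_partial ds \<phi> x) = (- 1) ^ length ds * (LINT x:U|lebesgue. G x * \<phi> x))"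
proof -
  define c where "c = (LBINT z. kernel_density (z::'a))"
  have c: "0 < c" unfolding c_def by (rule kernel_density_integral_pos)
  have Ul: "U \<inter> space lebesgue \<in> sets lebesgue" by (simp add: U_def)
  \<comment> \<open>The index is shifted because the uniform bound starts at scale 3.\<close>
  define G where "G k x = (- 1) ^ length ds / c * mollified ds (k + 3) x" for k x
  define \<Lambda> where "\<Lambda> \<phi> = (- 1) ^ length ds * (LBINT x. u x * iter_partial ds \<phi> x)" for \<phi>
  have Gm: "G k \<in> borel_measurable borel" for k
    unfolding G_def[abs_def] using mollified_measurable[OF ds] by simp
  have \<phi>b: "\<phi> \<in> borel_measurable borel" if "\<phi> \<in> test_functions U" for \<phi>
    using test_functionsD(1)[OF that] by (rule smooth_borel_measurable)
  have \<phi>0: "\<phi> x = 0" if "\<phi> \<in> test_functions U" "x \<notin> U" for \<phi> x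
    using test_functionsD(2)[OF that, of "[]"] by simp
  have "\<exists>h. h \<in> borel_measurable (lebesgue_on U) \<and> (\<forall>x\<in>space (lebesgue_on U). \<bar>h x\<bar> \<le> B / c) \<and>
     (\<forall>\<phi>\<in>test_functions U. (\<integral>x. h x * \<phi> x \<partial>lebesgue_on U) = \<Lambda> \<phi>)"
  proof (rule bounded_weak_limit[where g = G])
    show "finite_measure (lebesgue_on U)" unfolding U_def by (rule finite_measure_lebesgue_on_ball)
    show "G k \<in> borel_measurable (lebesgue_on U)" for k
      using Gm[of k] by (intro measurable_restrict_space1 measurable_completion) simp
    show "\<bar>G k x\<bar> \<le> B / c" if "x \<in> space (lebesgue_on U)" for k x
      using B[of "k + 3" x] that c by (simp add: G_def U_def abs_mult divide_right_mono power_abs)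
    fix \<phi> assume \<phi>: "\<phi> \<in> test_functions U"
    have z: "\<phi> z = 0" if "1 / 2 < norm z" for z using \<phi>0[OF \<phi>] that by (simp add: U_def)
    have i: "integrable lborel \<phi>"
      by (rule integrable_continuous_support[OF smooth_imp_continuous_on[OF test_functionsD(1)[OF \<phi>]] z])
    then have "integrable lebesgue \<phi>" by (simp add: integrable_completion borel_measurable_integrable)
    moreover have "(\<lambda>x. indicator U x *\<^sub>R \<phi> x) = \<phi>" using \<phi>0[OF \<phi>] by (auto simp: fun_eq_iff indicator_def)
    ultimately show "integrable (lebesgue_on U) \<phi>" by (simp add: integrable_restrict_space[OF Ul])
    have "(\<integral>x. G k x * \<phi> x \<partial>lebesgue_on U) = (- 1) ^ length ds / c * (LBINT x. mollified ds (k + 3) x * \<phi> x)" for k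
    proof -
      have "(\<integral>x. G k x * \<phi> x \<partial>lebesgue_on U) = (LINT x:U|lebesgue. G k x * \<phi> x)"
        unfolding set_lebesgue_integral_def by (rule integral_restrict_space[OF Ul])
      also have "\<dots> = (LBINT x. G k x * \<phi> x)"
        by (rule set_integral_lebesgue_AE[OF Gm \<phi>b[OF \<phi>], of U]) (use \<phi>0[OF \<phi>] in auto)
      finally show ?thesis by (simp add: G_def mult.assoc)
    qed
    moreover have "(\<lambda>k. (- 1) ^ length ds / c * (LBINT x. mollified ds (k + 3) x * \<phi> x)) \<longlonglongrightarrow>
        (- 1) ^ length ds / c * (c * (LBINT y. u y * iter_partial ds \<phi> y))"
      unfolding c_def
      by (intro tendsto_mult tendsto_const LIMSEQ_ignore_initial_segment mollified_weak_limit[OF ds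
          test_functionsD(1)[OF \<phi>] z])
    ultimately show "(\<lambda>k. \<integral>x. G k x * \<phi> x \<partial>lebesgue_on U) \<longlonglongrightarrow> \<Lambda> \<phi>"
      using c by (simp add: \<Lambda>_def)
  qed
  then obtain h where h: "h \<in> borel_measurable (lebesgue_on U)" "\<forall>x\<in>space (lebesgue_on U). \<bar>h x\<bar> \<le> B / c"
     "\<forall>\<phi>\<in>test_functions U. (\<integral>x. h x * \<phi> x \<partial>lebesgue_on U) = \<Lambda> \<phi>" by blast
  have "(LBINT x. u x * iter_partial ds \<phi> x)
      = (- 1) ^ length ds * (LINT x:U|lebesgue. h x * \<phi> x)" if "\<phi> \<in> test_functions U" for \<phi>
  proof -
    have "(LINT x:U|lebesgue. h x * \<phi> x) = \<Lambda> \<phi>"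
      using h(3) that unfolding set_lebesgue_integral_def by (simp add: integral_restrict_space[OF Ul])
    then show ?thesis by (simp add: \<Lambda>_def mult.assoc[symmetric] power_mult_distrib[symmetric])
  qed
  moreover have "L_infty U h" unfolding L_infty_def using h(1,2) by (auto intro!: exI[of _ "B / c"] AE_I2)
  ultimately show ?thesis by blast
qed

section \<open>Local integrability and measurability of sections\<close>

lemma L_infty_subset:
  assumes "L_infty U w" "V \<subseteq> U" "V \<in> sets borel" "U \<in> sets borel"
  shows "L_infty V w"
proof -
  obtain C where w: "w \<in> borel_measurable (lebesgue_on U)" and C: "AE x in lebesgue_on U. \<bar>w x\<bar> \<le> C"
    using assms(1) by (auto simp: L_infty_def)
  have Ul: "U \<inter> space lebesgue \<in> sets lebesgue" "V \<inter> space lebesgue \<in> sets lebesgue" using assms by auto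
  have "AE x in lebesgue_on V. \<bar>w x\<bar> \<le> C"
    using C unfolding AE_restrict_space_iff[OF Ul(1)] AE_restrict_space_iff[OF Ul(2)]
    by eventually_elim (use assms(2) in auto)
  then show ?thesis using measurable_restrict_mono[OF w assms(2)] by (auto simp: L_infty_def)
qed

lemma L_infty_locally_integrable:
  assumes w: "L_infty U w" and U: "U \<in> sets borel"
  shows "locally_integrable U w"
  unfolding locally_integrable_def
proof (intro allI impI)
  fix K assume K: "compact K \<and> K \<subseteq> U"
  have Kb: "K \<in> sets borel" using K by (simp add: borel_compact)
  have "L_infty K w" using L_infty_subset[OF w _ Kb U] K by blast
  then obtain C where wK: "w \<in> borel_measurable (lebesgue_on K)" and C: "AE x in lebesgue_on K. \<bar>w x\<bar> \<le> C"
    by (auto simp: L_infty_def)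
  have "finite_measure (lebesgue_on K)" using K by (intro finite_measure_lebesgue_on lmeasurable_compact) simp
  then interpret finite_measure "lebesgue_on K" .
  have "integrable (lebesgue_on K) (norm \<circ> w)"
    by (rule integrable_const_bound[where B = C]) (use wK C in \<open>auto simp: o_def\<close>)
  then show "w absolutely_integrable_on K"
    using wK Kb by (simp add: absolutely_integrable_measurable)
qed

text \<open>A section of a Lebesgue measurable function need not be measurable. The function agrees
  with a Borel one off a Borel null set of the product, and by Fubini almost every section of that
  set is null.\<close>

lemma AE_borel_sections:
  fixes H :: "'a::euclidean_space \<times> real \<Rightarrow> real"
  assumes "H \<in> borel_measurable lebesgue"
  shows "\<exists>h. h \<in> borel_measurable borel \<and> (AE t in lborel. AE x in lborel. H (x, t) = h (x, t))"
proof -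
  obtain h where h: "h \<in> borel_measurable lborel" and ae: "AE p in lborel. H p = h p"
    using completion_ex_borel_measurable_real[OF assms] by blast
  obtain N where N: "{p \<in> space lborel. \<not> H p = h p} \<subseteq> N" "emeasure lborel N = 0" "N \<in> sets lborel"
    using AE_E[OF ae] by blast
  have "N \<in> null_sets lborel" using N by (simp add: null_sets_def)
  then have "AE p in lborel. p \<notin> N" by (rule AE_not_in)
  then have "AE p in (lborel :: 'a measure) \<Otimes>\<^sub>M (lborel :: real measure). p \<notin> N" by (simp only: lborel_prod)
  then have "AE x in (lborel :: 'a measure). AE t in (lborel :: real measure). (x, t) \<notin> N"
    by (rule lborel_pair.AE_pair)
  moreover have "{p \<in> space ((lborel :: 'a measure) \<Otimes>\<^sub>M (lborel :: real measure)). (fst p, snd p) \<notin> N} \<in>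
      sets ((lborel :: 'a measure) \<Otimes>\<^sub>M (lborel :: real measure))"
  proof -
    have "{p \<in> space ((lborel :: 'a measure) \<Otimes>\<^sub>M (lborel :: real measure)). (fst p, snd p) \<notin> N} = - N"
      by (auto simp: space_pair_measure)
    moreover have "- N \<in> sets lborel" using sets.compl_sets[OF N(3)] by (simp add: Compl_eq_Diff_UNIV)
    ultimately show ?thesis by (simp only: lborel_prod)
  qed
  ultimately have "AE t in (lborel :: real measure). AE x in (lborel :: 'a measure). (x, t) \<notin> N"
    using lborel_pair.AE_commute[of "\<lambda>x t. (x, t) \<notin> N"] by blast
  then have "AE t in lborel. AE x in lborel. H (x, t) = h (x, t)"
  proof eventually_elim
    case (elim t)
    then show ?case by eventually_elim (use N(1) in auto)
  qed
  then show ?thesis using h by auto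
qed

lemma AE_lborel_dense:
  assumes "AE t in lborel. t \<in> S" "(a::real) < b"
  shows "\<exists>t\<in>S. a < t \<and> t < b"
proof (rule ccontr)
  assume "\<not> ?thesis"
  then have "AE t in lborel. t \<notin> {a<..<b}" using assms(1) by (auto elim!: eventually_mono)
  then have "emeasure lborel {a<..<b} = 0"
    using AE_iff_null_sets[of "{a<..<b}" lborel] by auto
  then show False using assms(2) by simp
qed

theorem theorem1p1:
  fixes f :: "'a::euclidean_space \<Rightarrow> real \<Rightarrow> real" and u :: "'a \<Rightarrow> real"
  assumes "DIM('a) \<ge> 2"
    and "(\<lambda>(x, t). f x t) \<in> borel_measurable (lebesgue_on (ball 0 1 \<times> UNIV))"
    and "bounded ((\<lambda>(x, t). f x t) ` (ball 0 1 \<times> UNIV))"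
    and "assumption_A f"
    and "weak_solution (ball 0 1) f u"
  shows "C11_on (ball 0 (1/2)) u"
proof -
  define U where "U = ball (0::'a) 1"
  define V where "V = ball (0::'a) (1 / 2)"
  have Ub: "U \<in> sets borel" and Vb: "V \<in> sets borel" and VU: "V \<subseteq> U" by (auto simp: U_def V_def)
  have Ul: "U \<inter> space lebesgue \<in> sets lebesgue" using Ub by simp
  obtain M0 where fM: "\<And>x t. x \<in> U \<Longrightarrow> \<bar>f x t\<bar> \<le> M0"
    using assms(3) unfolding bounded_iff U_def by force
  have M0: "0 \<le> M0" using fM[of 0 0] by (simp add: U_def)
  obtain h \<omega> where h: "L_infty U h" and \<omega>: "modulus_of_continuity \<omega>" "dini \<omega>"
    and fh: "\<And>x s t. x \<in> U \<Longrightarrow> \<bar>f x t - f x s\<bar> \<le> h x * \<omega> \<bar>t - s\<bar>"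
    and hess: "\<And>a b. \<exists>C. \<forall>t\<in>{a..b}. weak_hessian_bound U (newtonian_potential f t) C"
    using assms(4) unfolding assumption_A_def U_def by blast
  have \<omega>0: "0 \<le> \<omega> s" if "0 \<le> s" for s using \<omega>(1) that by (simp add: modulus_of_continuity_def)
  obtain Ch where "AE x in lebesgue_on U. \<bar>h x\<bar> \<le> Ch" using h by (auto simp: L_infty_def)
  then have hC: "AE x in lborel. x \<in> U \<longrightarrow> \<bar>h x\<bar> \<le> Ch"
    unfolding AE_restrict_space_iff[OF Ul] AE_completion_iff .
  have u: "L_infty U u" and loc: "locally_integrable U (\<lambda>x. f x (u x))"
    and weak: "\<And>\<phi>. \<phi> \<in> test_functions U \<Longrightarrow> (LINT x:U|lebesgue. u x * laplacian \<phi> x)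
        = (LINT x:U|lebesgue. f x (u x) * \<phi> x)"
    using assms(5) unfolding weak_solution_def U_def by blast+
  obtain M1 where um: "u \<in> borel_measurable (lebesgue_on U)" and M1: "AE x in lebesgue_on U. \<bar>u x\<bar> \<le> M1"
    using u by (auto simp: L_infty_def)
  define M where "M = max M0 \<bar>M1\<bar>"
  have M: "0 \<le> M" "M0 \<le> M" "M1 \<le> M" using M0 by (auto simp: M_def)
  have "AE x in lebesgue_on U. \<bar>u x\<bar> \<le> M" using M1 by eventually_elim (use M in auto)
  from bounded_borel_representative[OF Ub um this M(1)] obtain u' where u': "u' \<in> borel_measurable borel"
    "\<And>x. \<bar>u' x\<bar> \<le> M" "\<And>x. x \<notin> U \<Longrightarrow> u' x = 0" "AE x in lborel. x \<in> U \<longrightarrow> u x = u' x" by blast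
  \<comment> \<open>f(x, u x) is given as locally integrable, so its measurability is read off on a
    compact ball; radius 7/8 leaves room for the supports of the test functions.\<close>
  define D where "D = cball (0::'a) (7 / 8)"
  have Db: "D \<in> sets borel" and DU: "D \<subseteq> U" by (auto simp: D_def U_def)
  have "(\<lambda>x. f x (u x)) absolutely_integrable_on D"
    using loc DU unfolding locally_integrable_def by (simp add: D_def)
  then have gm: "(\<lambda>x. f x (u x)) \<in> borel_measurable (lebesgue_on D)"
    using Db by (simp add: absolutely_integrable_measurable)
  have "AE x in lebesgue_on D. \<bar>f x (u x)\<bar> \<le> M"
    using order_trans[OF fM M(2)] DU by (intro AE_I2) auto
  from bounded_borel_representative[OF Db gm this M(1)] obtain g where g: "g \<in> borel_measurable borel"
    "\<And>x. \<bar>g x\<bar> \<le> M" "AE x in lborel. x \<in> D \<longrightarrow> f x (u x) = g x" by blast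
  interpret poisson_solution u' g M
  proof
    fix \<phi> :: "'a \<Rightarrow> real" assume \<phi>: "smooth \<phi>" "\<And>z. 7 / 8 < norm z \<Longrightarrow> \<phi> z = 0"
    have test: "\<phi> \<in> test_functions U"
      unfolding U_def by (rule test_functions_ballI[where r = "7 / 8", OF \<phi>]) simp_all
    have \<Delta>0: "laplacian \<phi> x = 0" if "x \<notin> U" for x
      using test_functionsD(2)[OF test that] by (simp add: laplacian_eq del: iter_partial_simps)
    have "(LBINT x. u' x * laplacian \<phi> x) = (LINT x:U|lebesgue. u x * laplacian \<phi> x)"
      by (rule set_integral_lebesgue_AE[OF u'(1) smooth_borel_measurable[OF smooth_laplacian[OF \<phi>(1)]] u'(4)
          order_refl \<Delta>0, symmetric])
    also have "\<dots> = (LINT x:U|lebesgue. f x (u x) * \<phi> x)" by (rule weak[OF test])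
    also have "\<dots> = (LBINT x. g x * \<phi> x)"
      by (rule set_integral_lebesgue_AE[OF g(1) smooth_borel_measurable[OF \<phi>(1)] g(3) DU])
          (use \<phi>(2) in \<open>simp add: D_def\<close>)
    finally show "(LBINT x. u' x * laplacian \<phi> x) = (LBINT x. g x * \<phi> x)" .
  qed (use assms(1) u' g in \<open>auto simp: U_def\<close>)
  have "(\<lambda>p. indicator (U \<times> UNIV) p *\<^sub>R (case p of (x, t) \<Rightarrow> f x t)) \<in> borel_measurable lebesgue"
  proof -
    have "open (U \<times> (UNIV :: real set))" by (auto simp: U_def intro: open_Times)
    then have "(U \<times> (UNIV :: real set)) \<inter> space lebesgue \<in> sets lebesgue" by simp
    from borel_measurable_restrict_space_iff[OF this] show ?thesis using assms(2) unfolding U_def by blast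
  qed
  from AE_borel_sections[OF this] obtain H where Hm: "H \<in> borel_measurable borel"
    and H: "AE t in lborel. AE x in lborel. indicator (U \<times> UNIV) (x, t) *\<^sub>R f x t = H (x, t)" by auto
  \<comment> \<open>The levels at which the section of f agrees almost everywhere with a Borel
    section. They have full measure, hence are dense, which is what the choice of the level in
    \<open>mollified_hessian_bound\<close> relies on.\<close>
  define S where "S = {t. AE x in lborel. x \<in> U \<longrightarrow> f x t = H (x, t)}"
  have "AE t in lborel. t \<in> S"
    using H
  proof eventually_elim
    case (elim t)
    then have "AE x in lborel. x \<in> U \<longrightarrow> f x t = H (x, t)" by eventually_elim auto
    then show ?case by (simp add: S_def)
  qed
  note dense = AE_lborel_dense[OF this]
  define F where "F t x = indicator U x * max (- M) (min M (H (x, t)))" for t x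
  have Fm: "F t \<in> borel_measurable borel" for t
  proof -
    have "(\<lambda>x. H (x, t)) \<in> borel_measurable borel" by (rule measurable_compose[OF _ Hm]) simp
    then show ?thesis unfolding F_def[abs_def] using Ub by simp
  qed
  have FM: "\<bar>F t x\<bar> \<le> M" for t x using M(1) by (auto simp: F_def indicator_def abs_le_iff)
  have F0: "F t x = 0" if "1 < norm x" for t x using that by (simp add: F_def U_def)
  have F: "AE x in lborel. x \<in> U \<longrightarrow> f x t = F t x" if "t \<in> S" for t
    using that unfolding S_def mem_Collect_eq
  proof eventually_elim
    case (elim x)
    show ?case
    proof
      assume x: "x \<in> U"
      have "\<bar>f x t\<bar> \<le> M" using fM[OF x, of t] M(2) by linarith
      then show "f x t = F t x" using elim x by (auto simp: F_def abs_le_iff max_def min_def)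
    qed
  qed
  \<comment> \<open>The equality holds at every point, since the integrals do not see the null set
    where \<open>F t\<close> and f(., t) differ. Condition (ii) of assumption A therefore carries
    over verbatim.\<close>
  have pot: "newtonian_potential f t = (\<lambda>x. LBINT y. F t y * newtonian_kernel (x - y))" if "t \<in> S" for t
  proof
    fix x
    show "newtonian_potential f t x = (LBINT y. F t y * newtonian_kernel (x - y))"
      unfolding newtonian_potential_def convolution_def
    proof (rule integral_lebesgue_AE)
      note [measurable] = Fm[of t]
      show "(\<lambda>y. F t y * newtonian_kernel (x - y)) \<in> borel_measurable borel" by measurable
      show "AE y in lborel. (if y \<in> ball 0 1 then f y t else 0) * newtonian_kernel (x - y)
          = F t y * newtonian_kernel (x - y)"
        using F[OF that] by eventually_elim (auto simp: U_def F_def)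
    qed
  qed
  \<comment> \<open>Almost everywhere \<open>g y\<close> and \<open>F t y\<close> are values of f at
    the same point, at the levels \<open>u' y\<close> and \<open>t\<close>, so condition (i) of
    assumption A applies directly.\<close>
  have diff: "AE y in lborel. norm y < 3 / 4 \<longrightarrow> \<bar>g y - F t y\<bar> \<le> \<bar>Ch\<bar> * \<omega> \<bar>u' y - t\<bar>" if "t \<in> S" for t
    using g(3) u'(4) F[OF that] hC
  proof eventually_elim
    case (elim y)
    show ?case
    proof
      assume "norm y < 3 / 4"
      then have y: "y \<in> D" "y \<in> U" by (auto simp: D_def U_def)
      then have "\<bar>g y - F t y\<bar> = \<bar>f y (u' y) - f y t\<bar>" using elim by auto
      also have "\<dots> \<le> h y * \<omega> \<bar>u' y - t\<bar>" by (rule fh[OF y(2)])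
      also have "\<dots> \<le> \<bar>Ch\<bar> * \<omega> \<bar>u' y - t\<bar>" using elim y(2) by (intro mult_right_mono \<omega>0) auto
      finally show "\<bar>g y - F t y\<bar> \<le> \<bar>Ch\<bar> * \<omega> \<bar>u' y - t\<bar>" .
    qed
  qed
  have pairing: "\<exists>K. \<forall>t\<in>S \<inter> {a..b}. \<forall>\<phi> i j. smooth \<phi> \<longrightarrow> (\<forall>z. 7 / 8 < norm z \<longrightarrow> \<phi> z = 0) \<longrightarrow> i \<in> Basis \<longrightarrow> j \<in> Basis \<longrightarrow>
      \<bar>LBINT x. F t x * iter_partial [i, j] \<phi> x\<bar> \<le> K * (LBINT x. \<bar>laplacian \<phi> x\<bar>)" for a b
  proof -
    \<comment> \<open>The bound is uniform over the interval of levels, and this makes the final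
      constant independent of \<open>t\<close>.\<close>
    obtain C where C: "\<forall>t\<in>{a..b}. weak_hessian_bound U (newtonian_potential f t) C" using hess[of a b]
        by (elim exE)
    show ?thesis
    proof (intro exI ballI allI impI)
      fix t :: real and \<phi> :: "'a \<Rightarrow> real" and i j :: 'a
      assume t: "t \<in> S \<inter> {a..b}" and \<phi>: "smooth \<phi>" "\<forall>z. 7 / 8 < norm z \<longrightarrow> \<phi> z = 0" and ij: "i \<in> Basis" "j \<in> Basis"
      have w: "weak_hessian_bound (ball 0 1) (\<lambda>x. LBINT y. F t y * newtonian_kernel (x - y)) C"
      proof -
        have "t \<in> S" "t \<in> {a..b}" using t by auto
        then have "weak_hessian_bound (ball 0 1) (newtonian_potential f t) C" using C unfolding U_def by blast
        then show ?thesis unfolding pot[OF \<open>t \<in> S\<close>] .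
      qed
      have \<phi>0: "\<phi> z = 0" if "7 / 8 < norm z" for z using \<phi>(2) that by blast
      show "\<bar>LBINT x. F t x * iter_partial [i, j] \<phi> x\<bar> \<le>
         kernel_const DIM('a) / (LBINT z. kernel_density (z::'a)) * \<bar>C\<bar> * (LBINT x. \<bar>laplacian \<phi> x\<bar>)"
        by (rule newtonian_potential_hessian_pairing[OF assms(1) Fm FM F0 w \<phi>(1) \<phi>0 ij])
    qed
  qed
  have uV: "L_infty V u" by (rule L_infty_subset[OF u VU Vb Ub])
  have "\<exists>G. L_infty V G \<and> weak_deriv V ds u G" if ds: "ds \<in> lists Basis" "length ds \<le> 2" for ds
  proof (cases "ds = []")
    case True
    then show ?thesis
      using uV L_infty_locally_integrable[OF uV Vb] by (auto simp: weak_deriv_def)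
  next
    case False
    have "\<exists>B. \<forall>k\<ge>3. \<forall>x. norm x \<le> 1 / 2 \<longrightarrow> \<bar>mollified ds k x\<bar> \<le> B"
    proof (cases "length ds = 1")
      case True
      then obtain B where "\<forall>k\<ge>3. \<forall>x. norm x \<le> 3 / 4 \<longrightarrow> \<bar>mollified ds k x\<bar> \<le> B"
        using mollified_gradient_bound[OF ds(1)] by blast
      then show ?thesis by (intro exI[of _ B]) auto
    next
      case len: False
      \<comment> \<open>\<open>remdups_adj.cases\<close> splits a list into length 0, length 1 and
        length at least 2; here exactly two directions remain.\<close>
      then obtain b b' where b: "ds = [b, b']"
        using False ds(2) by (cases ds rule: remdups_adj.cases) auto
      then have "b \<in> Basis" "b' \<in> Basis" using ds(1) by auto
      from mollified_hessian_bound[OF this \<omega> abs_ge_zero dense Fm FM diff pairing]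
      show ?thesis unfolding b .
    qed
    then obtain B where B: "\<And>k x. 3 \<le> k \<Longrightarrow> norm x \<le> 1 / 2 \<Longrightarrow> \<bar>mollified ds k x\<bar> \<le> B" by blast
    from bounded_weak_derivative[OF ds(1) B] obtain G where G: "L_infty V G" and
      eq: "\<And>\<phi>. \<phi> \<in> test_functions V \<Longrightarrow> (LBINT x. u' x * iter_partial ds \<phi> x)
          = (- 1) ^ length ds * (LINT x:V|lebesgue. G x * \<phi> x)"
      unfolding V_def by blast
    have "(LINT x:V|lebesgue. u x * iter_partial ds \<phi> x) = (- 1) ^ length ds * (LINT x:V|lebesgue. G x * \<phi> x)"
      if \<phi>: "\<phi> \<in> test_functions V" for \<phi>
    proof -
      have "AE x in lborel. x \<in> V \<longrightarrow> u x = u' x" using u'(4) by eventually_elim (use VU in auto)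
      from set_integral_lebesgue_AE[OF u'(1) iter_partial_measurable[OF test_functionsD(1)[OF \<phi>] ds(1)] this
          order_refl test_functionsD(2)[OF \<phi>]]
      show ?thesis using eq[OF \<phi>] by simp
    qed
    then have "weak_deriv V ds u G"
      unfolding weak_deriv_def using L_infty_locally_integrable[OF uV Vb] L_infty_locally_integrable[OF G
          Vb] by blast
    then show ?thesis using G by blast
  qed
  then show ?thesis unfolding C11_on_def W_infty_def V_def by blast
qed

end
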